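(* There exists a constant $\delta>0$ such that $[1-\delta,1]\subseteq \Pi$, where $\Pi\subseteq[0,1]$ is the set of uniform Turán densities of possibly infinite families of $3$-graphs. In particular, $\Pi$ has positive Lebesgue measure and Hausdorff dimension $1$.
   Context: A $3$-graph is a finite $3$-uniform hypergraph. For a $3$-graph $H$ and $U\subseteq V(H)$, $e_H(U)$ is the number of edges of $H$ contained in $U$. For $d\in[0,1]$ and $\eta>0$, a $3$-graph $H$ on $n$ vertices is uniformly $(d,\eta)$-dense if $e_H(U)\ge d\binom{|U|}{3}-\eta n^3$ for every $U\subseteq V(H)$. For a family $\mathcal F$ of $3$-graphs (possibly infinite, possibly empty), $H$ is $\mathcal F$-free if it contains no member of $\mathcal F$ as a (not necessarily induced) subgraph. The uniform Turán density $\pi(\mathcal F)$ is the supremum, taken in $[0,1]$ (with $\sup\varnothing=0$), of the set of all $d\in[0,1]$ such that for every $\eta>0$ and $n_0\in\mathbb N$ there exists an $\mathcal F$-free, uniformly $(d,\eta)$-dense $3$-graph on at least $n_0$ vertices. Finally, $\Pi=\{\pi(\mathcal F):\mathcal F\text{ is a possibly infinite family of }3\text{-graphs}\}$; the empty family $\mathcal F=\varnothing$ is allowed. *)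

theory Defs
  imports "HOL-Analysis.Analysis"
begin

record 'a hgraph =
  verts :: "'a set"
  edges :: "'a set set"

definition three_graph :: "'a hgraph \<Rightarrow> bool" where
  "three_graph H \<longleftrightarrow>
     finite (verts H) \<and> (\<forall>e\<in>edges H. e \<subseteq> verts H \<and> card e = 3)"

definition edges_in :: "'a hgraph \<Rightarrow> 'a set \<Rightarrow> nat" where
  "edges_in H U = card {e \<in> edges H. e \<subseteq> U}"

definition uniformly_dense :: "real \<Rightarrow> real \<Rightarrow> 'a hgraph \<Rightarrow> bool" where
  "uniformly_dense d \<eta> H \<longleftrightarrow>
     (\<forall>U\<subseteq>verts H.
        real (edges_in H U) \<ge> d * real (card U choose 3) - \<eta> * real (card (verts H)) ^ 3)"

definition contains_copy :: "'a hgraph \<Rightarrow> 'b hgraph \<Rightarrow> bool" where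
  "contains_copy H F \<longleftrightarrow>
     (\<exists>\<phi>. inj_on \<phi> (verts F) \<and> \<phi> ` verts F \<subseteq> verts H \<and> (\<forall>e\<in>edges F. \<phi> ` e \<in> edges H))"

definition free_of :: "'b hgraph set \<Rightarrow> 'a hgraph \<Rightarrow> bool" where
  "free_of \<F> H \<longleftrightarrow> (\<forall>F\<in>\<F>. \<not> contains_copy H F)"

(* Every finite 3-graph is isomorphic to one whose vertices are natural numbers, and
   all notions here are isomorphism invariant, so it is enough to let both the members of
   the families and the host 3-graphs range over 3-graphs on finite sets of naturals. *)

definition achievable_densities :: "nat hgraph set \<Rightarrow> real set" where
  "achievable_densities \<F> =
     {d \<in> {0..1}. \<forall>\<eta>>0. \<forall>n\<^sub>0::nat. \<exists>H::nat hgraph.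
        three_graph H \<and> card (verts H) \<ge> n\<^sub>0 \<and> free_of \<F> H \<and> uniformly_dense d \<eta> H}"

(* The case distinction is needed because Sup {} is unspecified on the reals. *)
definition uniform_turan_density :: "nat hgraph set \<Rightarrow> real" where
  "uniform_turan_density \<F> =
     (if achievable_densities \<F> = {} then 0 else Sup (achievable_densities \<F>))"

definition uniform_turan_densities :: "real set" where
  "uniform_turan_densities =
     {uniform_turan_density \<F> | \<F>. \<forall>F\<in>\<F>. three_graph F}"

(* (diam U)^s with the conventions diam({})^s = 0 and 0^0 = 1 (whereas 0 powr 0 = 0),
   so that the 0-dimensional Hausdorff measure is counting measure.
   Only meaningful for bounded U, since diameter is unspecified on unbounded sets. *)
definition diam_power :: "real \<Rightarrow> 'a::metric_space set \<Rightarrow> ennreal" where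
  "diam_power s U =
     (if U = {} then 0 else if s = 0 then 1 else ennreal (diameter U powr s))"

definition hausdorff_premeasure :: "real \<Rightarrow> real \<Rightarrow> 'a::metric_space set \<Rightarrow> ennreal" where
  "hausdorff_premeasure s \<epsilon> A =
     Inf {\<Sum>i. diam_power s (U i) | U :: nat \<Rightarrow> 'a set.
            A \<subseteq> (\<Union>i. U i) \<and> (\<forall>i. bounded (U i) \<and> diameter (U i) \<le> \<epsilon>)}"

definition hausdorff_measure :: "real \<Rightarrow> 'a::metric_space set \<Rightarrow> ennreal" where
  "hausdorff_measure s A = (SUP \<epsilon>\<in>{0<..}. hausdorff_premeasure s \<epsilon> A)"

definition hausdorff_dim :: "'a::metric_space set \<Rightarrow> ennreal" where
  "hausdorff_dim A = Inf {ennreal s | s. s \<ge> 0 \<and> hausdorff_measure s A = 0}"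

lemma uniform_turan_densities_subset: "uniform_turan_densities \<subseteq> {0..1}"
proof
  fix x assume "x \<in> uniform_turan_densities"
  then obtain \<F> where x: "x = uniform_turan_density \<F>"
    unfolding uniform_turan_densities_def by blast
  have sub: "achievable_densities \<F> \<subseteq> {0..1}"
    unfolding achievable_densities_def by blast
  show "x \<in> {0..1}"
  proof (cases "achievable_densities \<F> = {}")
    case True
    then show ?thesis using x by (simp add: uniform_turan_density_def)
  next
    case False
    have "bdd_above (achievable_densities \<F>)"
      by (rule bdd_above_mono[OF bdd_above_Icc sub])
    moreover obtain d where "d \<in> achievable_densities \<F>" using False by blast
    ultimately have "0 \<le> Sup (achievable_densities \<F>)"
      using sub by (meson atLeastAtMost_iff cSup_upper order_trans subsetD)
    moreover have "Sup (achievable_densities \<F>) \<le> 1"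
      using False sub by (intro cSup_least) auto
    ultimately show ?thesis using False x by (simp add: uniform_turan_density_def)
  qed
qed

end

theory Submission
  imports Defs "HOL-Probability.Probability" "HOL-Library.Ramsey"
begin

text \<open>
  Every number in \<open>[1 - \<delta>, 1]\<close> is realised by a class of 3-graphs defined by colouring pairs of
  vertices. A palette is a finite set \<open>C\<close> of colours with a symmetric ternary relation \<open>D\<close> of forbidden
  colour triples; a 3-graph is paintable if the pairs of vertices can be coloured so that no edge
  sees a forbidden triple. The largest uniform density of large paintable 3-graphs is
  \<open>1 - min forbidden_mass C D p\<close>, the minimum being over probability vectors \<open>p\<close> on \<open>C\<close>. Colouring the
  pairs independently with distribution \<open>p\<close> and keeping all triples that are not forbidden attains
  this (\<open>uniform_random_colouring\<close>). Conversely, in any colouring some set of linear size has a fraction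
  of forbidden triples close to the minimum or more (\<open>paintable_not_dense\<close>): regularity and Ramsey's
  theorem give many vertex classes such that the colours between any two of them are distributed
  almost regularly, with the same density vector for all pairs.

  A palette alone yields countably many densities. A continuum comes from infinite decreasing
  sequences of palettes, each mapping homomorphically to the previous one. If their minima converge
  to \<open>\<beta>\<close>, the 3-graphs paintable by all of them have density exactly \<open>1 - \<beta>\<close>
  (\<open>density_of_palette_sequence\<close>). The lower bound survives the passage to the limit because the
  number of vertices that the random colouring needs depends on the error only, not on the palette.

  To steer the minimum to a prescribed \<open>\<beta>\<close>, suppose that it is below \<open>\<beta>\<close> by at most \<open>\<Delta>\<close>. Split every
  colour into \<open>S\<close> copies and also forbid the triples of two colours of a group \<open>X\<close> with the same copy
  number and a colour of a group \<open>Y\<close>. This raises the minimum by an amount of order \<open>1/S\<close>. With \<open>S\<close>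
  the least number for which the minimum stays below \<open>\<beta>\<close>, the remaining gap is at most the effect of
  passing from \<open>S\<close> to \<open>S - 1\<close>, hence \<open>O(1/S^2) = O(\<Delta>^2)\<close>. Near the optimum the mass of \<open>X\<close> is spread
  almost evenly over its copies, so two halves of the copies are two new groups of substantial mass,
  and the construction can be repeated (\<open>refinement_step\<close>). The groups lose a constant factor of
  mass in each step, which the quadratic decrease of the gap outweighs.

  Starting from three colours of which only the monochromatic triples are forbidden, with minimum
  \<open>1/9\<close>, this reaches all \<open>\<beta>\<close> in a short interval to the right of \<open>1/9\<close>. Taking \<open>m\<close> disjoint copies of
  a palette without forbidding triples across copies divides the minimum by \<open>m^2\<close>; for large \<open>m\<close> the
  scaled intervals overlap and cover some \<open>(0, \<delta>]\<close> (\<open>interval_in_uniform_turan_densities\<close>).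

  Containing an interval gives the Hausdorff dimension and a positive lower bound on the measure of
  any measurable superset. That the set of densities is measurable needs its own argument, since
  families range over an uncountable set: being a density is expressed by a Souslin scheme of Borel
  sets (\<open>density_iff_witnesses\<close>), and the Souslin operation preserves Lebesgue measurability
  (\<open>souslin_operation_lebesgue\<close>).
\<close>

section \<open>Copies and monotonicity of uniform density\<close>

lemma contains_copy_refl: "contains_copy H H"
  unfolding contains_copy_def by (intro exI[of _ "\<lambda>x. x"]) auto

lemma contains_copy_trans:
  assumes "contains_copy H G" "contains_copy G F"
  shows "contains_copy H F"
proof -
  obtain \<phi> where \<phi>: "inj_on \<phi> (verts G)" "\<phi> ` verts G \<subseteq> verts H" "\<forall>e\<in>edges G. \<phi> ` e \<in> edges H"
    using assms(1) unfolding contains_copy_def by blast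
  obtain \<psi> where \<psi>: "inj_on \<psi> (verts F)" "\<psi> ` verts F \<subseteq> verts G" "\<forall>e\<in>edges F. \<psi> ` e \<in> edges G"
    using assms(2) unfolding contains_copy_def by blast
  show ?thesis unfolding contains_copy_def
  proof (intro exI[of _ "\<phi> \<circ> \<psi>"] conjI ballI)
    show "inj_on (\<phi> \<circ> \<psi>) (verts F)" using \<phi>(1) \<psi>(1,2) by (intro comp_inj_on) (auto intro: inj_on_subset)
    show "(\<phi> \<circ> \<psi>) ` verts F \<subseteq> verts H" using \<phi>(2) \<psi>(2) by auto
    show "(\<phi> \<circ> \<psi>) ` e \<in> edges H" if "e \<in> edges F" for e
      using \<phi>(3) \<psi>(3) that by (metis image_comp)
  qed
qed

lemma card_verts_copy_le:
  assumes "contains_copy H G" "three_graph H"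
  shows "card (verts G) \<le> card (verts H)"
  using assms unfolding contains_copy_def three_graph_def by (metis card_inj_on_le)

lemma uniformly_dense_mono:
  assumes "uniformly_dense d \<eta> H" "d' \<le> d" "\<eta> \<le> \<eta>'"
  shows "uniformly_dense d' \<eta>' H"
  unfolding uniformly_dense_def
proof (intro allI impI)
  fix U assume "U \<subseteq> verts H"
  then have "d * real (card U choose 3) - \<eta> * real (card (verts H)) ^ 3 \<le> real (edges_in H U)"
    using assms(1) unfolding uniformly_dense_def by blast
  moreover have "d' * real (card U choose 3) \<le> d * real (card U choose 3)" using assms by (intro mult_right_mono) auto
  moreover have "\<eta> * real (card (verts H)) ^ 3 \<le> \<eta>' * real (card (verts H)) ^ 3" using assms by (intro mult_right_mono) auto
  ultimately show "d' * real (card U choose 3) - \<eta>' * real (card (verts H)) ^ 3 \<le> real (edges_in H U)" by linarith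
qed

section \<open>Palettes\<close>

definition symmetric_relation :: "('c \<Rightarrow> 'c \<Rightarrow> 'c \<Rightarrow> bool) \<Rightarrow> bool" where
  "symmetric_relation D \<longleftrightarrow> (\<forall>a b c. D a b c = D b a c \<and> D a b c = D a c b)"

definition probability_on :: "'c set \<Rightarrow> ('c \<Rightarrow> real) \<Rightarrow> bool" where
  "probability_on C p \<longleftrightarrow> (\<forall>a\<in>C. 0 \<le> p a) \<and> sum p C = 1"

text \<open>The probability that a random triple of colours is forbidden. Weights that do not sum to one are
  allowed too: the densities of the colours between two vertex classes form a probability vector only
  up to a regularity error.\<close>

definition forbidden_mass :: "'c set \<Rightarrow> ('c \<Rightarrow> 'c \<Rightarrow> 'c \<Rightarrow> bool) \<Rightarrow> ('c \<Rightarrow> real) \<Rightarrow> real" where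
  "forbidden_mass C D p = (\<Sum>a\<in>C. \<Sum>b\<in>C. \<Sum>c\<in>C. of_bool (D a b c) * (p a * p b * p c))"

text \<open>Some ordering of the three vertices violates \<open>D\<close>; for symmetric \<open>D\<close> and distinct vertices every ordering
  then does. The colouring is a function on all sets, of which only the values on pairs matter.\<close>

definition forbidden_triple :: "('c \<Rightarrow> 'c \<Rightarrow> 'c \<Rightarrow> bool) \<Rightarrow> ('v set \<Rightarrow> 'c) \<Rightarrow> 'v set \<Rightarrow> bool" where
  "forbidden_triple D f t \<longleftrightarrow> (\<exists>u v w. t = {u, v, w} \<and> D (f {u, v}) (f {u, w}) (f {v, w}))"

definition paintable :: "'c set \<Rightarrow> ('c \<Rightarrow> 'c \<Rightarrow> 'c \<Rightarrow> bool) \<Rightarrow> 'v hgraph \<Rightarrow> bool" where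
  "paintable C D H \<longleftrightarrow> (\<exists>f. (\<forall>t. f t \<in> C) \<and> (\<forall>t\<in>edges H. \<not> forbidden_triple D f t))"

text \<open>Merging colours along \<open>h\<close> creates no new forbidden triple, so that colourings can be pushed forward.\<close>

definition palette_hom ::
  "('c \<Rightarrow> 'd) \<Rightarrow> 'c set \<Rightarrow> ('c \<Rightarrow> 'c \<Rightarrow> 'c \<Rightarrow> bool) \<Rightarrow> 'd set \<Rightarrow> ('d \<Rightarrow> 'd \<Rightarrow> 'd \<Rightarrow> bool) \<Rightarrow> bool" where
  "palette_hom h C D C' D' \<longleftrightarrow> h ` C \<subseteq> C' \<and> (\<forall>a b c. D' (h a) (h b) (h c) \<longrightarrow> D a b c)"

lemma paintable_hom:
  assumes "palette_hom h C D C' D'" "paintable C D H"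
  shows "paintable C' D' H"
proof -
  obtain f where "\<forall>t. f t \<in> C" "\<forall>t\<in>edges H. \<not> forbidden_triple D f t" using assms(2) unfolding paintable_def by blast
  then show ?thesis unfolding paintable_def
    by (intro exI[of _ "h \<circ> f"]) (use assms(1) in \<open>fastforce simp: palette_hom_def forbidden_triple_def\<close>)
qed

text \<open>The colouring is pulled back along the embedding. Hence the 3-graphs that are not paintable can
  serve as a forbidden family whose free 3-graphs are exactly the paintable ones.\<close>

lemma paintable_copy:
  assumes "contains_copy H G" "paintable C D H"
  shows "paintable C D G"
proof -
  obtain f where f: "\<forall>t. f t \<in> C" "\<forall>t\<in>edges H. \<not> forbidden_triple D f t" using assms(2) unfolding paintable_def by blast
  obtain \<phi> where \<phi>: "\<forall>e\<in>edges G. \<phi> ` e \<in> edges H" using assms(1) unfolding contains_copy_def by blast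
  have "\<not> forbidden_triple D (\<lambda>t. f (\<phi> ` t)) e" if "e \<in> edges G" for e
  proof
    assume "forbidden_triple D (\<lambda>t. f (\<phi> ` t)) e"
    then obtain u v w where "e = {u, v, w}" "D (f (\<phi> ` {u, v})) (f (\<phi> ` {u, w})) (f (\<phi> ` {v, w}))"
      unfolding forbidden_triple_def by blast
    then have "forbidden_triple D f (\<phi> ` e)" unfolding forbidden_triple_def
      by (intro exI[of _ "\<phi> u"] exI[of _ "\<phi> v"] exI[of _ "\<phi> w"]) simp
    then show False using f \<phi> that by blast
  qed
  then show ?thesis unfolding paintable_def using f by (intro exI[of _ "\<lambda>t. f (\<phi> ` t)"]) auto
qed

lemma forbidden_mass_nonneg:
  assumes "\<And>a. a \<in> C \<Longrightarrow> 0 \<le> p a"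
  shows "0 \<le> forbidden_mass C D p"
  unfolding forbidden_mass_def by (intro sum_nonneg mult_nonneg_nonneg) (use assms in auto)

lemma forbidden_mass_scale: "forbidden_mass C D (\<lambda>a. t * p a) = t ^ 3 * forbidden_mass C D p"
  unfolding forbidden_mass_def sum_distrib_left by (intro sum.cong refl) (simp add: power3_eq_cube)

text \<open>The forbidden mass is homogeneous of degree three.\<close>

lemma forbidden_mass_homogeneous_bound:
  assumes "\<And>p. probability_on C p \<Longrightarrow> b \<le> forbidden_mass C D p" "\<And>a. a \<in> C \<Longrightarrow> 0 \<le> q a"
  shows "b * (sum q C) ^ 3 \<le> forbidden_mass C D q"
proof (cases "sum q C = 0")
  case True
  then show ?thesis using forbidden_mass_nonneg[of C q D] assms(2) by simp
next
  case False
  moreover have "0 \<le> sum q C" using assms(2) by (intro sum_nonneg)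
  ultimately have pos: "0 < sum q C" by simp
  have "probability_on C (\<lambda>a. (1 / sum q C) * q a)"
    using assms(2) pos by (simp add: probability_on_def flip: sum_divide_distrib)
  then have "b \<le> forbidden_mass C D (\<lambda>a. (1 / sum q C) * q a)" by (rule assms(1))
  then have "b \<le> (1 / sum q C) ^ 3 * forbidden_mass C D q" by (simp only: forbidden_mass_scale)
  then show ?thesis using pos by (simp add: field_simps)
qed

section \<open>Counting triples\<close>

text \<open>A set of three elements has only one increasing enumeration, with respect to any labelling \<open>h\<close>. The
  labelling is the identity for numbers and the index of the class for vertices in disjoint classes.\<close>

lemma increasing_triple_unique:
  fixes h :: "'a \<Rightarrow> 'b::linorder"
  assumes "{x, y, z} = {x', y', z'}" "h x < h y" "h y < h z" "h x' < h y'" "h y' < h z'"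
  shows "x = x' \<and> y = y' \<and> z = z'"
proof -
  have 1: "x' = x \<or> x' = y \<or> x' = z" and 2: "y' = x \<or> y' = y \<or> y' = z" and 3: "z' = x \<or> z' = y \<or> z' = z"
    using assms(1) by blast+
  have "h x < h z" "h x' < h z'" using assms by (blast intro: less_trans)+
  with 1 2 3 assms(2-5) show ?thesis
    by (elim disjE; simp; order)
qed

lemma bij_betw_increasing_triples:
  fixes I :: "'a::linorder set"
  shows "bij_betw (\<lambda>(i, j, l). {i, j, l}) {(i, j, l). i \<in> I \<and> j \<in> I \<and> l \<in> I \<and> i < j \<and> j < l} {t. t \<subseteq> I \<and> card t = 3}"
proof (rule bij_betw_imageI)
  show "inj_on (\<lambda>(i, j, l). {i, j, l}) {(i, j, l). i \<in> I \<and> j \<in> I \<and> l \<in> I \<and> i < j \<and> j < l}"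
    unfolding inj_on_def by (auto dest!: increasing_triple_unique[where h = "\<lambda>x. x"])
  show "(\<lambda>(i, j, l). {i, j, l}) ` {(i, j, l). i \<in> I \<and> j \<in> I \<and> l \<in> I \<and> i < j \<and> j < l} = {t. t \<subseteq> I \<and> card t = 3}" (is "?L = ?R")
  proof
    show "?L \<subseteq> ?R" by (auto simp: card_insert_if)
    show "?R \<subseteq> ?L"
    proof
      fix t assume "t \<in> ?R"
      then obtain x y z where t: "t = {x, y, z}" "x \<noteq> y" "x \<noteq> z" "y \<noteq> z" "t \<subseteq> I"
        by (auto simp: card_3_iff)
      have perm: "t = {x, z, y}" "t = {y, x, z}" "t = {y, z, x}" "t = {z, x, y}" "t = {z, y, x}"
        unfolding t(1) by blast+
      consider "x < y" "y < z" | "x < z" "z < y" | "y < x" "x < z" | "y < z" "z < x" | "z < x" "x < y" | "z < y" "y < x"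
        using t(2-4) by (metis linorder_neqE)
      then have "\<exists>i j l. i < j \<and> j < l \<and> t = {i, j, l}"
        by cases (use t(1) perm in metis)+
      then obtain i j l where "i < j" "j < l" "t = {i, j, l}" by blast
      then show "t \<in> ?L" using t(5) by (intro image_eqI[of _ _ "(i, j, l)"]) auto
    qed
  qed
qed

lemma choose_3_real: "real (n choose 3) = real n * (real n - 1) * (real n - 2) / 6"
proof (cases "n < 3")
  case True
  then have "n = 0 \<or> n = 1 \<or> n = 2" by auto
  then show ?thesis by auto
next
  case False
  then have "real (n choose 3) = (\<Prod>i = 0..<3. real n - real i) / fact 3"
    by (simp add: binomial_gbinomial gbinomial_prod_rev)
  also have "{0..<3::nat} = {0, 1, 2}" by auto
  finally show ?thesis by (simp add: fact_numeral)
qed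

lemma choose_3_le: "real (n choose 3) \<le> real n ^ 3 / 6"
proof -
  have "real n * (real n - 1) * (real n - 2) \<le> real n ^ 3"
  proof (cases "n \<le> 1")
    case True then have "n = 0 \<or> n = 1" by auto
    then show ?thesis by auto
  next
    case False
    then have "real n * (real n - 1) * (real n - 2) \<le> real n * real n * real n"
      by (intro mult_mono) auto
    then show ?thesis by (simp add: power3_eq_cube)
  qed
  then show ?thesis by (simp add: choose_3_real)
qed

lemma choose_3_ge: "real n ^ 3 / 6 - real n ^ 2 / 2 \<le> real (n choose 3)"
proof -
  have "real (n choose 3) = real n ^ 3 / 6 - real n ^ 2 / 2 + real n / 3"
    unfolding choose_3_real power3_eq_cube power2_eq_square by (simp add: algebra_simps add_divide_distrib diff_divide_distrib)
  then show ?thesis by simp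
qed

section \<open>Regular pairs\<close>

text \<open>The error is measured against the size of the whole pair, so that subsets of arbitrary size are
  allowed. The density vector \<open>d\<close> is a parameter rather than the true density, which makes it possible
  to prescribe the same rounded vector for many pairs.\<close>

definition regular_pair :: "'c set \<Rightarrow> ('v \<Rightarrow> 'w \<Rightarrow> 'c) \<Rightarrow> 'v set \<Rightarrow> 'w set \<Rightarrow> ('c \<Rightarrow> real) \<Rightarrow> real \<Rightarrow> bool" where
  "regular_pair C g A B d \<epsilon> \<longleftrightarrow>
     (\<forall>a\<in>C. \<forall>A'\<subseteq>A. \<forall>B'\<subseteq>B.
        \<bar>\<Sum>x\<in>A'. \<Sum>y\<in>B'. of_bool (g x y = a) - d a\<bar> \<le> \<epsilon> * real (card A) * real (card B))"

lemma regular_pairD: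
  assumes "regular_pair C g A B d \<epsilon>" "a \<in> C" "A' \<subseteq> A" "B' \<subseteq> B"
  shows "\<bar>\<Sum>x\<in>A'. \<Sum>y\<in>B'. of_bool (g x y = a) - d a\<bar> \<le> \<epsilon> * real (card A) * real (card B)"
  using assms unfolding regular_pair_def by blast

lemma regular_pair_subset:
  assumes "regular_pair C g A B d \<epsilon>" "A' \<subseteq> A" "B' \<subseteq> B" "0 < \<gamma>" "0 \<le> \<epsilon>"
    and "\<gamma> * real (card A) \<le> real (card A')" "\<gamma> * real (card B) \<le> real (card B')"
  shows "regular_pair C g A' B' d (\<epsilon> / \<gamma>\<^sup>2)"
  unfolding regular_pair_def
proof (intro ballI allI impI)
  fix a P Q assume a: "a \<in> C" and PQ: "P \<subseteq> A'" "Q \<subseteq> B'"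
  have "\<bar>\<Sum>x\<in>P. \<Sum>y\<in>Q. of_bool (g x y = a) - d a\<bar> \<le> \<epsilon> * real (card A) * real (card B)"
    using assms(1) a PQ assms(2,3) unfolding regular_pair_def by blast
  also have "\<dots> = \<epsilon> / \<gamma>\<^sup>2 * ((\<gamma> * real (card A)) * (\<gamma> * real (card B)))"
    using assms(4) by (simp add: power2_eq_square)
  also have "\<dots> \<le> \<epsilon> / \<gamma>\<^sup>2 * (real (card A') * real (card B'))"
    using assms by (intro mult_left_mono mult_mono) auto
  finally show "\<bar>\<Sum>x\<in>P. \<Sum>y\<in>Q. of_bool (g x y = a) - d a\<bar> \<le> \<epsilon> / \<gamma>\<^sup>2 * real (card A') * real (card B')"
    by (simp add: mult.assoc)
qed

lemma regular_pair_round: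
  assumes "regular_pair C g A B d \<epsilon>" "\<And>a. a \<in> C \<Longrightarrow> \<bar>d a - d' a\<bar> \<le> \<delta>" "finite A" "finite B"
  shows "regular_pair C g A B d' (\<epsilon> + \<delta>)"
  unfolding regular_pair_def
proof (intro ballI allI impI)
  fix a P Q assume a: "a \<in> C" and PQ: "P \<subseteq> A" "Q \<subseteq> B"
  have 1: "\<bar>\<Sum>x\<in>P. \<Sum>y\<in>Q. of_bool (g x y = a) - d a\<bar> \<le> \<epsilon> * real (card A) * real (card B)"
    using assms(1) a PQ unfolding regular_pair_def by blast
  have "(\<Sum>x\<in>P. \<Sum>y\<in>Q. of_bool (g x y = a) - d' a) =
      (\<Sum>x\<in>P. \<Sum>y\<in>Q. of_bool (g x y = a) - d a) + (\<Sum>x\<in>P. \<Sum>y\<in>Q. d a - d' a)"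
    by (simp only: sum.distrib[symmetric]) simp
  moreover have "\<bar>\<Sum>x\<in>P. \<Sum>y\<in>Q. d a - d' a\<bar> \<le> \<delta> * real (card A) * real (card B)"
  proof -
    have "\<bar>\<Sum>x\<in>P. \<Sum>y\<in>Q. d a - d' a\<bar> = real (card P) * (real (card Q) * \<bar>d a - d' a\<bar>)"
      by (simp add: abs_mult)
    also have "\<dots> \<le> real (card A) * (real (card B) * \<delta>)"
      by (intro mult_mono) (use PQ assms a in \<open>auto intro: card_mono\<close>)
    finally show ?thesis by (simp add: mult_ac)
  qed
  ultimately show "\<bar>\<Sum>x\<in>P. \<Sum>y\<in>Q. of_bool (g x y = a) - d' a\<bar> \<le> (\<epsilon> + \<delta>) * real (card A) * real (card B)"
    using 1 by (simp add: algebra_simps)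
qed

text \<open>Unlike in Szemeredi's lemma, one regular pair is enough, and it is found by an extremal argument:
  take the pair of nonempty subsets that maximises \<open>\<Phi>\<close>, the sum of the squared colour densities plus
  a small multiple of the logarithm of the size. The energy is bounded by the number of colours, so the
  logarithm keeps the maximiser from being small. If the maximiser had an irregular subpair, then
  cutting it into four cells would increase the average energy by more than the logarithm can lose, and
  some cell would beat it.\<close>

lemma regular_subpair_exists:
  fixes C :: "'c set" and \<epsilon> :: real
  assumes "finite C" "0 < \<epsilon>"
  obtains \<gamma> where "0 < \<gamma>"
    "\<And>(A :: 'v set) (B :: 'w set) g. finite A \<Longrightarrow> A \<noteq> {} \<Longrightarrow> finite B \<Longrightarrow> B \<noteq> {} \<Longrightarrow>
       \<exists>A' B' d. A' \<subseteq> A \<and> B' \<subseteq> B \<and> \<gamma> * real (card A) \<le> real (card A') \<and> \<gamma> * real (card B) \<le> real (card B')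
         \<and> (\<forall>a::'c. 0 \<le> d a \<and> d a \<le> 1) \<and> regular_pair C g A' B' d \<epsilon>"
proof -
  \<comment> \<open>An irregular subpair gains \<open>\<epsilon>\<^sup>2\<close> in average energy, and cutting into four cells costs
    at most \<open>3 * c\<close> in the logarithmic term; so any \<open>c < \<epsilon>\<^sup>2 / 3\<close> works.\<close>
  define c where "c = \<epsilon>\<^sup>2 / 4"
  define \<gamma> where "\<gamma> = exp (- (real (card C) / c))"
  have c: "c > 0" using assms by (simp add: c_def)
  have \<gamma>: "\<gamma> > 0" by (simp add: \<gamma>_def)
  show ?thesis
  proof (rule that[OF \<gamma>])
    fix A0 :: "'v set" and B0 :: "'w set" and g :: "'v \<Rightarrow> 'w \<Rightarrow> 'c"
    assume fin: "finite A0" "finite B0" and ne: "A0 \<noteq> {}" "B0 \<noteq> {}"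
    define e :: "'c \<Rightarrow> 'v set \<Rightarrow> 'w set \<Rightarrow> real"
      where "e = (\<lambda>a A B. \<Sum>x\<in>A. \<Sum>y\<in>B. of_bool (g x y = a))"
    define N :: "'v set \<Rightarrow> 'w set \<Rightarrow> real" where "N = (\<lambda>A B. real (card A) * real (card B))"
    define dens where "dens = (\<lambda>a A B. e a A B / N A B)"
    define \<Phi> where "\<Phi> = (\<lambda>A B. (\<Sum>a\<in>C. (dens a A B)\<^sup>2) + c * ln (N A B))"
    have e_nonneg: "0 \<le> e a A B" for a A B by (simp add: e_def sum_nonneg)
    have e_le: "e a A B \<le> N A B" for a A B
    proof -
      have "e a A B \<le> (\<Sum>x\<in>A. \<Sum>y\<in>B. 1)" unfolding e_def by (intro sum_mono) auto
      then show ?thesis by (simp add: N_def)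
    qed
    have N_nonneg: "0 \<le> N A B" for A B by (simp add: N_def)
    have dens01: "0 \<le> dens a A B \<and> dens a A B \<le> 1" for a A B
      using e_nonneg[of a A B] e_le[of a A B] N_nonneg[of A B]
      by (cases "N A B = 0") (auto simp: dens_def divide_le_eq)
    define S where "S = {(A, B). A \<subseteq> A0 \<and> B \<subseteq> B0 \<and> A \<noteq> {} \<and> B \<noteq> {}}"
    have "finite S"
      by (rule finite_subset[of _ "Pow A0 \<times> Pow B0"]) (use fin in \<open>auto simp: S_def\<close>)
    moreover have "(A0, B0) \<in> S" using ne by (auto simp: S_def)
    ultimately have mx: "Max ((\<lambda>(A, B). \<Phi> A B) ` S) \<in> (\<lambda>(A, B). \<Phi> A B) ` S"
      "\<And>z. z \<in> S \<Longrightarrow> (\<lambda>(A, B). \<Phi> A B) z \<le> Max ((\<lambda>(A, B). \<Phi> A B) ` S)"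
      by (auto intro!: Max_in Max_ge)
    then obtain A B where zAB: "(A, B) \<in> S" "Max ((\<lambda>(A, B). \<Phi> A B) ` S) = \<Phi> A B" by auto
    have AB: "A \<subseteq> A0" "B \<subseteq> B0" "A \<noteq> {}" "B \<noteq> {}"
      using zAB by (auto simp: S_def)
    have finAB: "finite A" "finite B" using AB fin by (auto intro: finite_subset)
    have Npos: "N A B > 0" using AB finAB by (simp add: N_def card_gt_0_iff)
    have max: "\<Phi> P Q \<le> \<Phi> A B" if "P \<subseteq> A0" "Q \<subseteq> B0" "P \<noteq> {}" "Q \<noteq> {}" for P Q
    proof -
      have "(P, Q) \<in> S" using that by (auto simp: S_def)
      then show ?thesis using mx(2)[of "(P, Q)"] zAB by simp
    qed
    have N0pos: "N A0 B0 > 0" using ne fin by (simp add: N_def card_gt_0_iff)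
    have "c * ln (N A0 B0) \<le> \<Phi> A0 B0" by (simp add: \<Phi>_def sum_nonneg)
    also have "\<dots> \<le> \<Phi> A B" by (rule max) (use ne in auto)
    also have "\<dots> \<le> real (card C) + c * ln (N A B)"
    proof -
      have "(\<Sum>a\<in>C. (dens a A B)\<^sup>2) \<le> (\<Sum>a\<in>C. 1)"
        using dens01 by (intro sum_mono) (simp add: power_le_one)
      then show ?thesis by (simp add: \<Phi>_def)
    qed
    finally have "ln (N A0 B0) - real (card C) / c \<le> ln (N A B)"
      using c by (simp add: field_simps)
    then have "exp (ln (N A0 B0) - real (card C) / c) \<le> exp (ln (N A B))" by simp
    then have big: "\<gamma> * N A0 B0 \<le> N A B"
      using N0pos Npos by (simp add: exp_diff \<gamma>_def exp_minus field_simps)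
    have cA: "real (card A) \<le> real (card A0)" "real (card B) \<le> real (card B0)"
      using AB fin by (auto intro: card_mono)
    have pos: "0 < real (card A0)" "0 < real (card B0)" using ne fin by (auto simp: card_gt_0_iff)
    have "\<gamma> * real (card A0) * real (card B0) \<le> real (card A) * real (card B0)"
      using big mult_left_mono[OF cA(2), of "real (card A)"] by (simp add: N_def mult.assoc)
    then have szA: "\<gamma> * real (card A0) \<le> real (card A)" using pos by simp
    have "\<gamma> * real (card B0) * real (card A0) \<le> real (card B) * real (card A0)"
      using big mult_right_mono[OF cA(1), of "real (card B)"] by (simp add: N_def mult_ac)
    then have szB: "\<gamma> * real (card B0) \<le> real (card B)" using pos by simp
    define d where "d = (\<lambda>a. dens a A B)"
    have dN: "d a * N A B = e a A B" for a using Npos by (simp add: d_def dens_def)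
    have "regular_pair C g A B d \<epsilon>"
      unfolding regular_pair_def
    proof (intro ballI allI impI, rule ccontr)
      fix a A1 B1 assume a: "a \<in> C" and A1: "A1 \<subseteq> A" and B1: "B1 \<subseteq> B"
        and "\<not> \<bar>\<Sum>x\<in>A1. \<Sum>y\<in>B1. of_bool (g x y = a) - d a\<bar> \<le> \<epsilon> * real (card A) * real (card B)"
      then have irr: "\<epsilon> * N A B < \<bar>e a A1 B1 - d a * N A1 B1\<bar>"
        by (simp add: e_def N_def sum_subtractf mult_ac)
      define A2 where "A2 = A - A1"
      define B2 where "B2 = B - B1"
      have \<Phi>cell: "N P Q * \<Phi> P Q \<le> N P Q * \<Phi> A B" if "P \<subseteq> A" "Q \<subseteq> B" for P Q
      proof (cases "P = {} \<or> Q = {}")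
        case True then show ?thesis by (auto simp: N_def)
      next
        case False
        then show ?thesis using that AB by (intro mult_left_mono max N_nonneg) auto
      qed
      have Ne: "N P Q * (dens b P Q)\<^sup>2 - (2 * d b * e b P Q - (d b)\<^sup>2 * N P Q) = (if N P Q = 0 then 0 else (e b P Q - d b * N P Q)\<^sup>2 / N P Q)" for b P Q
        using e_nonneg[of b P Q] e_le[of b P Q] by (auto simp: dens_def field_simps power2_eq_square)
      \<comment> \<open>From \<open>ln t \<le> t - 1\<close>; summed over the four cells the loss is \<open>3 * N A B\<close>.\<close>
      have ln: "N P Q * ln (N P Q) \<ge> N P Q * ln (N A B) + N P Q - N A B" for P Q
      proof (cases "N P Q = 0")
        case True then show ?thesis using Npos by simp
      next
        case False
        then have p: "N P Q > 0" using N_nonneg[of P Q] by simp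
        have "ln (N A B / N P Q) \<le> N A B / N P Q - 1" using p Npos by (intro ln_le_minus_one) auto
        then have "N P Q * (ln (N A B) - ln (N P Q)) \<le> N P Q * (N A B / N P Q - 1)"
          using p Npos by (intro mult_left_mono) (auto simp: ln_div)
        then show ?thesis using p by (simp add: algebra_simps)
      qed
      define bonus :: "'c \<Rightarrow> 'v set \<Rightarrow> 'w set \<Rightarrow> real" where
        "bonus = (\<lambda>b P Q. if b = a \<and> P = A1 \<and> Q = B1 then \<epsilon>\<^sup>2 * N A B else 0)"
      have bonus: "N P Q * (dens b P Q)\<^sup>2 \<ge> 2 * d b * e b P Q - (d b)\<^sup>2 * N P Q + bonus b P Q" for b P Q
      proof (cases "b = a \<and> P = A1 \<and> Q = B1")
        case False
        then have "bonus b P Q = 0" unfolding bonus_def by auto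
        moreover have "0 \<le> (if N P Q = 0 then 0 else (e b P Q - d b * N P Q)\<^sup>2 / N P Q)"
          using N_nonneg[of P Q] by simp
        ultimately show ?thesis using Ne[of P Q b] by linarith
      next
        case True
        have "N A1 B1 \<noteq> 0"
        proof
          assume "N A1 B1 = 0"
          then have "e a A1 B1 = 0" using e_nonneg[of a A1 B1] e_le[of a A1 B1] by simp
          then show False using irr \<open>N A1 B1 = 0\<close> Npos assms by (simp add: mult_less_0_iff)
        qed
        then have p: "N A1 B1 > 0" using N_nonneg[of A1 B1] by simp
        have le: "N A1 B1 \<le> N A B" unfolding N_def
          by (intro mult_mono) (use A1 B1 finAB in \<open>auto intro: card_mono\<close>)
        have "(\<epsilon> * N A B)\<^sup>2 \<le> (e a A1 B1 - d a * N A1 B1)\<^sup>2"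
          using irr assms Npos by (simp add: abs_le_square_iff[symmetric])
        then have "\<epsilon>\<^sup>2 * N A B * N A B \<le> (e a A1 B1 - d a * N A1 B1)\<^sup>2"
          by (simp add: power2_eq_square mult_ac)
        moreover have "\<epsilon>\<^sup>2 * N A B * N A1 B1 \<le> \<epsilon>\<^sup>2 * N A B * N A B"
          by (intro mult_left_mono le) (use Npos in auto)
        ultimately have "\<epsilon>\<^sup>2 * N A B \<le> (e a A1 B1 - d a * N A1 B1)\<^sup>2 / N A1 B1"
          using p by (simp add: le_divide_eq)
        then show ?thesis using Ne[of A1 B1 a] p True by (simp add: bonus_def)
      qed
      have part: "e b A B = e b A1 B1 + e b A1 B2 + e b A2 B1 + e b A2 B2" for b
      proof -
        have s1: "(\<Sum>x\<in>A. h x) = (\<Sum>x\<in>A1. h x) + (\<Sum>x\<in>A2. h x)" for h :: "'v \<Rightarrow> real"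
          unfolding A2_def using sum.subset_diff[OF A1 finAB(1), of h] by simp
        have s2: "(\<Sum>x\<in>B. h x) = (\<Sum>x\<in>B1. h x) + (\<Sum>x\<in>B2. h x)" for h :: "'w \<Rightarrow> real"
          unfolding B2_def using sum.subset_diff[OF B1 finAB(2), of h] by simp
        show ?thesis unfolding e_def s1 s2 sum.distrib by simp
      qed
      have partN: "N A B = N A1 B1 + N A1 B2 + N A2 B1 + N A2 B2"
      proof -
        have "real (card A) = real (card A1) + real (card A2)"
          unfolding A2_def using A1 finAB by (simp add: card_Diff_subset card_mono finite_subset of_nat_diff)
        moreover have "real (card B) = real (card B1) + real (card B2)"
          unfolding B2_def using B1 finAB by (simp add: card_Diff_subset card_mono finite_subset of_nat_diff)
        ultimately show ?thesis by (simp add: N_def algebra_simps)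
      qed
      have sub: "A2 \<subseteq> A" "B2 \<subseteq> B" by (auto simp: A2_def B2_def)
      have cell: "N P Q * \<Phi> A B \<ge> (\<Sum>b\<in>C. 2 * d b * e b P Q - (d b)\<^sup>2 * N P Q + bonus b P Q)
           + c * (N P Q * ln (N A B) + N P Q - N A B)" if "P \<subseteq> A" "Q \<subseteq> B" for P Q
      proof -
        have "(\<Sum>b\<in>C. 2 * d b * e b P Q - (d b)\<^sup>2 * N P Q + bonus b P Q) \<le> (\<Sum>b\<in>C. N P Q * (dens b P Q)\<^sup>2)"
          by (intro sum_mono bonus)
        moreover have "c * (N P Q * ln (N A B) + N P Q - N A B) \<le> c * (N P Q * ln (N P Q))"
          using c ln by (intro mult_left_mono) auto
        moreover have "N P Q * \<Phi> P Q = (\<Sum>b\<in>C. N P Q * (dens b P Q)\<^sup>2) + c * (N P Q * ln (N P Q))"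
          by (simp add: \<Phi>_def algebra_simps sum_distrib_left)
        ultimately show ?thesis using \<Phi>cell[OF that] by linarith
      qed
      have bon: "\<epsilon>\<^sup>2 * N A B \<le> (\<Sum>b\<in>C. bonus b A1 B1)"
      proof -
        have "(\<Sum>b\<in>C. bonus b A1 B1) = (\<Sum>b\<in>C. if b = a then \<epsilon>\<^sup>2 * N A B else 0)"
          by (intro sum.cong) (auto simp: bonus_def)
        then show ?thesis using a assms by (simp add: sum.delta)
      qed
      have bon0: "0 \<le> (\<Sum>b\<in>C. bonus b P Q)" for P Q
        using Npos by (intro sum_nonneg) (simp add: bonus_def)
      define L where "L = (\<lambda>P Q. (\<Sum>b\<in>C. 2 * d b * e b P Q - (d b)\<^sup>2 * N P Q))"
      have Lsum: "L A1 B1 + L A1 B2 + L A2 B1 + L A2 B2 = (\<Sum>b\<in>C. (dens b A B)\<^sup>2) * N A B"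
      proof -
        have "L A1 B1 + L A1 B2 + L A2 B1 + L A2 B2 = (\<Sum>b\<in>C. 2 * d b * e b A B - (d b)\<^sup>2 * N A B)"
          unfolding L_def part partN by (simp add: algebra_simps flip: sum.distrib)
        also have "\<dots> = (\<Sum>b\<in>C. (dens b A B)\<^sup>2 * N A B)"
          by (intro sum.cong refl, subst dN[symmetric]) (simp add: d_def power2_eq_square algebra_simps)
        finally show ?thesis by (simp add: sum_distrib_right)
      qed
      have cell': "N P Q * \<Phi> A B \<ge> L P Q + (\<Sum>b\<in>C. bonus b P Q)
           + c * (N P Q * ln (N A B) + N P Q - N A B)" if "P \<subseteq> A" "Q \<subseteq> B" for P Q
        using cell[OF that] by (simp add: L_def sum.distrib)
      note cells = cell'[OF A1 B1] cell'[OF A1 sub(2)] cell'[OF sub(1) B1] cell'[OF sub]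
      have "N A B * \<Phi> A B \<ge> (\<Sum>b\<in>C. (dens b A B)\<^sup>2) * N A B + \<epsilon>\<^sup>2 * N A B
          + c * (N A B * ln (N A B) + N A B - 4 * N A B)"
      proof -
        have 1: "N A B * \<Phi> A B = N A1 B1 * \<Phi> A B + N A1 B2 * \<Phi> A B + N A2 B1 * \<Phi> A B + N A2 B2 * \<Phi> A B"
          by (subst partN) (simp add: algebra_simps)
        have 2: "c * (N A B * ln (N A B) + N A B - 4 * N A B) =
            c * (N A1 B1 * ln (N A B) + N A1 B1 - N A B) + c * (N A1 B2 * ln (N A B) + N A1 B2 - N A B)
          + c * (N A2 B1 * ln (N A B) + N A2 B1 - N A B) + c * (N A2 B2 * ln (N A B) + N A2 B2 - N A B)"
        proof -
          have gen: "c * (n * l + n - 4 * n) = c * (n1 * l + n1 - n) + c * (n2 * l + n2 - n) + c * (n3 * l + n3 - n) + c * (n4 * l + n4 - n)"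
            if "n = n1 + n2 + n3 + n4" for n n1 n2 n3 n4 l :: real
            unfolding that by (simp add: algebra_simps)
          show ?thesis by (rule gen[OF partN])
        qed
        show ?thesis
          using cells bon bon0[of A1 B2] bon0[of A2 B1] bon0[of A2 B2] Lsum 1 2 by linarith
      qed
      then have "\<epsilon>\<^sup>2 * N A B \<le> 3 * c * N A B"
        by (simp add: \<Phi>_def algebra_simps)
      then have "\<epsilon>\<^sup>2 \<le> 3 * c" using Npos by simp
      then show False using assms by (simp add: c_def)
    qed
    then show "\<exists>A' B' d. A' \<subseteq> A0 \<and> B' \<subseteq> B0 \<and> \<gamma> * real (card A0) \<le> real (card A') \<and>
        \<gamma> * real (card B0) \<le> real (card B') \<and> (\<forall>a. 0 \<le> d a \<and> d a \<le> 1) \<and> regular_pair C g A' B' d \<epsilon>"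
      using AB szA szB dens01 by (intro exI[of _ A] exI[of _ B] exI[of _ d] conjI allI) (simp_all add: d_def)
  qed
qed

text \<open>The pairs are treated one after the other. Shrinking the parts of a pair that is already regular
  worsens its error by the factor \<open>1 / \<gamma>1\<^sup>2\<close>, so it is made regular with error \<open>\<epsilon> * \<gamma>1\<^sup>2\<close> before the
  others, which shrink the parts by \<open>\<gamma>1\<close> in total.\<close>

lemma regular_subparts_exist:
  fixes C :: "'c set" and E :: "(nat \<times> nat) set"
  assumes "finite C" "finite E" "\<forall>(i,j)\<in>E. i \<noteq> j" "0 < \<epsilon>"
  shows "\<exists>\<gamma>>0. \<forall>(A :: nat \<Rightarrow> 'v set) g. (\<forall>i. finite (A i) \<and> A i \<noteq> {}) \<longrightarrow>
     (\<exists>A'. (\<forall>i. A' i \<subseteq> A i \<and> \<gamma> * real (card (A i)) \<le> real (card (A' i))) \<and>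
        (\<forall>(i,j)\<in>E. \<exists>d. (\<forall>a::'c. 0 \<le> d a \<and> d a \<le> 1) \<and> regular_pair C g (A' i) (A' j) d \<epsilon>))"
  using assms(2,3)
proof (induction E rule: finite_induct)
  case empty
  show ?case
    by (intro exI[of _ 1]) auto
next
  case (insert ij E)
  obtain i j where ij: "ij = (i, j)" by fastforce
  have ne: "i \<noteq> j" using insert.prems ij by auto
  obtain \<gamma>1 where \<gamma>1: "0 < \<gamma>1" and IH: "\<forall>(A :: nat \<Rightarrow> 'v set) g. (\<forall>i. finite (A i) \<and> A i \<noteq> {}) \<longrightarrow>
     (\<exists>A'. (\<forall>i. A' i \<subseteq> A i \<and> \<gamma>1 * real (card (A i)) \<le> real (card (A' i))) \<and>
        (\<forall>(i,j)\<in>E. \<exists>d. (\<forall>a::'c. 0 \<le> d a \<and> d a \<le> 1) \<and> regular_pair C g (A' i) (A' j) d \<epsilon>))"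
    using insert.IH insert.prems by auto
  have "0 < \<epsilon> * \<gamma>1\<^sup>2" using assms \<gamma>1 by simp
  from regular_subpair_exists[OF assms(1) this, where 'v = 'v and 'w = 'v]
  obtain \<gamma>2 where \<gamma>2: "0 < \<gamma>2" and sub: "\<And>(A :: 'v set) (B :: 'v set) g. finite A \<Longrightarrow> A \<noteq> {} \<Longrightarrow> finite B \<Longrightarrow> B \<noteq> {} \<Longrightarrow>
       \<exists>A' B' d. A' \<subseteq> A \<and> B' \<subseteq> B \<and> \<gamma>2 * real (card A) \<le> real (card A') \<and> \<gamma>2 * real (card B) \<le> real (card B')
         \<and> (\<forall>a::'c. 0 \<le> d a \<and> d a \<le> 1) \<and> regular_pair C g A' B' d (\<epsilon> * \<gamma>1\<^sup>2)"
    by metis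
  define \<gamma> where "\<gamma> = \<gamma>1 * min \<gamma>2 1"
  have \<gamma>: "0 < \<gamma>" using \<gamma>1 \<gamma>2 by (simp add: \<gamma>_def)
  show ?case
  proof (intro exI[of _ \<gamma>] conjI \<gamma> allI impI)
    fix A :: "nat \<Rightarrow> 'v set" and g
    assume A: "\<forall>i. finite (A i) \<and> A i \<noteq> {}"
    obtain P Q d where PQ: "P \<subseteq> A i" "Q \<subseteq> A j" "\<gamma>2 * real (card (A i)) \<le> real (card P)"
      "\<gamma>2 * real (card (A j)) \<le> real (card Q)" "\<forall>a::'c. 0 \<le> d a \<and> d a \<le> 1"
      "regular_pair C g P Q d (\<epsilon> * \<gamma>1\<^sup>2)"
      using sub[of "A i" "A j" g] A by blast
    define B where "B = A(i := P, j := Q)"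
    have Bi: "B i = P" "B j = Q" using ne by (auto simp: B_def)
    have Bsub: "B l \<subseteq> A l" for l using PQ by (auto simp: B_def)
    have cardpos: "0 < real (card (A l))" for l using A by (simp add: card_gt_0_iff)
    have Bcard: "min \<gamma>2 1 * real (card (A l)) \<le> real (card (B l))" for l
    proof -
      have "min \<gamma>2 1 * real (card (A l)) \<le> \<gamma>2 * real (card (A l))"
        "min \<gamma>2 1 * real (card (A l)) \<le> 1 * real (card (A l))"
        by (intro mult_right_mono; simp)+
      then show ?thesis using PQ by (auto simp: B_def intro: order_trans)
    qed
    have Bok: "finite (B l) \<and> B l \<noteq> {}" for l
    proof -
      have "0 < min \<gamma>2 1 * real (card (A l))" using \<gamma>2 cardpos by simp
      then have "0 < real (card (B l))" using Bcard[of l] by linarith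
      then show ?thesis by (auto simp: card_gt_0_iff)
    qed
    obtain A' where A': "\<And>l. A' l \<subseteq> B l" "\<And>l. \<gamma>1 * real (card (B l)) \<le> real (card (A' l))"
      "\<forall>(i,j)\<in>E. \<exists>d. (\<forall>a::'c. 0 \<le> d a \<and> d a \<le> 1) \<and> regular_pair C g (A' i) (A' j) d \<epsilon>"
      using IH[rule_format, of B g] Bok by blast
    have "regular_pair C g (A' i) (A' j) d (\<epsilon> * \<gamma>1\<^sup>2 / \<gamma>1\<^sup>2)"
    proof (rule regular_pair_subset[OF PQ(6) _ _ \<gamma>1])
      show "A' i \<subseteq> P" "A' j \<subseteq> Q" "\<gamma>1 * real (card P) \<le> real (card (A' i))"
        "\<gamma>1 * real (card Q) \<le> real (card (A' j))"
        using A'(1,2)[of i] A'(1,2)[of j] Bi by simp_all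
    qed (use assms in simp)
    then have new: "regular_pair C g (A' i) (A' j) d \<epsilon>" using \<gamma>1 by simp
    have "\<gamma> * real (card (A l)) \<le> real (card (A' l))" for l
    proof -
      have "\<gamma> * real (card (A l)) = \<gamma>1 * (min \<gamma>2 1 * real (card (A l)))" by (simp add: \<gamma>_def)
      also have "\<dots> \<le> \<gamma>1 * real (card (B l))" using \<gamma>1 Bcard by (intro mult_left_mono) auto
      also have "\<dots> \<le> real (card (A' l))" by (rule A')
      finally show ?thesis .
    qed
    then show "\<exists>A'. (\<forall>i. A' i \<subseteq> A i \<and> \<gamma> * real (card (A i)) \<le> real (card (A' i))) \<and>
        (\<forall>(i,j)\<in>insert ij E. \<exists>d. (\<forall>a::'c. 0 \<le> d a \<and> d a \<le> 1) \<and> regular_pair C g (A' i) (A' j) d \<epsilon>)"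
      using A'(3) order_trans[OF A'(1) Bsub] new PQ(5) unfolding ij
      by (intro exI[of _ A'] conjI allI ballI) auto
  qed
qed

section \<open>Every colouring has a large set with many forbidden triples\<close>

lemma mult_of_bool_eq: "(x::real) * of_bool b = (if b then x else 0)"
  by (cases b) simp_all

text \<open>Replacing the three indicators one by one by their densities leaves an error of \<open>\<epsilon>\<close> in each step,
  because the other indicators, once the third vertex is fixed, restrict the sum to a product of two
  subsets.\<close>

lemma regular_triangle_count:
  fixes f :: "'v set \<Rightarrow> 'c"
  assumes reg: "regular_pair C (\<lambda>x y. f {x, y}) P Q d \<epsilon>" "regular_pair C (\<lambda>x y. f {x, y}) P R d \<epsilon>"
    "regular_pair C (\<lambda>x y. f {x, y}) Q R d \<epsilon>"
    and fin: "finite P" "finite Q" "finite R"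
    and d: "\<And>a. a \<in> C \<Longrightarrow> 0 \<le> d a \<and> d a \<le> 1" and abc: "a \<in> C" "b \<in> C" "c \<in> C"
  shows "(\<Sum>x\<in>P. \<Sum>y\<in>Q. \<Sum>z\<in>R. of_bool (f {x, y} = a) * of_bool (f {x, z} = b) * of_bool (f {y, z} = c))
     \<ge> (d a * d b * d c - 3 * \<epsilon>) * (real (card P) * real (card Q) * real (card R))"
proof -
  define F where "F = (\<lambda>x y. of_bool (f {x, y} = a) :: real)"
  define G where "G = (\<lambda>x y. of_bool (f {x, y} = b) :: real)"
  define H where "H = (\<lambda>x y. of_bool (f {x, y} = c) :: real)"
  have 1: "\<bar>\<Sum>z\<in>R. \<Sum>x\<in>P. \<Sum>y\<in>Q. (F x y - d a) * G x z * H y z\<bar> \<le> real (card R) * (\<epsilon> * real (card P) * real (card Q))"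
  proof (rule order_trans[OF sum_abs], rule sum_bounded_above)
    fix z assume "z \<in> R"
    have "(\<Sum>x\<in>P. \<Sum>y\<in>Q. (F x y - d a) * G x z * H y z)
       = (\<Sum>x\<in>{x\<in>P. f {x, z} = b}. \<Sum>y\<in>{y\<in>Q. f {y, z} = c}. F x y - d a)"
    proof -
      have "(\<Sum>x\<in>P. \<Sum>y\<in>Q. (F x y - d a) * G x z * H y z)
         = (\<Sum>x\<in>P. if f {x, z} = b then \<Sum>y\<in>Q. (if f {y, z} = c then F x y - d a else 0) else 0)"
        unfolding G_def H_def by (intro sum.cong refl) (simp add: mult_of_bool_eq if_distrib cong: if_cong)
      then show ?thesis by (simp only: sum.inter_filter[OF fin(1)] sum.inter_filter[OF fin(2)])
    qed
    also have "\<bar>\<dots>\<bar> \<le> \<epsilon> * real (card P) * real (card Q)"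
      unfolding F_def by (rule regular_pairD[OF reg(1) abc(1)]) auto
    finally show "\<bar>\<Sum>x\<in>P. \<Sum>y\<in>Q. (F x y - d a) * G x z * H y z\<bar> \<le> \<epsilon> * real (card P) * real (card Q)" .
  qed
  have 2: "\<bar>\<Sum>y\<in>Q. \<Sum>x\<in>P. \<Sum>z\<in>R. (G x z - d b) * H y z\<bar> \<le> real (card Q) * (\<epsilon> * real (card P) * real (card R))"
  proof (rule order_trans[OF sum_abs], rule sum_bounded_above)
    fix y assume "y \<in> Q"
    have "(\<Sum>x\<in>P. \<Sum>z\<in>R. (G x z - d b) * H y z)
       = (\<Sum>x\<in>P. \<Sum>z\<in>{z\<in>R. f {y, z} = c}. G x z - d b)"
      unfolding H_def by (simp add: sum.inter_filter[OF fin(3)] mult_of_bool_eq)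
    also have "\<bar>\<dots>\<bar> \<le> \<epsilon> * real (card P) * real (card R)"
      unfolding G_def by (rule regular_pairD[OF reg(2) abc(2)]) auto
    finally show "\<bar>\<Sum>x\<in>P. \<Sum>z\<in>R. (G x z - d b) * H y z\<bar> \<le> \<epsilon> * real (card P) * real (card R)" .
  qed
  have 3: "\<bar>\<Sum>y\<in>Q. \<Sum>z\<in>R. H y z - d c\<bar> \<le> \<epsilon> * real (card Q) * real (card R)"
    unfolding H_def by (rule regular_pairD[OF reg(3) abc(3)]) auto
  have "(\<Sum>x\<in>P. \<Sum>y\<in>Q. \<Sum>z\<in>R. F x y * G x z * H y z) =
     (\<Sum>x\<in>P. \<Sum>y\<in>Q. \<Sum>z\<in>R. (F x y - d a) * G x z * H y z + d a * ((G x z - d b) * H y z)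
        + d a * d b * (H y z - d c) + d a * d b * d c)"
    by (intro sum.cong refl) (simp add: algebra_simps)
  also have "\<dots> = (\<Sum>z\<in>R. \<Sum>x\<in>P. \<Sum>y\<in>Q. (F x y - d a) * G x z * H y z)
      + d a * (\<Sum>y\<in>Q. \<Sum>x\<in>P. \<Sum>z\<in>R. (G x z - d b) * H y z)
      + d a * d b * (real (card P) * (\<Sum>y\<in>Q. \<Sum>z\<in>R. H y z - d c))
      + d a * d b * d c * (real (card P) * real (card Q) * real (card R))"
  proof -
    have s1: "(\<Sum>x\<in>P. \<Sum>y\<in>Q. \<Sum>z\<in>R. (F x y - d a) * G x z * H y z) = (\<Sum>z\<in>R. \<Sum>x\<in>P. \<Sum>y\<in>Q. (F x y - d a) * G x z * H y z)"
    proof -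
      have "(\<Sum>x\<in>P. \<Sum>y\<in>Q. \<Sum>z\<in>R. (F x y - d a) * G x z * H y z) = (\<Sum>x\<in>P. \<Sum>z\<in>R. \<Sum>y\<in>Q. (F x y - d a) * G x z * H y z)"
        by (intro sum.cong refl sum.swap)
      also have "\<dots> = (\<Sum>z\<in>R. \<Sum>x\<in>P. \<Sum>y\<in>Q. (F x y - d a) * G x z * H y z)" by (rule sum.swap)
      finally show ?thesis .
    qed
    have s2: "(\<Sum>x\<in>P. \<Sum>y\<in>Q. \<Sum>z\<in>R. d a * ((G x z - d b) * H y z)) = d a * (\<Sum>y\<in>Q. \<Sum>x\<in>P. \<Sum>z\<in>R. (G x z - d b) * H y z)"
      by (subst sum.swap) (simp only: sum_distrib_left)
    have s3: "(\<Sum>x\<in>P. \<Sum>y\<in>Q. \<Sum>z\<in>R. d a * d b * (H y z - d c)) = d a * d b * (real (card P) * (\<Sum>y\<in>Q. \<Sum>z\<in>R. H y z - d c))"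
      by (simp add: sum_distrib_left mult_ac)
    show ?thesis by (simp only: sum.distrib s1 s2 s3) simp
  qed
  finally have eq: "(\<Sum>x\<in>P. \<Sum>y\<in>Q. \<Sum>z\<in>R. F x y * G x z * H y z) =
      (\<Sum>z\<in>R. \<Sum>x\<in>P. \<Sum>y\<in>Q. (F x y - d a) * G x z * H y z)
      + d a * (\<Sum>y\<in>Q. \<Sum>x\<in>P. \<Sum>z\<in>R. (G x z - d b) * H y z)
      + d a * d b * (real (card P) * (\<Sum>y\<in>Q. \<Sum>z\<in>R. H y z - d c))
      + d a * d b * d c * (real (card P) * real (card Q) * real (card R))" .
  define N where "N = real (card P) * real (card Q) * real (card R)"
  have da: "0 \<le> d a" "d a \<le> 1" "0 \<le> d b" "d b \<le> 1" using d abc by auto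
  have scale: "\<bar>t * X\<bar> \<le> Y" if "\<bar>X\<bar> \<le> Y" "0 \<le> t" "t \<le> 1" for t X Y :: real
  proof -
    have "\<bar>t * X\<bar> = t * \<bar>X\<bar>" using that by (simp add: abs_mult)
    also have "\<dots> \<le> 1 * \<bar>X\<bar>" using that by (intro mult_right_mono) auto
    finally show ?thesis using that by simp
  qed
  have e1: "\<bar>\<Sum>z\<in>R. \<Sum>x\<in>P. \<Sum>y\<in>Q. (F x y - d a) * G x z * H y z\<bar> \<le> \<epsilon> * N"
    using 1 by (simp add: N_def mult_ac)
  have e2: "\<bar>d a * (\<Sum>y\<in>Q. \<Sum>x\<in>P. \<Sum>z\<in>R. (G x z - d b) * H y z)\<bar> \<le> \<epsilon> * N"
    by (rule scale) (use 2 da in \<open>auto simp: N_def mult_ac\<close>)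
  have e3: "\<bar>d a * d b * (real (card P) * (\<Sum>y\<in>Q. \<Sum>z\<in>R. H y z - d c))\<bar> \<le> \<epsilon> * N"
  proof (rule scale)
    have "\<bar>real (card P) * (\<Sum>y\<in>Q. \<Sum>z\<in>R. H y z - d c)\<bar> = real (card P) * \<bar>\<Sum>y\<in>Q. \<Sum>z\<in>R. H y z - d c\<bar>"
      by (simp add: abs_mult)
    also have "\<dots> \<le> real (card P) * (\<epsilon> * real (card Q) * real (card R))"
      by (intro mult_left_mono 3) auto
    finally show "\<bar>real (card P) * (\<Sum>y\<in>Q. \<Sum>z\<in>R. H y z - d c)\<bar> \<le> \<epsilon> * N" by (simp add: N_def mult_ac)
  qed (use da in \<open>auto simp: mult_le_one\<close>)
  have "(\<Sum>x\<in>P. \<Sum>y\<in>Q. \<Sum>z\<in>R. F x y * G x z * H y z) \<ge> (d a * d b * d c - 3 * \<epsilon>) * N"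
    using e1 e2 e3 unfolding eq N_def[symmetric] by (simp add: algebra_simps)
  then show ?thesis by (simp add: F_def G_def H_def N_def)
qed

text \<open>The triangle count summed over all forbidden colour triples. As each pair has exactly one colour,
  the vector \<open>d\<close> has total mass almost one, so its forbidden mass is almost \<open>\<beta>\<close>.\<close>

lemma regular_forbidden_count:
  fixes f :: "'v set \<Rightarrow> 'c"
  assumes reg: "regular_pair C (\<lambda>x y. f {x, y}) P Q d \<epsilon>" "regular_pair C (\<lambda>x y. f {x, y}) P R d \<epsilon>"
    "regular_pair C (\<lambda>x y. f {x, y}) Q R d \<epsilon>"
    and fin: "finite C" "finite P" "finite Q" "finite R" "P \<noteq> {}" "Q \<noteq> {}"
    and d: "\<And>a. a \<in> C \<Longrightarrow> 0 \<le> d a \<and> d a \<le> 1" and f: "\<And>e. f e \<in> C"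
    and \<beta>: "\<And>p. (\<And>a. a \<in> C \<Longrightarrow> 0 \<le> p a) \<Longrightarrow> \<beta> * (sum p C) ^ 3 \<le> forbidden_mass C D p" "0 \<le> \<beta>" "\<beta> \<le> 1"
    and \<epsilon>: "0 < \<epsilon>" "real (card C) * \<epsilon> \<le> 1"
  shows "(\<Sum>x\<in>P. \<Sum>y\<in>Q. \<Sum>z\<in>R. of_bool (D (f {x, y}) (f {x, z}) (f {y, z})))
     \<ge> (\<beta> - 3 * real (card C) * \<epsilon> - 3 * real (card C) ^ 3 * \<epsilon>) * (real (card P) * real (card Q) * real (card R))"
proof -
  define N where "N = real (card P) * real (card Q) * real (card R)"
  define k where "k = real (card C)"
  have N0: "N \<ge> 0" by (simp add: N_def)
  have sumd: "1 - k * \<epsilon> \<le> sum d C"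
  proof -
    define n where "n = real (card P) * real (card Q)"
    have n: "n > 0" using fin by (simp add: n_def card_gt_0_iff)
    have "(\<Sum>a\<in>C. \<Sum>x\<in>P. \<Sum>y\<in>Q. of_bool (f {x, y} = a) - d a) \<le> (\<Sum>a\<in>C. \<epsilon> * real (card P) * real (card Q))"
    proof (rule sum_mono)
      fix a assume "a \<in> C"
      then have "\<bar>\<Sum>x\<in>P. \<Sum>y\<in>Q. of_bool (f {x, y} = a) - d a\<bar> \<le> \<epsilon> * real (card P) * real (card Q)"
        by (intro regular_pairD[OF reg(1)]) auto
      then show "(\<Sum>x\<in>P. \<Sum>y\<in>Q. of_bool (f {x, y} = a) - d a) \<le> \<epsilon> * real (card P) * real (card Q)" by linarith
    qed
    also have "(\<Sum>a\<in>C. \<Sum>x\<in>P. \<Sum>y\<in>Q. of_bool (f {x, y} = a) - d a) = n - sum d C * n"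
    proof -
      have "(\<Sum>a\<in>C. \<Sum>x\<in>P. \<Sum>y\<in>Q. of_bool (f {x, y} = a) - d a) = (\<Sum>x\<in>P. \<Sum>a\<in>C. \<Sum>y\<in>Q. of_bool (f {x, y} = a) - d a)"
        by (rule sum.swap)
      also have "\<dots> = (\<Sum>x\<in>P. \<Sum>y\<in>Q. \<Sum>a\<in>C. of_bool (f {x, y} = a) - d a)"
        by (intro sum.cong refl sum.swap)
      also have "\<dots> = (\<Sum>x\<in>P. \<Sum>y\<in>Q. 1 - sum d C)"
      proof (intro sum.cong refl)
        fix x y
        have "(\<Sum>a\<in>C. of_bool (f {x, y} = a) :: real) = (\<Sum>a\<in>C. if f {x, y} = a then 1 else 0)" by (intro sum.cong) auto
        then show "(\<Sum>a\<in>C. of_bool (f {x, y} = a) - d a) = 1 - sum d C"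
          using f fin by (simp add: sum_subtractf)
      qed
      finally show ?thesis by (simp add: n_def algebra_simps)
    qed
    finally have "n * (1 - sum d C) \<le> n * (k * \<epsilon>)" by (simp add: n_def k_def algebra_simps)
    then show ?thesis using n by simp
  qed
  have dC: "0 \<le> sum d C" using d by (intro sum_nonneg) auto
  have "1 - 3 * (k * \<epsilon>) \<le> (1 - k * \<epsilon>) ^ 3"
    using Bernoulli_inequality[of "- (k * \<epsilon>)" 3] \<epsilon> by (simp add: k_def)
  also have "\<dots> \<le> (sum d C) ^ 3" using sumd \<epsilon> by (intro power_mono) (auto simp: k_def)
  finally have "\<beta> * (1 - 3 * (k * \<epsilon>)) \<le> \<beta> * (sum d C) ^ 3" using \<beta> by (intro mult_left_mono)
  moreover have "\<beta> * (sum d C) ^ 3 \<le> forbidden_mass C D d" using d by (intro \<beta>) auto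
  moreover have "\<beta> * (3 * (k * \<epsilon>)) \<le> 1 * (3 * (k * \<epsilon>))" using \<beta> \<epsilon> by (intro mult_right_mono) (auto simp: k_def)
  ultimately have m: "\<beta> - 3 * k * \<epsilon> \<le> forbidden_mass C D d" by (simp add: algebra_simps)
  have "(\<Sum>x\<in>P. \<Sum>y\<in>Q. \<Sum>z\<in>R. of_bool (D (f {x, y}) (f {x, z}) (f {y, z})) :: real)
     = (\<Sum>x\<in>P. \<Sum>y\<in>Q. \<Sum>z\<in>R. \<Sum>a\<in>C. \<Sum>b\<in>C. \<Sum>c\<in>C. of_bool (D a b c) * (of_bool (f {x, y} = a) * of_bool (f {x, z} = b) * of_bool (f {y, z} = c)))"
  proof (intro sum.cong refl)
    fix x y z
    have sc: "(\<Sum>a\<in>C. of_bool (f e = a) * h a) = h (f e)" for e and h :: "'c \<Rightarrow> real"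
    proof -
      have "(\<Sum>a\<in>C. of_bool (f e = a) * h a) = (\<Sum>a\<in>C. if f e = a then h a else 0)" by (intro sum.cong) auto
      then show ?thesis using f fin by simp
    qed
    have "(\<Sum>a\<in>C. \<Sum>b\<in>C. \<Sum>c\<in>C. of_bool (D a b c) * (of_bool (f {x, y} = a) * of_bool (f {x, z} = b) * of_bool (f {y, z} = c)))
      = (\<Sum>a\<in>C. of_bool (f {x, y} = a) * (\<Sum>b\<in>C. of_bool (f {x, z} = b) * (\<Sum>c\<in>C. of_bool (f {y, z} = c) * of_bool (D a b c) :: real)))"
      by (simp add: sum_distrib_left mult_ac)
    then show "of_bool (D (f {x, y}) (f {x, z}) (f {y, z})) = (\<Sum>a\<in>C. \<Sum>b\<in>C. \<Sum>c\<in>C. of_bool (D a b c) * (of_bool (f {x, y} = a) * of_bool (f {x, z} = b) * of_bool (f {y, z} = c)) :: real)"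
      by (simp only: sc)
  qed
  also have "\<dots> = (\<Sum>a\<in>C. \<Sum>b\<in>C. \<Sum>c\<in>C. of_bool (D a b c) * (\<Sum>x\<in>P. \<Sum>y\<in>Q. \<Sum>z\<in>R. of_bool (f {x, y} = a) * of_bool (f {x, z} = b) * of_bool (f {y, z} = c)))"
    (is "?A = ?B")
  proof -
    have sum3: "(\<Sum>x\<in>P. \<Sum>y\<in>Q. \<Sum>z\<in>R. h x y z) = (\<Sum>(x,y,z)\<in>P\<times>Q\<times>R. h x y z)"
      for P :: "'x set" and Q :: "'y set" and R :: "'z set" and h :: "'x \<Rightarrow> 'y \<Rightarrow> 'z \<Rightarrow> real"
      by (simp add: sum.cartesian_product)
    have "?A = (\<Sum>(x,y,z)\<in>P\<times>Q\<times>R. \<Sum>a\<in>C. \<Sum>b\<in>C. \<Sum>c\<in>C. of_bool (D a b c) * (of_bool (f {x, y} = a) * of_bool (f {x, z} = b) * of_bool (f {y, z} = c)))"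
      by (rule sum3)
    also have "\<dots> = (\<Sum>(x,y,z)\<in>P\<times>Q\<times>R. \<Sum>(a,b,c)\<in>C\<times>C\<times>C. of_bool (D a b c) * (of_bool (f {x, y} = a) * of_bool (f {x, z} = b) * of_bool (f {y, z} = c)))"
      by (intro sum.cong refl) (clarsimp simp only: sum3 split: prod.splits)
    also have "\<dots> = (\<Sum>(a,b,c)\<in>C\<times>C\<times>C. \<Sum>(x,y,z)\<in>P\<times>Q\<times>R. of_bool (D a b c) * (of_bool (f {x, y} = a) * of_bool (f {x, z} = b) * of_bool (f {y, z} = c)))"
      unfolding case_prod_unfold by (rule sum.swap)
    also have "\<dots> = (\<Sum>(a,b,c)\<in>C\<times>C\<times>C. of_bool (D a b c) * (\<Sum>(x,y,z)\<in>P\<times>Q\<times>R. of_bool (f {x, y} = a) * of_bool (f {x, z} = b) * of_bool (f {y, z} = c)))"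
      by (intro sum.cong refl) (simp add: sum_distrib_left case_prod_unfold)
    also have "\<dots> = (\<Sum>(a,b,c)\<in>C\<times>C\<times>C. of_bool (D a b c) * (\<Sum>x\<in>P. \<Sum>y\<in>Q. \<Sum>z\<in>R. of_bool (f {x, y} = a) * of_bool (f {x, z} = b) * of_bool (f {y, z} = c)))"
      by (intro sum.cong refl) (clarsimp simp only: sum3 split: prod.splits)
    also have "\<dots> = ?B" by (rule sum3[symmetric])
    finally show ?thesis .
  qed
  also have "\<dots> \<ge> (\<Sum>a\<in>C. \<Sum>b\<in>C. \<Sum>c\<in>C. of_bool (D a b c) * (d a * d b * d c) * N - 3 * \<epsilon> * N)"
  proof (intro sum_mono)
    fix a b c assume "a \<in> C" "b \<in> C" "c \<in> C"
    note cnt = regular_triangle_count[OF reg fin(2-4) d this, folded N_def]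
    show "of_bool (D a b c) * (d a * d b * d c) * N - 3 * \<epsilon> * N \<le> of_bool (D a b c) * (\<Sum>x\<in>P. \<Sum>y\<in>Q. \<Sum>z\<in>R. of_bool (f {x, y} = a) * of_bool (f {x, z} = b) * of_bool (f {y, z} = c))"
      using cnt N0 \<epsilon> by (cases "D a b c") (simp_all add: algebra_simps)
  qed
  also (xtrans) have "(\<Sum>a\<in>C. \<Sum>b\<in>C. \<Sum>c\<in>C. of_bool (D a b c) * (d a * d b * d c) * N - 3 * \<epsilon> * N)
      = forbidden_mass C D d * N - 3 * k ^ 3 * \<epsilon> * N"
    by (simp add: forbidden_mass_def sum_subtractf sum_distrib_right k_def power3_eq_cube)
  also (xtrans) have "\<dots> \<ge> (\<beta> - 3 * k * \<epsilon>) * N - 3 * k ^ 3 * \<epsilon> * N"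
    using m N0 by (intro diff_right_mono mult_right_mono)
  finally show ?thesis by (simp add: N_def k_def algebra_simps)
qed

text \<open>As a function of any one of the classes, \<open>F\<close> is the average of a function on vertices. Such an \<open>F\<close> does not
  decrease when a class is replaced by a suitable subset of given size. This equalises the sizes of the
  classes without any loss, whereas regularity would get worse on smaller classes.\<close>

definition part_averaging :: "((nat \<Rightarrow> 'v set) \<Rightarrow> real) \<Rightarrow> bool" where
  "part_averaging F \<longleftrightarrow>
     (\<forall>W i. \<exists>k. \<forall>X. finite X \<longrightarrow> X \<noteq> {} \<longrightarrow> F (W(i := X)) = (\<Sum>x\<in>X. k x) / real (card X))"

lemma part_averaging_sum:
  fixes F :: "'t \<Rightarrow> (nat \<Rightarrow> 'v set) \<Rightarrow> real"
  assumes "\<And>t. t \<in> T \<Longrightarrow> part_averaging (F t)"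
  shows "part_averaging (\<lambda>W. \<Sum>t\<in>T. F t W)"
  unfolding part_averaging_def
proof (intro allI)
  fix W :: "nat \<Rightarrow> 'v set" and i
  have "\<forall>t\<in>T. \<exists>k. \<forall>X. finite X \<longrightarrow> X \<noteq> {} \<longrightarrow> F t (W(i := X)) = (\<Sum>x\<in>X. k x) / real (card X)"
    using assms unfolding part_averaging_def by blast
  then obtain k where k: "\<And>t X. t \<in> T \<Longrightarrow> finite X \<Longrightarrow> X \<noteq> {} \<Longrightarrow> F t (W(i := X)) = (\<Sum>x\<in>X. k t x) / real (card X)"
    by metis
  show "\<exists>k. \<forall>X. finite X \<longrightarrow> X \<noteq> {} \<longrightarrow> (\<Sum>t\<in>T. F t (W(i := X))) = (\<Sum>x\<in>X. k x) / real (card X)"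
  proof (intro exI[of _ "\<lambda>x. \<Sum>t\<in>T. k t x"] allI impI)
    fix X :: "'v set" assume X: "finite X" "X \<noteq> {}"
    have "(\<Sum>t\<in>T. F t (W(i := X))) = (\<Sum>t\<in>T. (\<Sum>x\<in>X. k t x) / real (card X))"
      using k X by simp
    also have "\<dots> = (\<Sum>x\<in>X. \<Sum>t\<in>T. k t x) / real (card X)"
      by (subst sum.swap) (simp add: sum_divide_distrib)
    finally show "(\<Sum>t\<in>T. F t (W(i := X))) = (\<Sum>x\<in>X. \<Sum>t\<in>T. k t x) / real (card X)" .
  qed
qed

lemma part_averaging_triple:
  fixes h :: "'v \<Rightarrow> 'v \<Rightarrow> 'v \<Rightarrow> real"
  assumes "i \<noteq> j" "j \<noteq> l" "i \<noteq> l"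
  shows "part_averaging (\<lambda>W. (\<Sum>x\<in>W i. \<Sum>y\<in>W j. \<Sum>z\<in>W l. h x y z) /
            (real (card (W i)) * real (card (W j)) * real (card (W l))))"
  unfolding part_averaging_def
proof (intro allI)
  fix W :: "nat \<Rightarrow> 'v set" and n
  consider "n = i" | "n = j" | "n = l" | "n \<noteq> i" "n \<noteq> j" "n \<noteq> l" by blast
  then show "\<exists>k. \<forall>X. finite X \<longrightarrow> X \<noteq> {} \<longrightarrow>
     (\<Sum>x\<in>(W(n := X)) i. \<Sum>y\<in>(W(n := X)) j. \<Sum>z\<in>(W(n := X)) l. h x y z) /
       (real (card ((W(n := X)) i)) * real (card ((W(n := X)) j)) * real (card ((W(n := X)) l))) = (\<Sum>x\<in>X. k x) / real (card X)"
  proof cases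
    case 1
    show ?thesis
      by (intro exI[of _ "\<lambda>x. (\<Sum>y\<in>W j. \<Sum>z\<in>W l. h x y z) / (real (card (W j)) * real (card (W l)))"])
         (use assms 1 in \<open>auto simp: sum_divide_distrib[symmetric] mult_ac\<close>)
  next
    case 2
    have sw: "(\<Sum>x\<in>W i. \<Sum>y\<in>X. \<Sum>z\<in>W l. h x y z) = (\<Sum>y\<in>X. \<Sum>x\<in>W i. \<Sum>z\<in>W l. h x y z)" for X
      by (rule sum.swap)
    show ?thesis
      by (intro exI[of _ "\<lambda>y. (\<Sum>x\<in>W i. \<Sum>z\<in>W l. h x y z) / (real (card (W i)) * real (card (W l)))"])
         (use assms 2 in \<open>auto simp: sum_divide_distrib[symmetric] mult_ac sw\<close>)
  next
    case 3
    have sw: "(\<Sum>x\<in>W i. \<Sum>y\<in>W j. \<Sum>z\<in>X. h x y z) = (\<Sum>z\<in>X. \<Sum>x\<in>W i. \<Sum>y\<in>W j. h x y z)" for X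
    proof -
      have "(\<Sum>x\<in>W i. \<Sum>y\<in>W j. \<Sum>z\<in>X. h x y z) = (\<Sum>x\<in>W i. \<Sum>z\<in>X. \<Sum>y\<in>W j. h x y z)"
        by (intro sum.cong refl sum.swap)
      also have "\<dots> = (\<Sum>z\<in>X. \<Sum>x\<in>W i. \<Sum>y\<in>W j. h x y z)" by (rule sum.swap)
      finally show ?thesis .
    qed
    show ?thesis
      by (intro exI[of _ "\<lambda>z. (\<Sum>x\<in>W i. \<Sum>y\<in>W j. h x y z) / (real (card (W i)) * real (card (W j)))"])
         (use assms 3 in \<open>auto simp: sum_divide_distrib[symmetric] mult_ac sw\<close>)
  next
    case 4
    show ?thesis
      by (intro exI[of _ "\<lambda>_. (\<Sum>x\<in>W i. \<Sum>y\<in>W j. \<Sum>z\<in>W l. h x y z) / (real (card (W i)) * real (card (W j)) * real (card (W l)))"])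
         (use 4 in \<open>auto simp: card_gt_0_iff\<close>)
  qed
qed

text \<open>Discard the elements with the smallest values.\<close>

lemma subset_with_large_average:
  fixes k :: "'v \<Rightarrow> real"
  assumes "finite A" "0 < s" "s \<le> card A"
  shows "\<exists>X\<subseteq>A. card X = s \<and> (\<Sum>x\<in>A. k x) / real (card A) \<le> (\<Sum>x\<in>X. k x) / real s"
  using assms
proof (induction "card A - s" arbitrary: A)
  case 0
  then show ?case by (intro exI[of _ A]) auto
next
  case (Suc n)
  then have c: "s < card A" "finite A" by auto
  then have "A \<noteq> {}" using Suc.prems by auto
  then obtain a where a: "a \<in> A" "\<And>x. x \<in> A \<Longrightarrow> k a \<le> k x"
    using arg_min_if_finite[OF c(2), of k] by (metis linorder_not_less)
  define B where "B = A - {a}"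
  have B: "card B = card A - 1" "finite B" using a c by (auto simp: B_def)
  obtain X where X: "X \<subseteq> B" "card X = s" "(\<Sum>x\<in>B. k x) / real (card B) \<le> (\<Sum>x\<in>X. k x) / real s"
  proof -
    have "n = card B - s" "s \<le> card B" using Suc.hyps(2) B c by auto
    then show ?thesis using Suc.hyps(1)[of B] B Suc.prems that by blast
  qed
  have sA: "(\<Sum>x\<in>A. k x) = k a + (\<Sum>x\<in>B. k x)" unfolding B_def using a c by (simp add: sum.remove)
  have "real (card A) * k a \<le> (\<Sum>x\<in>A. k x)" using a by (intro sum_bounded_below) auto
  moreover have "real (card B) = real (card A) - 1" "real (card A) > 1" using B c Suc.prems by auto
  moreover have "(t + S) / N \<le> S / n" if "N * t \<le> t + S" "n = N - 1" "N > 1" for t S N n :: real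
  proof -
    have "(t + S) * n \<le> S * N" using that(1) unfolding that(2) by (simp add: algebra_simps)
    then show ?thesis using that by (simp add: divide_simps)
  qed
  ultimately have "(\<Sum>x\<in>A. k x) / real (card A) \<le> (\<Sum>x\<in>B. k x) / real (card B)"
    unfolding sA by blast
  then show ?case using X by (intro exI[of _ X]) (auto simp: B_def)
qed

lemma part_averaging_trim:
  assumes F: "part_averaging F" and "finite I" "0 < s" "\<And>i. i \<in> I \<Longrightarrow> finite (A i) \<and> s \<le> card (A i)"
  shows "\<exists>W. (\<forall>i\<in>I. W i \<subseteq> A i \<and> card (W i) = s) \<and> (\<forall>i. i \<notin> I \<longrightarrow> W i = A i) \<and> F A \<le> F W"
  using assms(2,4)
proof (induction I rule: finite_induct)
  case empty
  then show ?case by (intro exI[of _ A]) auto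
next
  case (insert n I)
  then obtain W where W: "\<forall>i\<in>I. W i \<subseteq> A i \<and> card (W i) = s" "\<forall>i. i \<notin> I \<longrightarrow> W i = A i" "F A \<le> F W"
    by (metis insert_iff)
  obtain k where k: "\<And>X. finite X \<Longrightarrow> X \<noteq> {} \<Longrightarrow> F (W(n := X)) = (\<Sum>x\<in>X. k x) / real (card X)"
    using F unfolding part_averaging_def by blast
  have Wn: "W n = A n" using W insert by auto
  have fin: "finite (A n)" "s \<le> card (A n)" using insert by auto
  then obtain X where X: "X \<subseteq> A n" "card X = s" "(\<Sum>x\<in>A n. k x) / real (card (A n)) \<le> (\<Sum>x\<in>X. k x) / real s"
    using subset_with_large_average[of "A n" s k] assms(3) by auto
  have ne: "A n \<noteq> {}" "X \<noteq> {}" "finite X" using X fin assms(3) by (auto intro: finite_subset)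
  have "F W = F (W(n := A n))" using Wn by (metis fun_upd_triv)
  also have "\<dots> \<le> F (W(n := X))" using k ne fin X by simp
  finally have "F A \<le> F (W(n := X))" using W(3) by simp
  moreover have "\<forall>i\<in>insert n I. (W(n := X)) i \<subseteq> A i \<and> card ((W(n := X)) i) = s"
    "\<forall>i. i \<notin> insert n I \<longrightarrow> (W(n := X)) i = A i"
    using W X by auto
  ultimately show ?case by blast
qed

text \<open>Forbidden triples with vertices in three different classes are counted once on the left, namely with
  the classes in increasing order.\<close>

lemma forbidden_transversal_count:
  fixes f :: "'v set \<Rightarrow> 'c" and W :: "nat \<Rightarrow> 'v set"
  assumes "finite I" "\<And>i. i \<in> I \<Longrightarrow> finite (W i)"
    "\<And>i j. i \<in> I \<Longrightarrow> j \<in> I \<Longrightarrow> i \<noteq> j \<Longrightarrow> W i \<inter> W j = {}"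
  shows "(\<Sum>(i, j, l)\<in>{(i, j, l). i \<in> I \<and> j \<in> I \<and> l \<in> I \<and> i < j \<and> j < l}.
            \<Sum>x\<in>W i. \<Sum>y\<in>W j. \<Sum>z\<in>W l. of_bool (D (f {x, y}) (f {x, z}) (f {y, z})))
     \<le> real (card {t. t \<subseteq> (\<Union>i\<in>I. W i) \<and> card t = 3 \<and> forbidden_triple D f t})"
proof -
  define T where "T = {(i, j, l). i \<in> I \<and> j \<in> I \<and> l \<in> I \<and> i < j \<and> j < l}"
  define B where "B = (\<lambda>(i, j, l). {(x, y, z). x \<in> W i \<and> y \<in> W j \<and> z \<in> W l \<and> D (f {x, y}) (f {x, z}) (f {y, z})})"
  define h where "h = (\<lambda>x. THE i. i \<in> I \<and> x \<in> W i)"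
  have h: "h x = i" if "i \<in> I" "x \<in> W i" for i x
    unfolding h_def using that assms(3) by (intro the_equality) auto
  have finT: "finite T" by (rule finite_subset[of _ "I \<times> I \<times> I"]) (use assms in \<open>auto simp: T_def\<close>)
  have finB: "finite (B t)" if "t \<in> T" for t
  proof -
    obtain i j l where t: "t = (i, j, l)" by (cases t)
    show ?thesis
      by (rule finite_subset[of _ "W i \<times> W j \<times> W l"]) (use that assms t in \<open>auto simp: B_def T_def\<close>)
  qed
  have cnt: "(\<Sum>x\<in>W i. \<Sum>y\<in>W j. \<Sum>z\<in>W l. of_bool (D (f {x, y}) (f {x, z}) (f {y, z}))) = real (card (B (i, j, l)))"
    if "(i, j, l) \<in> T" for i j l
  proof -
    have fin: "finite (W i)" "finite (W j)" "finite (W l)" using that assms by (auto simp: T_def)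
    have "(\<Sum>x\<in>W i. \<Sum>y\<in>W j. \<Sum>z\<in>W l. of_bool (D (f {x, y}) (f {x, z}) (f {y, z})) :: real)
       = (\<Sum>(x,y,z)\<in>W i \<times> W j \<times> W l. of_bool (D (f {x, y}) (f {x, z}) (f {y, z})))"
      by (simp add: sum.cartesian_product)
    also have "\<dots> = (\<Sum>v\<in>W i \<times> W j \<times> W l. of_bool (v \<in> B (i, j, l)))"
      by (intro sum.cong refl) (auto simp: B_def)
    also have "\<dots> = real (card (B (i, j, l)))"
    proof -
      have "(W i \<times> W j \<times> W l) \<inter> {v. v \<in> B (i, j, l)} = B (i, j, l)" by (auto simp: B_def)
      then show ?thesis using fin by (simp add: sum_of_bool_eq)
    qed
    finally show ?thesis .
  qed
  define g where "g = (\<lambda>(t :: nat \<times> nat \<times> nat, (x, y, z)). {x, y, z :: 'v})"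
  have "inj_on g (Sigma T B)"
  proof (rule inj_onI)
    fix p q assume "p \<in> Sigma T B" "q \<in> Sigma T B" and eq: "g p = g q"
    then obtain i j l x y z i' j' l' x' y' z'
      where p: "p = ((i, j, l), x, y, z)" and q: "q = ((i', j', l'), x', y', z')"
        and T: "(i, j, l) \<in> T" "(i', j', l') \<in> T"
        and W: "x \<in> W i" "y \<in> W j" "z \<in> W l" "x' \<in> W i'" "y' \<in> W j'" "z' \<in> W l'"
      by (auto simp: B_def)
    have hs: "h x = i" "h y = j" "h z = l" "h x' = i'" "h y' = j'" "h z' = l'"
      using T W by (auto simp: T_def intro!: h)
    have "x = x' \<and> y = y' \<and> z = z'"
      by (rule increasing_triple_unique[where h = h]) (use eq T hs p q in \<open>auto simp: g_def T_def\<close>)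
    then show "p = q" using hs p q by auto
  qed
  moreover have "g ` Sigma T B \<subseteq> {t. t \<subseteq> (\<Union>i\<in>I. W i) \<and> card t = 3 \<and> forbidden_triple D f t}"
  proof (rule image_subsetI)
    fix p assume "p \<in> Sigma T B"
    then obtain i j l x y z where p: "p = ((i, j, l), x, y, z)" and T: "(i, j, l) \<in> T"
      and W: "x \<in> W i" "y \<in> W j" "z \<in> W l" and D: "D (f {x, y}) (f {x, z}) (f {y, z})"
      by (auto simp: B_def)
    have "W i \<inter> W j = {}" "W i \<inter> W l = {}" "W j \<inter> W l = {}" 
      using T assms(3)[of i j] assms(3)[of i l] assms(3)[of j l] by (auto simp: T_def)
    then have "x \<noteq> y" "x \<noteq> z" "y \<noteq> z" using W by auto
    then have "card {x, y, z} = 3" by simp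
    moreover have "forbidden_triple D f {x, y, z}" using D unfolding forbidden_triple_def by blast
    moreover have "{x, y, z} \<subseteq> (\<Union>i\<in>I. W i)" using W T by (auto simp: T_def)
    ultimately show "g p \<in> {t. t \<subseteq> (\<Union>i\<in>I. W i) \<and> card t = 3 \<and> forbidden_triple D f t}" by (simp add: g_def p)
  qed
  moreover have "finite {t. t \<subseteq> (\<Union>i\<in>I. W i) \<and> card t = 3 \<and> forbidden_triple D f t}"
    by (rule finite_subset[of _ "Pow (\<Union>i\<in>I. W i)"]) (use assms in auto)
  ultimately have "card (Sigma T B) \<le> card {t. t \<subseteq> (\<Union>i\<in>I. W i) \<and> card t = 3 \<and> forbidden_triple D f t}"
    by (rule card_inj_on_le)
  moreover have "card (Sigma T B) = (\<Sum>t\<in>T. card (B t))"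
    using finT finB by simp
  moreover have "(\<Sum>(i, j, l)\<in>T. \<Sum>x\<in>W i. \<Sum>y\<in>W j. \<Sum>z\<in>W l. of_bool (D (f {x, y}) (f {x, z}) (f {y, z})))
     = (\<Sum>t\<in>T. real (card (B t)))"
    by (intro sum.cong refl) (auto simp: cnt)
  ultimately show ?thesis unfolding T_def[symmetric] by (simp flip: of_nat_sum)
qed

lemma equitable_disjoint_parts:
  fixes V :: "'v set"
  assumes "finite V"
  obtains A :: "nat \<Rightarrow> 'v set" where
    "\<And>i. i < M \<Longrightarrow> A i \<subseteq> V \<and> card (A i) = card V div M"
    "\<And>i j. i < M \<Longrightarrow> j < M \<Longrightarrow> i \<noteq> j \<Longrightarrow> A i \<inter> A j = {}"
proof -
  define q where "q = card V div M"
  obtain b where b: "bij_betw b {0..<card V} V" using ex_bij_betw_nat_finite[OF assms] by blast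
  have inj: "inj_on b {0..<card V}" using b by (rule bij_betw_imp_inj_on)
  define R where "R = (\<lambda>i. {i * q..<i * q + q})"
  have sub: "R i \<subseteq> {0..<card V}" if "i < M" for i
  proof -
    have "i * q + q = Suc i * q" by simp
    also have "\<dots> \<le> M * q" using that by (intro mult_le_mono1) auto
    also have "\<dots> \<le> card V" by (simp add: q_def)
    finally show ?thesis by (auto simp: R_def)
  qed
  have disj: "R i \<inter> R j = {}" if "i < j" for i j
  proof -
    have "i * q + q = Suc i * q" by simp
    also have "\<dots> \<le> j * q" using that by (intro mult_le_mono1) auto
    finally show ?thesis by (auto simp: R_def)
  qed
  show ?thesis
  proof (rule that[of "\<lambda>i. b ` R i"])
    fix i assume "i < M"
    then have "card (b ` R i) = q" using sub[of i] inj by (subst card_image) (auto simp: R_def intro: inj_on_subset)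
    then show "b ` R i \<subseteq> V \<and> card (b ` R i) = card V div M"
      using sub[OF \<open>i < M\<close>] b by (auto simp: q_def bij_betw_def)
  next
    fix i j assume ij: "i < M" "j < M" "i \<noteq> j"
    then have "R i \<inter> R j = {}" using disj[of i j] disj[of j i] by (cases "i < j") auto
    then show "b ` R i \<inter> b ` R j = {}"
      using inj_on_image_Int[OF inj sub[OF ij(1)] sub[OF ij(2)]] by simp
  qed
qed

text \<open>Cut the vertex set into many classes and make all pairs of classes regular. Rounding the density
  vectors to finitely many values colours the pairs of classes, and Ramsey's theorem gives \<open>m\<close> classes
  with one common rounded vector \<open>d\<close>. Any three of these contain the proportion \<open>forbidden_mass C D d\<close>
  of forbidden triples, and in their union, after the sizes are equalised, only a fraction \<open>O(1/m)\<close> of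
  all triples is not transversal.\<close>

lemma forbidden_dense_subset:
  fixes C :: "'c set" and \<beta> e :: real
  assumes C: "finite C" "C \<noteq> {}"
    and \<beta>: "\<And>p. (\<And>a. a \<in> C \<Longrightarrow> 0 \<le> p a) \<Longrightarrow> \<beta> * (sum p C) ^ 3 \<le> forbidden_mass C D p" "0 \<le> \<beta>" "\<beta> \<le> 1"
    and e: "0 < e"
  obtains \<gamma> n0 where "0 < \<gamma>"
    "\<forall>(V :: 'v set) f. finite V \<longrightarrow> n0 \<le> card V \<longrightarrow> (\<forall>t. f t \<in> C) \<longrightarrow>
      (\<exists>U\<subseteq>V. \<gamma> * real (card V) \<le> real (card U) \<and>
        (\<beta> - e) * real (card U choose 3) \<le> real (card {t. t \<subseteq> U \<and> card t = 3 \<and> forbidden_triple D f t}))"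
proof -
  define k where "k = real (card C)"
  have k: "k \<ge> 1" using C by (simp add: k_def card_gt_0_iff Suc_le_eq)
  \<comment> \<open>The second entry makes the counting error in \<open>regular_forbidden_count\<close> at most \<open>e / 2\<close>; the first is
    one of its assumptions.\<close>
  define \<epsilon> where "\<epsilon> = min (1 / k) (e / (12 * k ^ 3))"
  have \<epsilon>: "0 < \<epsilon>" using k e by (simp add: \<epsilon>_def)
  have k\<epsilon>: "k * \<epsilon> \<le> 1"
  proof -
    have "k * \<epsilon> \<le> k * (1 / k)" using k by (intro mult_left_mono) (auto simp: \<epsilon>_def)
    then show ?thesis using k by simp
  qed
  have err: "3 * k * \<epsilon> + 3 * k ^ 3 * \<epsilon> \<le> e / 2"
  proof -
    have "k \<le> k ^ 3" using k self_le_power[of k 3] by simp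
    then have "3 * k * \<epsilon> + 3 * k ^ 3 * \<epsilon> \<le> 6 * k ^ 3 * \<epsilon>" using \<epsilon> by simp
    also have "\<dots> \<le> 6 * k ^ 3 * (e / (12 * k ^ 3))" using k by (intro mult_left_mono) (auto simp: \<epsilon>_def)
    also have "\<dots> = e / 2" using k by simp
    finally show ?thesis .
  qed
  \<comment> \<open>Densities are rounded down to multiples of \<open>1 / n\<close>, an error of at most \<open>\<epsilon> / 2\<close>.\<close>
  define n where "n = nat \<lceil>2 / \<epsilon>\<rceil>"
  have n: "2 / \<epsilon> \<le> real n" unfolding n_def by (rule real_nat_ceiling_ge)
  have n0: "0 < real n" using n \<epsilon> divide_pos_pos[of 2 \<epsilon>] by linarith
  have n': "1 / real n \<le> \<epsilon> / 2" using n n0 \<epsilon> by (simp add: field_simps)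
  \<comment> \<open>Of the triples in the union of \<open>m\<close> equal classes, a fraction of about \<open>3 / m \<le> e / 2\<close> is not transversal.\<close>
  define m where "m = nat \<lceil>6 / e\<rceil> + 3"
  have m: "6 / e \<le> real m" "3 \<le> m"
    using real_nat_ceiling_ge[of "6 / e"] by (simp_all add: m_def)
  define R where "R = (PiE C (\<lambda>_. {0..n}))"
  have finR: "finite R" using C by (simp add: R_def finite_PiE)
  obtain h where h: "bij_betw h R {0..<card R}" using ex_bij_betw_finite_nat[OF finR] by blast
  obtain M :: nat where M: "partn_lst {..<M} (replicate (card R) m) 2" using ramsey_full by blast
  define E where "E = {(i, j). i < j \<and> j < (M :: nat)}"
  have finE: "finite E" by (rule finite_subset[of _ "{..<M} \<times> {..<M}"]) (auto simp: E_def)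
  have "\<forall>(i, j)\<in>E. i \<noteq> j" "0 < \<epsilon> / 2" using \<epsilon> by (auto simp: E_def)
  from regular_subparts_exist[OF C(1) finE this, where 'v = 'v]
  obtain \<gamma>1 where \<gamma>1: "0 < \<gamma>1" and parts: "\<And>(A :: nat \<Rightarrow> 'v set) g. (\<And>i. finite (A i) \<and> A i \<noteq> {}) \<Longrightarrow>
     (\<exists>A'. (\<forall>i. A' i \<subseteq> A i \<and> \<gamma>1 * real (card (A i)) \<le> real (card (A' i))) \<and>
        (\<forall>(i,j)\<in>E. \<exists>d. (\<forall>a::'c. 0 \<le> d a \<and> d a \<le> 1) \<and> regular_pair C g (A' i) (A' j) d (\<epsilon> / 2)))"
    by blast
  define \<gamma> where "\<gamma> = \<gamma>1 / (2 * real (M + 1))"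
  show ?thesis
  proof (rule that[of \<gamma> "M + 1"], goal_cases)
    case 1
    show "0 < \<gamma>" using \<gamma>1 by (simp add: \<gamma>_def)
  next
    case 2
    show ?case
    proof (intro allI impI)
    fix V :: "'v set" and f :: "'v set \<Rightarrow> 'c"
    assume V: "finite V" "M + 1 \<le> card V" and f0: "\<forall>t. f t \<in> C"
    then have f: "\<And>t. f t \<in> C" by blast
    define q where "q = card V div (M + 1)"
    have q: "1 \<le> q" using V by (simp add: q_def div_greater_zero_iff Suc_le_eq)
    have "card V < (q + 1) * (M + 1)"
      using dividend_less_div_times[of "M + 1" "card V"] by (simp add: q_def)
    also have "(q + 1) * (M + 1) \<le> (2 * q) * (M + 1)" using q by (intro mult_le_mono1) simp
    finally have "card V < (2 * q) * (M + 1)" .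
    then have "real (card V) \<le> real ((2 * q) * (M + 1))" by (simp only: of_nat_le_iff)
    then have qV: "\<gamma> * real (card V) \<le> \<gamma>1 * real q"
      using \<gamma>1 mult_left_mono[of "real (card V)" "2 * real q * real (M + 1)" "\<gamma>1"]
      by (simp add: \<gamma>_def field_simps)
    obtain A0 :: "nat \<Rightarrow> 'v set" where A00: "\<And>i. i < M + 1 \<Longrightarrow> A0 i \<subseteq> V \<and> card (A0 i) = card V div (M + 1)"
      "\<And>i j. i < M + 1 \<Longrightarrow> j < M + 1 \<Longrightarrow> i \<noteq> j \<Longrightarrow> A0 i \<inter> A0 j = {}"
      using equitable_disjoint_parts[OF V(1), of "M + 1"] by metis
    note A0 = A00[folded q_def]
    \<comment> \<open>Part \<open>M\<close> is a dummy for the indices from \<open>M\<close> on, for which \<open>regular_subparts_exist\<close> also wants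
      nonempty sets; only the parts with index below \<open>M\<close> need to be disjoint.\<close>
    define A where "A = (\<lambda>i. A0 (min i M))"
    have A: "A i \<subseteq> V" "card (A i) = q" for i using A0(1)[of "min i M"] by (auto simp: A_def)
    have Aok: "finite (A i) \<and> A i \<noteq> {}" for i using A[of i] V q by (auto intro: finite_subset)
    have Adisj: "A i \<inter> A j = {}" if "i < M" "j < M" "i \<noteq> j" for i j
      using that A0(2)[of i j] by (simp add: A_def)
    obtain A' where A'0: "\<forall>i. A' i \<subseteq> A i \<and> \<gamma>1 * real (card (A i)) \<le> real (card (A' i))"
      and reg: "\<forall>(i,j)\<in>E. \<exists>d. (\<forall>a::'c. 0 \<le> d a \<and> d a \<le> 1) \<and> regular_pair C (\<lambda>x y. f {x, y}) (A' i) (A' j) d (\<epsilon> / 2)"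
      using parts[of A "\<lambda>x y. f {x, y}", OF Aok] by (elim exE conjE)
    have A': "\<And>i. A' i \<subseteq> A i" "\<And>i. \<gamma>1 * real q \<le> real (card (A' i))"
      using A'0 A(2) by simp_all
    have "\<forall>i j. \<exists>d. i < j \<and> j < M \<longrightarrow> (\<forall>a::'c. 0 \<le> d a \<and> d a \<le> 1) \<and> regular_pair C (\<lambda>x y. f {x, y}) (A' i) (A' j) d (\<epsilon> / 2)"
      using reg unfolding E_def by blast
    then obtain dd where dd: "\<And>i j a. i < j \<Longrightarrow> j < M \<Longrightarrow> 0 \<le> dd i j a \<and> dd i j (a :: 'c) \<le> 1"
      "\<And>i j. i < j \<Longrightarrow> j < M \<Longrightarrow> regular_pair C (\<lambda>x y. f {x, y}) (A' i) (A' j) (dd i j) (\<epsilon> / 2)"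
      by metis
    define rd where "rd = (\<lambda>i j. \<lambda>a\<in>C. nat \<lfloor>real n * dd i j a\<rfloor>)"
    have rdR: "rd i j \<in> R" if "i < j" "j < M" for i j
    proof -
      have "nat \<lfloor>real n * dd i j a\<rfloor> \<le> n" for a
      proof -
        have "real n * dd i j a \<le> real n * 1" using dd(1)[OF that, of a] by (intro mult_left_mono) auto
        then show ?thesis by linarith
      qed
      then show ?thesis by (auto simp: rd_def R_def)
    qed
    define col where "col = (\<lambda>t. h (rd (Min t) (Max t)))"
    have "col \<in> nsets {..<M} 2 \<rightarrow> {..<length (replicate (card R) m)}"
    proof
      fix t assume "t \<in> nsets {..<M} 2"
      then obtain x y where xy: "t = {x, y}" "x < M" "y < M" "x \<noteq> y" by (auto elim!: nsets2_E)
      then have "rd (Min t) (Max t) \<in> R" by (intro rdR) (auto simp: min_def max_def)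
      then show "col t \<in> {..<length (replicate (card R) m)}"
        using h by (auto simp: col_def bij_betw_def)
    qed
    then obtain c I where c: "c < card R" and I: "I \<in> nsets {..<M} m" "col ` nsets I 2 \<subseteq> {c}"
      using M unfolding partn_lst_def monochromatic_def by fastforce
    have I': "finite I" "I \<subseteq> {..<M}" "card I = m" using I by (auto simp: nsets_def intro: finite_subset)
    obtain r where r: "r \<in> R" "h r = c" using c h by (metis atLeastLessThan_iff bij_betw_imp_surj_on imageE le0)
    have rd_eq: "rd i j = r" if "i \<in> I" "j \<in> I" "i < j" for i j
    proof -
      have "{i, j} \<in> nsets I 2" using that by simp
      then have "col {i, j} = c" using I(2) by (meson image_subset_iff singletonD)
      moreover have "col {i, j} = h (rd i j)" using that(3) by (simp add: col_def min_def max_def)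
      ultimately have "h (rd i j) = h r" using r by simp
      moreover have "rd i j \<in> R" using that I' by (intro rdR) auto
      ultimately show ?thesis using r(1) bij_betw_imp_inj_on[OF h] by (metis inj_onD)
    qed
    define d where "d = (\<lambda>a. real (r a) / real n)"
    have d01: "0 \<le> d a \<and> d a \<le> 1" if "a \<in> C" for a
      using that r n0 by (auto simp: d_def R_def PiE_iff)
    have regd: "regular_pair C (\<lambda>x y. f {x, y}) (A' i) (A' j) d \<epsilon>" if ij: "i \<in> I" "j \<in> I" "i < j" for i j
    proof -
      have jM: "j < M" using ij I' by auto
      have close: "\<bar>dd i j a - d a\<bar> \<le> \<epsilon> / 2" if "a \<in> C" for a
      proof -
        have "r a = nat \<lfloor>real n * dd i j a\<rfloor>" using rd_eq[OF ij] that by (auto simp: rd_def)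
        moreover have "0 \<le> real n * dd i j a" using dd(1)[OF ij(3) jM, of a] by simp
        ultimately have "\<bar>real n * dd i j a - real (r a)\<bar> \<le> 1" by linarith
        moreover have "real n * dd i j a - real (r a) = real n * (dd i j a - d a)" using n0 by (simp add: d_def algebra_simps)
        ultimately have "real n * \<bar>dd i j a - d a\<bar> \<le> 1" by (simp add: abs_mult)
        then have "\<bar>dd i j a - d a\<bar> \<le> 1 / real n" using n0 by (simp add: field_simps)
        then show ?thesis using n' by linarith
      qed
      have "regular_pair C (\<lambda>x y. f {x, y}) (A' i) (A' j) d (\<epsilon> / 2 + \<epsilon> / 2)"
        using Aok A' by (intro regular_pair_round[OF dd(2)[OF ij(3) jM] close]) (auto intro: finite_subset)
      then show ?thesis by simp
    qed
    define T where "T = {(i, j, l). i \<in> I \<and> j \<in> I \<and> l \<in> I \<and> i < j \<and> j < l}"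
    define hh where "hh = (\<lambda>x y z. of_bool (D (f {x, y}) (f {x, z}) (f {y, z})) :: real)"
    \<comment> \<open>The sum of the densities of forbidden transversal triples, without any weighting by class sizes.\<close>
    define F where "F = (\<lambda>W :: nat \<Rightarrow> 'v set. \<Sum>t\<in>T. case t of (i, j, l) \<Rightarrow> (\<Sum>x\<in>W i. \<Sum>y\<in>W j. \<Sum>z\<in>W l. hh x y z) /
            (real (card (W i)) * real (card (W j)) * real (card (W l))))"
    define b where "b = \<beta> - 3 * k * \<epsilon> - 3 * k ^ 3 * \<epsilon>"
    have A'fin: "finite (A' i)" for i using A'(1) Aok by (meson finite_subset)
    have A'ne: "A' i \<noteq> {}" for i
    proof -
      have "0 < \<gamma>1 * real q" using \<gamma>1 q by simp
      then have "0 < real (card (A' i))" using A'(2)[of i] by linarith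
      then show ?thesis by auto
    qed
    have cardT: "card T = m choose 3"
    proof -
      have "card T = card {t. t \<subseteq> I \<and> card t = 3}"
        unfolding T_def by (rule bij_betw_same_card[OF bij_betw_increasing_triples])
      then show ?thesis using n_subsets[OF I'(1), of 3] I' by simp
    qed
    have FA: "real (card T) * b \<le> F A'"
      unfolding F_def
    proof (rule sum_bounded_below)
      fix t assume "t \<in> T"
      then obtain i j l where t: "t = (i, j, l)" "i \<in> I" "j \<in> I" "l \<in> I" "i < j" "j < l" by (auto simp: T_def)
      have "b * (real (card (A' i)) * real (card (A' j)) * real (card (A' l))) \<le> (\<Sum>x\<in>A' i. \<Sum>y\<in>A' j. \<Sum>z\<in>A' l. hh x y z)"
        unfolding hh_def b_def k_def
        by (rule regular_forbidden_count[where d = d])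
           (use t C A'fin A'ne d01 f \<beta> \<epsilon> k\<epsilon> in \<open>auto intro!: regd simp: k_def\<close>)
      moreover have "0 < real (card (A' i)) * real (card (A' j)) * real (card (A' l))"
        using A'fin A'ne by (simp add: card_gt_0_iff)
      ultimately show "b \<le> (case t of (i, j, l) \<Rightarrow> (\<Sum>x\<in>A' i. \<Sum>y\<in>A' j. \<Sum>z\<in>A' l. hh x y z) /
            (real (card (A' i)) * real (card (A' j)) * real (card (A' l))))"
        by (simp add: t(1) le_divide_eq)
    qed
    define s where "s = nat \<lceil>\<gamma>1 * real q\<rceil>"
    have s: "0 < s" "\<gamma>1 * real q \<le> real s" using \<gamma>1 q by (auto simp: s_def)
    have sA': "s \<le> card (A' i)" for i using A'(2)[of i] by (simp add: s_def)
    have "part_averaging F"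
      unfolding F_def
    proof (rule part_averaging_sum)
      fix t assume "t \<in> T"
      then obtain i j l where t: "t = (i, j, l)" "i < j" "j < l" by (auto simp: T_def)
      show "part_averaging (\<lambda>W. case t of (i, j, l) \<Rightarrow> (\<Sum>x\<in>W i. \<Sum>y\<in>W j. \<Sum>z\<in>W l. hh x y z) /
            (real (card (W i)) * real (card (W j)) * real (card (W l))))"
        unfolding t(1) prod.case by (rule part_averaging_triple) (use t in auto)
    qed
    from part_averaging_trim[OF this I'(1) s(1), of A']
    obtain W where W: "\<And>i. i \<in> I \<Longrightarrow> W i \<subseteq> A' i \<and> card (W i) = s" "F A' \<le> F W"
      using A'fin sA' by blast
    define U where "U = (\<Union>i\<in>I. W i)"
    have Wdisj: "W i \<inter> W j = {}" if "i \<in> I" "j \<in> I" "i \<noteq> j" for i j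
      using that W(1)[of i] W(1)[of j] A'(1)[of i] A'(1)[of j] Adisj[of i j] I' by fastforce
    have Wfin: "finite (W i)" if "i \<in> I" for i using W(1)[OF that] A'fin by (meson finite_subset)
    have cardU: "card U = m * s"
    proof -
      have "card U = (\<Sum>i\<in>I. card (W i))" unfolding U_def
        by (rule card_UN_disjoint) (use I' Wfin Wdisj in auto)
      then show ?thesis using W(1) I' by simp
    qed
    have UV: "U \<subseteq> V" using W(1) A'(1) A(1) unfolding U_def by blast
    have FW: "F W * real s ^ 3 = (\<Sum>(i, j, l)\<in>T. \<Sum>x\<in>W i. \<Sum>y\<in>W j. \<Sum>z\<in>W l. hh x y z)"
      unfolding F_def sum_distrib_right
      by (intro sum.cong refl) (use W(1) s in \<open>auto simp: T_def power3_eq_cube\<close>)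
    have "(\<Sum>(i, j, l)\<in>T. \<Sum>x\<in>W i. \<Sum>y\<in>W j. \<Sum>z\<in>W l. hh x y z) \<le> real (card {t. t \<subseteq> U \<and> card t = 3 \<and> forbidden_triple D f t})"
      unfolding T_def hh_def U_def by (rule forbidden_transversal_count) (use I' Wfin Wdisj in auto)
    moreover have "real (card T) * b * real s ^ 3 \<le> F W * real s ^ 3"
      using FA W(2) by (intro mult_right_mono) auto
    ultimately have low: "real (m choose 3) * b * real s ^ 3 \<le> real (card {t. t \<subseteq> U \<and> card t = 3 \<and> forbidden_triple D f t})"
      using FW cardT by simp
    have b: "\<beta> - e / 2 \<le> b" using err by (simp add: b_def)
    have fin: "(\<beta> - e) * real (card U choose 3) \<le> real (card {t. t \<subseteq> U \<and> card t = 3 \<and> forbidden_triple D f t})"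
    proof (cases "\<beta> - e \<le> 0")
      case True
      then have "(\<beta> - e) * real (card U choose 3) \<le> 0" by (simp add: mult_nonpos_nonneg)
      then show ?thesis using of_nat_0_le_iff order_trans by blast
    next
      case False
      define x where "x = real m"
      have x: "3 \<le> x" "6 / e \<le> x" using m by (simp_all add: x_def)
      then have ex: "6 \<le> e * x" using e by (simp add: field_simps)
      have "real (card U choose 3) \<le> (x * real s) ^ 3 / 6" using choose_3_le[of "card U"] by (simp add: cardU x_def)
      then have "(\<beta> - e) * real (card U choose 3) \<le> (\<beta> - e) * ((x * real s) ^ 3 / 6)"
        using False by (intro mult_left_mono) auto
      also have "\<dots> = (\<beta> - e) * (x ^ 3 / 6) * real s ^ 3" by (simp add: power_mult_distrib)
      also have "\<dots> \<le> real (m choose 3) * b * real s ^ 3"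
      proof (intro mult_right_mono)
        \<comment> \<open>The non-transversal triples cost \<open>3 * \<beta> / x\<close>, relative to all, and the gap \<open>e / 2\<close> pays for it.\<close>
        have "(\<beta> - e) * (x ^ 3 / 6) \<le> (x ^ 3 / 6 - x ^ 2 / 2) * (\<beta> - e / 2)"
        proof -
          have "\<beta> * 3 \<le> 3" using \<beta> by simp
          then have "3 * \<beta> \<le> e * x / 2" using ex by linarith
          moreover have "3 * (\<beta> - e / 2) \<le> 3 * \<beta>" using e by simp
          ultimately have "3 * (\<beta> - e / 2) \<le> e * x / 2" by linarith
          then have "x ^ 2 / 6 * (3 * (\<beta> - e / 2)) \<le> x ^ 2 / 6 * (e * x / 2)" by (intro mult_left_mono) auto
          moreover have "(x ^ 3 / 6 - x ^ 2 / 2) * (\<beta> - e / 2) - (\<beta> - e) * (x ^ 3 / 6) = x ^ 2 / 6 * (e * x / 2) - x ^ 2 / 6 * (3 * (\<beta> - e / 2))"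
            by (simp add: field_simps power2_eq_square power3_eq_cube)
          ultimately show ?thesis by linarith
        qed
        also have "\<dots> \<le> real (m choose 3) * (\<beta> - e / 2)"
          using choose_3_ge[of m] False e by (intro mult_right_mono) (auto simp: x_def)
        also have "\<dots> \<le> real (m choose 3) * b" using b by (intro mult_left_mono) auto
        finally show "(\<beta> - e) * (x ^ 3 / 6) \<le> real (m choose 3) * b" .
      qed auto
      finally show ?thesis using low by linarith
    qed
    have "\<gamma> * real (card V) \<le> real (card U)"
    proof -
      have "\<gamma> * real (card V) \<le> 1 * real s" using qV s by linarith
      also have "\<dots> \<le> real m * real s" using m by (intro mult_right_mono) auto
      finally show ?thesis by (simp add: cardU)
    qed
    with fin UV show "\<exists>U\<subseteq>V. \<gamma> * real (card V) \<le> real (card U) \<and>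
        (\<beta> - e) * real (card U choose 3) \<le> real (card {t. t \<subseteq> U \<and> card t = 3 \<and> forbidden_triple D f t})"
      by (intro exI[of _ U] conjI)
    qed
  qed
qed

text \<open>The set found by \<open>forbidden_dense_subset\<close> has linear size, so its deficit of edges is cubic in the
  number of vertices and beats the error term in the definition of uniform density.\<close>

lemma paintable_not_dense:
  fixes C :: "'c set" and \<beta> e :: real
  assumes C: "finite C" "C \<noteq> {}"
    and \<beta>: "\<And>p. (\<And>a. a \<in> C \<Longrightarrow> 0 \<le> p a) \<Longrightarrow> \<beta> * (sum p C) ^ 3 \<le> forbidden_mass C D p" "0 \<le> \<beta>" "\<beta> \<le> 1"
    and e: "0 < e"
  obtains \<eta> n0 where "0 < \<eta>"
    "\<forall>H :: 'v hgraph. three_graph H \<longrightarrow> paintable C D H \<longrightarrow> n0 \<le> card (verts H) \<longrightarrow> \<not> uniformly_dense (1 - \<beta> + e) \<eta> H"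
proof -
  have "0 < e / 2" using e by simp
  from forbidden_dense_subset[OF C \<beta> this, where 'v = 'v]
  obtain \<gamma> n0 where \<gamma>: "0 < \<gamma>" and U:
    "\<forall>(V :: 'v set) f. finite V \<longrightarrow> n0 \<le> card V \<longrightarrow> (\<forall>t. f t \<in> C) \<longrightarrow>
      (\<exists>U\<subseteq>V. \<gamma> * real (card V) \<le> real (card U) \<and>
        (\<beta> - e / 2) * real (card U choose 3) \<le> real (card {t. t \<subseteq> U \<and> card t = 3 \<and> forbidden_triple D f t}))"
    .
  \<comment> \<open>The surplus \<open>e / 2\<close> on a set of size \<open>u \<ge> \<gamma> * N\<close> amounts to at least \<open>e / 2 * u ^ 3 / 12\<close> triples, which
    is twice \<open>\<eta> * N ^ 3\<close>.\<close>
  define \<eta> where "\<eta> = e * \<gamma> ^ 3 / 48"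
  have \<eta>: "0 < \<eta>" using e \<gamma> by (simp add: \<eta>_def)
  show ?thesis
  proof (rule that[of \<eta> "n0 + nat \<lceil>6 / \<gamma>\<rceil> + 1"])
    show "0 < \<eta>" by (rule \<eta>)
    show "\<forall>H :: 'v hgraph. three_graph H \<longrightarrow> paintable C D H \<longrightarrow> n0 + nat \<lceil>6 / \<gamma>\<rceil> + 1 \<le> card (verts H) \<longrightarrow> \<not> uniformly_dense (1 - \<beta> + e) \<eta> H"
    proof (intro allI impI notI)
    fix H :: "'v hgraph"
    assume H: "three_graph H" "paintable C D H" and n: "n0 + nat \<lceil>6 / \<gamma>\<rceil> + 1 \<le> card (verts H)"
      assume dense: "uniformly_dense (1 - \<beta> + e) \<eta> H"
      obtain f where f: "\<And>t. f t \<in> C" "\<And>t. t \<in> edges H \<Longrightarrow> \<not> forbidden_triple D f t"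
        using H(2) unfolding paintable_def by (elim exE conjE) blast
      have fin: "finite (verts H)" using H by (simp add: three_graph_def)
      define N where "N = real (card (verts H))"
      have Npos: "0 < N" and N\<gamma>: "6 \<le> \<gamma> * N"
      proof -
        show "0 < N" using n by (simp add: N_def)
        have "6 / \<gamma> \<le> N" using n unfolding N_def by linarith
        then show "6 \<le> \<gamma> * N" using \<gamma> by (simp add: field_simps)
      qed
      obtain U where Usub: "U \<subseteq> verts H" and Ucard: "\<gamma> * N \<le> real (card U)"
        and Uforb: "(\<beta> - e / 2) * real (card U choose 3) \<le> real (card {t. t \<subseteq> U \<and> card t = 3 \<and> forbidden_triple D f t})"
      proof -
        have "n0 \<le> card (verts H)" "\<forall>t. f t \<in> C" using n f by auto
        then show ?thesis using U[rule_format, of "verts H" f] fin that unfolding N_def by blast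
      qed
      have finU: "finite U" using Usub fin by (rule finite_subset)
      have "edges_in H U + card {t. t \<subseteq> U \<and> card t = 3 \<and> forbidden_triple D f t} \<le> card U choose 3"
      proof -
        define X where "X = {t \<in> edges H. t \<subseteq> U}"
        define Y where "Y = {t. t \<subseteq> U \<and> card t = 3 \<and> forbidden_triple D f t}"
        have fX: "finite X" "finite Y" using finU by (auto simp: X_def Y_def intro!: finite_subset[of _ "Pow U"])
        have "X \<inter> Y = {}" using f(2) by (auto simp: X_def Y_def)
        then have "card X + card Y = card (X \<union> Y)" using fX by (simp add: card_Un_disjoint)
        also have "\<dots> \<le> card {t. t \<subseteq> U \<and> card t = 3}"
          using H finU by (intro card_mono) (auto simp: X_def Y_def three_graph_def)
        also have "\<dots> = card U choose 3" using finU by (rule n_subsets)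
        finally show ?thesis by (simp add: edges_in_def X_def Y_def)
      qed
      then have "real (edges_in H U) + real (card {t. t \<subseteq> U \<and> card t = 3 \<and> forbidden_triple D f t}) \<le> real (card U choose 3)"
        by (simp flip: of_nat_add)
      moreover have "(1 - \<beta> + e) * real (card U choose 3) - \<eta> * N ^ 3 \<le> real (edges_in H U)"
        using dense Usub unfolding uniformly_dense_def N_def by blast
      ultimately have le: "e / 2 * real (card U choose 3) \<le> \<eta> * N ^ 3" using Uforb by (simp add: algebra_simps)
      define u where "u = real (card U)"
      have u: "6 \<le> u" "\<gamma> * N \<le> u" using Ucard N\<gamma> by (auto simp: u_def)
      have "u ^ 3 / 12 \<le> u ^ 3 / 6 - u ^ 2 / 2"
      proof -
        have "u ^ 2 * 6 \<le> u ^ 2 * u" using u by (intro mult_left_mono) auto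
        then show ?thesis by (simp add: power2_eq_square power3_eq_cube)
      qed
      also have "\<dots> \<le> real (card U choose 3)" using choose_3_ge[of "card U"] by (simp add: u_def)
      finally have "e / 2 * (u ^ 3 / 12) \<le> \<eta> * N ^ 3" using le e by (smt (verit) mult_left_mono divide_pos_pos)
      moreover have "(\<gamma> * N) ^ 3 \<le> u ^ 3" using u \<gamma> Npos by (intro power_mono) auto
      then have "e / 2 * ((\<gamma> * N) ^ 3 / 12) \<le> e / 2 * (u ^ 3 / 12)" using e by (intro mult_left_mono) auto
      ultimately have "e * \<gamma> ^ 3 / 24 * N ^ 3 \<le> e * \<gamma> ^ 3 / 48 * N ^ 3" by (simp add: \<eta>_def power_mult_distrib algebra_simps)
      moreover have "e * \<gamma> ^ 3 / 24 * N ^ 3 = 2 * (e * \<gamma> ^ 3 / 48 * N ^ 3)" by simp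
      moreover have "0 < e * \<gamma> ^ 3 / 48 * N ^ 3" using e \<gamma> Npos by simp
      ultimately show False by linarith
    qed
  qed
qed

section \<open>Random colourings\<close>

lemma forbidden_triple_iff:
  assumes "symmetric_relation D" "u \<noteq> v" "u \<noteq> w" "v \<noteq> w"
  shows "forbidden_triple D f {u, v, w} \<longleftrightarrow> D (f {u, v}) (f {u, w}) (f {v, w})"
proof
  have sym: "D a b c = D b a c" "D a b c = D a c b" for a b c
    using assms(1) unfolding symmetric_relation_def by blast+
  have perm: "D a b c \<Longrightarrow> D b a c" "D a b c \<Longrightarrow> D a c b" "D a b c \<Longrightarrow> D b c a" "D a b c \<Longrightarrow> D c a b" "D a b c \<Longrightarrow> D c b a" for a b c
    using sym by blast+
  assume "forbidden_triple D f {u, v, w}"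
  then obtain x y z where t: "{u, v, w} = {x, y, z}" and D: "D (f {x, y}) (f {x, z}) (f {y, z})"
    unfolding forbidden_triple_def by blast
  have "x \<in> {u, v, w}" "y \<in> {u, v, w}" "z \<in> {u, v, w}" using t by auto
  moreover have "x \<noteq> y" "x \<noteq> z" "y \<noteq> z"
    using t assms(2-4) by (metis insert_absorb2 card_2_iff doubleton_eq_iff insertCI insertE singletonD)+
  ultimately consider "x = u" "y = v" "z = w" | "x = u" "y = w" "z = v" | "x = v" "y = u" "z = w"
    | "x = v" "y = w" "z = u" | "x = w" "y = u" "z = v" | "x = w" "y = v" "z = u" by auto
  then show "D (f {u, v}) (f {u, w}) (f {v, w})"
  proof cases
    case 1 then show ?thesis using D by simp
  next
    case 2 then show ?thesis using D perm(1) by (simp add: insert_commute)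
  next
    case 3 then show ?thesis using D perm(2) by (simp add: insert_commute)
  next
    case 4 then show ?thesis using D perm(3) by (simp add: insert_commute)
  next
    case 5 then show ?thesis using D perm(4) by (simp add: insert_commute)
  next
    case 6 then show ?thesis using D perm(5) by (simp add: insert_commute)
  qed
next
  assume "D (f {u, v}) (f {u, w}) (f {v, w})"
  then show "forbidden_triple D f {u, v, w}" unfolding forbidden_triple_def by blast
qed

text \<open>Three distinct pairs receive independent colours.\<close>

lemma random_colouring_expectation:
  fixes C :: "'c set" and E :: "'e set"
  assumes "finite C" and P: "\<And>a. a \<in> C \<Longrightarrow> pmf P a = p a" "set_pmf P \<subseteq> C"
    and E: "finite E" "e1 \<in> E" "e2 \<in> E" "e3 \<in> E" "e1 \<noteq> e2" "e1 \<noteq> e3" "e2 \<noteq> e3"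
  shows "measure_pmf.expectation (Pi_pmf E dflt (\<lambda>_. P)) (\<lambda>g. of_bool (D (g e1) (g e2) (g e3))) = forbidden_mass C D p"
proof -
  let ?M = "Pi_pmf E dflt (\<lambda>_. P)"
  define Q :: "'c \<Rightarrow> 'c \<Rightarrow> 'c \<Rightarrow> ('e \<Rightarrow> 'c) \<Rightarrow> real" where "Q = (\<lambda>a b c g. of_bool (g e1 = a \<and> g e2 = b \<and> g e3 = c))"
  have inC: "g e \<in> C" if "g \<in> set_pmf ?M" "e \<in> E" for g e
    using subsetD[OF set_Pi_pmf_subset'[OF E(1)] that(1)] that(2) P(2) by (auto simp: PiE_dflt_def)
  have prob: "measure_pmf.expectation ?M (Q a b c) = pmf P a * pmf P b * pmf P c" for a b c
  proof -
    define B where "B = (\<lambda>i. if i = e1 then {a} else if i = e2 then {b} else if i = e3 then {c} else UNIV)"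
    have "Q a b c = indicator (Pi E B)"
      using E by (auto simp: Q_def B_def indicator_def fun_eq_iff Pi_def)
    then have "measure_pmf.expectation ?M (Q a b c) = measure_pmf.prob ?M (Pi E B)" by simp
    also have "\<dots> = (\<Prod>i\<in>E. measure_pmf.prob P (B i))" by (rule measure_Pi_pmf_Pi[OF E(1)])
    also have "\<dots> = (\<Prod>i\<in>E. (if i = e1 then pmf P a else 1) * (if i = e2 then pmf P b else 1) * (if i = e3 then pmf P c else 1))"
      by (intro prod.cong refl) (use E in \<open>auto simp: B_def measure_pmf_single\<close>)
    also have "\<dots> = pmf P a * pmf P b * pmf P c"
      using E by (simp add: prod.distrib prod.delta)
    finally show ?thesis .
  qed
  have int: "integrable (measure_pmf ?M) (\<lambda>g. of_bool (D a b c) * Q a b c g)" for a b c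
    by (intro measure_pmf.integrable_const_bound[where B = 1]) (auto simp: Q_def)
  have "measure_pmf.expectation ?M (\<lambda>g. of_bool (D (g e1) (g e2) (g e3)))
     = measure_pmf.expectation ?M (\<lambda>g. \<Sum>a\<in>C. \<Sum>b\<in>C. \<Sum>c\<in>C. of_bool (D a b c) * Q a b c g)"
  proof (intro integral_cong_AE AE_pmfI)
    fix g assume g: "g \<in> set_pmf ?M"
    have sc: "(\<Sum>a\<in>C. of_bool (g e = a) * h a) = h (g e)" if "e \<in> E" for e and h :: "'c \<Rightarrow> real"
    proof -
      have "(\<Sum>a\<in>C. of_bool (g e = a) * h a) = (\<Sum>a\<in>C. if g e = a then h a else 0)" by (intro sum.cong) auto
      then show ?thesis using inC[OF g that] assms(1) by simp
    qed
    have "(\<Sum>a\<in>C. \<Sum>b\<in>C. \<Sum>c\<in>C. of_bool (D a b c) * Q a b c g)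
      = (\<Sum>a\<in>C. of_bool (g e1 = a) * (\<Sum>b\<in>C. of_bool (g e2 = b) * (\<Sum>c\<in>C. of_bool (g e3 = c) * of_bool (D a b c))))"
      unfolding Q_def sum_distrib_left by (intro sum.cong refl) (simp add: of_bool_conj)
    then show "of_bool (D (g e1) (g e2) (g e3)) = (\<Sum>a\<in>C. \<Sum>b\<in>C. \<Sum>c\<in>C. of_bool (D a b c) * Q a b c g)"
      using E by (simp only: sc)
  qed auto
  also have "\<dots> = (\<Sum>a\<in>C. \<Sum>b\<in>C. \<Sum>c\<in>C. of_bool (D a b c) * (pmf P a * pmf P b * pmf P c))"
    using int prob by (simp add: Bochner_Integration.integral_sum Bochner_Integration.integrable_sum)
  also have "\<dots> = forbidden_mass C D p"
    unfolding forbidden_mass_def by (intro sum.cong refl) (simp add: P)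
  finally show ?thesis .
qed

text \<open>The triples in \<open>U\<close> are divided according to the residue of their sum. Triples in the same class are
  edge-disjoint, hence their colourings are independent, and there are only \<open>N\<close> classes.\<close>

definition residue_triples :: "nat \<Rightarrow> nat set \<Rightarrow> nat \<Rightarrow> (nat \<times> nat \<times> nat) set" where
  "residue_triples N U r = {(u, v, w). u \<in> U \<and> v \<in> U \<and> w \<in> U \<and> u < v \<and> v < w \<and> (u + v + w) mod N = r}"

definition pairs_of :: "nat \<times> nat \<times> nat \<Rightarrow> nat set set" where
  "pairs_of = (\<lambda>(u, v, w). {{u, v}, {u, w}, {v, w}})"

lemma mod_add_cancel_less:
  fixes a b c N :: nat
  assumes "(a + c) mod N = (b + c) mod N" "a < N" "b < N"
  shows "a = b"
proof -
  have "int (a + c) mod int N = int (b + c) mod int N" using assms(1) by (metis zmod_int)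
  then have "int N dvd int (a + c) - int (b + c)" by (simp only: mod_eq_dvd_iff)
  then have "int N dvd int a - int b" by simp
  then have "int a - int b = 0" using assms(2,3) dvd_imp_le_int[of "int a - int b" "int N"] by linarith
  then show ?thesis by simp
qed

text \<open>Two vertices and the residue of the sum determine the third vertex.\<close>

lemma residue_triples_pairs_disjoint:
  assumes "U \<subseteq> {..<N}"
  shows "disjoint_family_on pairs_of (residue_triples N U r)"
  unfolding disjoint_family_on_def
proof (intro ballI impI)
  fix s t assume s: "s \<in> residue_triples N U r" and t: "t \<in> residue_triples N U r" and ne: "s \<noteq> t"
  obtain a b c where s': "s = (a, b, c)" "a < b" "b < c" "c < N" "(a + b + c) mod N = r"
    using s assms by (auto simp: residue_triples_def)
  obtain x y z where t': "t = (x, y, z)" "x < y" "y < z" "z < N" "(x + y + z) mod N = r"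
    using t assms by (auto simp: residue_triples_def)
  show "pairs_of s \<inter> pairs_of t = {}"
  proof (rule ccontr)
    assume "pairs_of s \<inter> pairs_of t \<noteq> {}"
    then obtain e where "e \<in> pairs_of s" "e \<in> pairs_of t" by blast
    then have e: "e = {a, b} \<or> e = {a, c} \<or> e = {b, c}" "e = {x, y} \<or> e = {x, z} \<or> e = {y, z}"
      by (simp_all add: pairs_of_def s' t')
    have rest: "\<exists>i. {a, b, c} = insert i e \<and> a + b + c = i + \<Sum>e \<and> i < N"
      if "e = {a, b} \<or> e = {a, c} \<or> e = {b, c}" "a < b" "b < c" "c < N" for a b c :: nat
      using that(1)
    proof (elim disjE)
      assume "e = {a, b}"
      then show ?thesis using that(2-4) by (intro exI[of _ c]) auto
    next
      assume "e = {a, c}"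
      then show ?thesis using that(2-4) by (intro exI[of _ b]) auto
    next
      assume "e = {b, c}"
      then show ?thesis using that(2-4) by (intro exI[of _ a]) auto
    qed
    obtain i where 1: "{a, b, c} = insert i e" "a + b + c = i + \<Sum>e" "i < N"
      using rest[OF e(1) s'(2-4)] by blast
    obtain j where 2: "{x, y, z} = insert j e" "x + y + z = j + \<Sum>e" "j < N"
      using rest[OF e(2) t'(2-4)] by blast
    have "i = j" by (rule mod_add_cancel_less[of i "\<Sum>e" N j]) (use 1 2 s' t' in simp_all)
    then have "{a, b, c} = {x, y, z}" using 1(1) 2(1) by simp
    then have "a = x \<and> b = y \<and> c = z"
      using increasing_triple_unique[of a b c x y z "\<lambda>x. x"] s' t' by simp
    then show False using ne s' t' by simp
  qed
qed

lemma card_residue_triples: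
  assumes "U \<subseteq> {..<N}"
  shows "finite (residue_triples N U r)" "card (residue_triples N U r) \<le> N ^ 2"
proof -
  have finU: "finite U" using assms by (rule finite_subset) simp
  show fin: "finite (residue_triples N U r)"
    by (rule finite_subset[of _ "U \<times> U \<times> U"]) (use finU in \<open>auto simp: residue_triples_def\<close>)
  have "inj_on (\<lambda>(u, v, w). (u, v)) (residue_triples N U r)"
  proof (rule inj_onI)
    fix s t assume "s \<in> residue_triples N U r" "t \<in> residue_triples N U r"
      and "(case s of (u, v, w) \<Rightarrow> (u, v)) = (case t of (u, v, w) \<Rightarrow> (u, v))"
    moreover obtain u v w u' v' w' where "s = (u, v, w)" "t = (u', v', w')" by (metis surj_pair)
    ultimately have s: "s = (u, v, w)" "t = (u, v, w')" "w < N" "w' < N"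
      "(u + v + w) mod N = (u + v + w') mod N"
      using assms by (auto simp: residue_triples_def)
    have "w = w'" by (rule mod_add_cancel_less[of w "u + v" N w']) (use s in \<open>auto simp: add_ac\<close>)
    then show "s = t" using s by simp
  qed
  then have "card (residue_triples N U r) \<le> card ({..<N} \<times> {..<N})"
    by (rule card_inj_on_le) (use assms in \<open>auto simp: residue_triples_def\<close>)
  then show "card (residue_triples N U r) \<le> N ^ 2" by (simp add: power2_eq_square)
qed

text \<open>The events for the triples of one residue class depend on disjoint sets of pairs, so they are
  independent and Hoeffding's inequality applies to at most \<open>N\<^sup>2\<close> of them. The deviation \<open>\<eta> * N\<^sup>2\<close> has
  probability exponentially small in \<open>N\<^sup>2\<close>, which leaves room for a union bound over all \<open>2 ^ N\<close> sets \<open>U\<close>.\<close>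

lemma random_colouring_deviation:
  fixes C :: "'c::countable set"
  assumes C: "finite C" and P: "\<And>a. a \<in> C \<Longrightarrow> pmf P a = p a" "set_pmf P \<subseteq> C"
    and U: "U \<subseteq> {..<N}" and \<eta>: "0 < \<eta>" and N: "0 < N"
  shows "measure_pmf.prob (Pi_pmf {e. e \<subseteq> {..<N} \<and> card e = 2} dflt (\<lambda>_. P))
     {g. real (card (residue_triples N U r)) * forbidden_mass C D p + \<eta> * real N ^ 2
          \<le> (\<Sum>(u, v, w)\<in>residue_triples N U r. of_bool (D (g {u, v}) (g {u, w}) (g {v, w})))}
     \<le> exp (- 2 * \<eta>\<^sup>2 * real N ^ 2)"
proof (cases "residue_triples N U r = {}")
  case True
  have "\<not> \<eta> * real N ^ 2 \<le> 0" using \<eta> N by (simp add: not_le)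
  then show ?thesis using True by simp
next
  case False
  define E where "E = {e. e \<subseteq> {..<N} \<and> card e = 2}"
  have finE: "finite E" by (rule finite_subset[of _ "Pow {..<N}"]) (auto simp: E_def)
  define M where "M = Pi_pmf E dflt (\<lambda>_. P)"
  define T where "T = residue_triples N U r"
  have finT: "finite T" "card T \<le> N ^ 2" using card_residue_triples[OF U] by (simp_all add: T_def)
  define Y :: "nat \<times> nat \<times> nat \<Rightarrow> (nat set \<Rightarrow> 'c) \<Rightarrow> real"
    where "Y = (\<lambda>(u, v, w) g. of_bool (D (g {u, v}) (g {u, w}) (g {v, w})))"
  have TE: "pairs_of t \<subseteq> E" if "t \<in> T" for t
    using that U by (auto simp: T_def residue_triples_def pairs_of_def E_def)
  have ind0: "prob_space.indep_vars (measure_pmf M) (\<lambda>t. PiM (pairs_of t) (\<lambda>_. count_space UNIV))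
      (\<lambda>t g. restrict (\<lambda>e. g e) (pairs_of t)) T"
    unfolding M_def
    by (rule prob_space.indep_vars_restrict[OF measure_pmf.prob_space_axioms indep_vars_Pi_pmf[OF finE]])
       (use TE residue_triples_pairs_disjoint[OF U] in \<open>auto simp: T_def\<close>)
  have meas: "Y t \<in> borel_measurable (PiM (pairs_of t) (\<lambda>_. count_space UNIV))" for t :: "nat \<times> nat \<times> nat"
  proof -
    obtain u v w where t: "t = (u, v, w)" by (cases t)
    have [measurable]: "(\<lambda>g. g e) \<in> measurable (PiM (pairs_of t) (\<lambda>_. count_space (UNIV :: 'c set))) (count_space UNIV)"
      if "e \<in> pairs_of t" for e using that by measurable
    have "(\<lambda>g. (g {u, v}, g {u, w}, g {v, w})) \<in> measurable (PiM (pairs_of t) (\<lambda>_. count_space (UNIV :: 'c set))) (count_space UNIV \<Otimes>\<^sub>M (count_space UNIV \<Otimes>\<^sub>M count_space UNIV))"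
      by (intro measurable_Pair measurable_component_singleton) (auto simp: t pairs_of_def)
    then have "(\<lambda>g. (g {u, v}, g {u, w}, g {v, w})) \<in> measurable (PiM (pairs_of t) (\<lambda>_. count_space (UNIV :: 'c set))) (count_space UNIV)"
      by (simp add: pair_measure_countable)
    from measurable_compose[OF this, of "\<lambda>(a, b, c). of_bool (D a b c) :: real" borel]
    show ?thesis by (simp add: Y_def t)
  qed
  have ind: "prob_space.indep_vars (measure_pmf M) (\<lambda>_. borel) Y T"
  proof -
    have "prob_space.indep_vars (measure_pmf M) (\<lambda>_. borel) (\<lambda>t g. Y t (restrict (\<lambda>e. g e) (pairs_of t))) T"
      by (rule prob_space.indep_vars_compose2[OF measure_pmf.prob_space_axioms ind0 meas])
    moreover have "(\<lambda>t g. Y t (restrict (\<lambda>e. g e) (pairs_of t))) = Y"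
      by (auto simp: Y_def pairs_of_def fun_eq_iff)
    ultimately show ?thesis by simp
  qed
  interpret H: Hoeffding_ineq "measure_pmf M" T Y "\<lambda>_. 0" "\<lambda>_. 1" "\<Sum>t\<in>T. measure_pmf.expectation M (Y t)"
    by unfold_locales (use finT ind in \<open>auto simp: Y_def\<close>)
  have ex: "measure_pmf.expectation M (Y t) = forbidden_mass C D p" if "t \<in> T" for t
  proof -
    obtain u v w where t: "t = (u, v, w)" by (cases t)
    then have lt: "u < v" "v < w" "w < N" "u < N" "v < N" using that U by (auto simp: T_def residue_triples_def)
    show ?thesis unfolding t Y_def M_def prod.case
      by (rule random_colouring_expectation[OF C P finE])
         (use lt in \<open>auto simp: E_def doubleton_eq_iff\<close>)
  qed
  have cT: "0 < card T" using False finT by (simp add: T_def card_gt_0_iff)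
  have "measure_pmf.prob M {x \<in> space (measure_pmf M). (\<Sum>t\<in>T. Y t x) \<ge> (\<Sum>t\<in>T. measure_pmf.expectation M (Y t)) + \<eta> * real N ^ 2}
     \<le> exp (- 2 * (\<eta> * real N ^ 2)\<^sup>2 / (\<Sum>t\<in>T. (1 - 0)\<^sup>2))"
    by (rule H.Hoeffding_ineq_ge) (use \<eta> cT in auto)
  also have "(\<Sum>t\<in>T. measure_pmf.expectation M (Y t)) = real (card T) * forbidden_mass C D p"
    using ex by simp
  also have "exp (- 2 * (\<eta> * real N ^ 2)\<^sup>2 / (\<Sum>t\<in>T. (1 - 0)\<^sup>2)) \<le> exp (- 2 * \<eta>\<^sup>2 * real N ^ 2)"
  proof -
    have "real (card T) \<le> real N ^ 2" using finT(2) by (metis of_nat_le_iff of_nat_power)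
    then have "2 * \<eta>\<^sup>2 * real N ^ 2 * real (card T) \<le> 2 * \<eta>\<^sup>2 * real N ^ 2 * real N ^ 2"
      by (intro mult_left_mono) auto
    then have "2 * \<eta>\<^sup>2 * real N ^ 2 \<le> 2 * (\<eta> * real N ^ 2)\<^sup>2 / real (card T)"
      using cT by (simp add: le_divide_eq power_mult_distrib power2_eq_square mult_ac)
    then show ?thesis by simp
  qed
  finally show ?thesis
    unfolding M_def E_def T_def by (simp add: Y_def case_prod_unfold)
qed

text \<open>Union bound over all sets \<open>U\<close> and residues. The condition on \<open>N\<close> does not mention the palette; this
  is what allows the colouring to be used for all palettes of a sequence with the same number of vertices.\<close>

lemma uniform_random_colouring:
  fixes C :: "'c::countable set"
  assumes C: "finite C" and D: "symmetric_relation D" and p: "probability_on C p"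
    and \<eta>: "0 < \<eta>" and N: "1 / \<eta>\<^sup>2 < real N"
  shows "\<exists>f :: nat set \<Rightarrow> 'c. (\<forall>t. f t \<in> C) \<and> (\<forall>U\<subseteq>{..<N}.
      real (card {t. t \<subseteq> U \<and> card t = 3 \<and> forbidden_triple D f t})
        \<le> forbidden_mass C D p * real (card U choose 3) + \<eta> * real N ^ 3)"
proof -
  have N0: "0 < N" using N \<eta> by (smt (verit) divide_pos_pos of_nat_0_less_iff zero_less_power)
  obtain dflt where dflt: "dflt \<in> C"
    using p unfolding probability_on_def by (metis all_not_in_conv sum.empty zero_neq_one)
  define P where "P = embed_pmf (\<lambda>a. if a \<in> C then p a else 0)"
  have pmfP: "pmf P a = (if a \<in> C then p a else 0)" for a
    unfolding P_def
  proof (rule pmf_embed_pmf)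
    show "0 \<le> (if x \<in> C then p x else 0)" for x using p by (auto simp: probability_on_def)
    have "(\<integral>\<^sup>+ x. ennreal (if x \<in> C then p x else 0) \<partial>count_space UNIV) = (\<Sum>x\<in>C. ennreal (if x \<in> C then p x else 0))"
      by (rule nn_integral_count_space'[OF C]) auto
    also have "\<dots> = ennreal (\<Sum>x\<in>C. p x)"
    proof -
      have "(\<Sum>x\<in>C. ennreal (if x \<in> C then p x else 0)) = (\<Sum>x\<in>C. ennreal (p x))" by (intro sum.cong) auto
      also have "\<dots> = ennreal (\<Sum>x\<in>C. p x)" by (rule sum_ennreal) (use p in \<open>auto simp: probability_on_def\<close>)
      finally show ?thesis .
    qed
    finally show "(\<integral>\<^sup>+ x. ennreal (if x \<in> C then p x else 0) \<partial>count_space UNIV) = 1"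
      using p by (simp add: probability_on_def)
  qed
  have setP: "set_pmf P \<subseteq> C" by (auto simp: set_pmf_iff pmfP split: if_splits)
  define E where "E = {e. e \<subseteq> {..<N} \<and> card e = 2}"
  have finE: "finite E" by (rule finite_subset[of _ "Pow {..<N}"]) (auto simp: E_def)
  define M where "M = Pi_pmf E dflt (\<lambda>_. P)"
  define b where "b = forbidden_mass C D p"
  define Bad where "Bad = (\<lambda>(r, U). {g. real (card (residue_triples N U r)) * b + \<eta> * real N ^ 2
          \<le> (\<Sum>(u, v, w)\<in>residue_triples N U r. of_bool (D (g {u, v}) (g {u, w}) (g {v, w})))})"
  define I where "I = {..<N} \<times> Pow {..<N}"
  have dev: "measure_pmf.prob M (Bad i) \<le> exp (- 2 * \<eta>\<^sup>2 * real N ^ 2)" if "i \<in> I" for i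
  proof -
    obtain r U where i: "i = (r, U)" by fastforce
    then have "U \<subseteq> {..<N}" using that by (auto simp: I_def)
    then show ?thesis unfolding i Bad_def M_def E_def b_def prod.case
      by (intro random_colouring_deviation) (use C pmfP setP \<eta> N0 in auto)
  qed
  have "measure_pmf.prob M (\<Union>i\<in>I. Bad i) \<le> (\<Sum>i\<in>I. measure_pmf.prob M (Bad i))"
    by (rule measure_pmf.finite_measure_subadditive_finite) (auto simp: I_def)
  also have "\<dots> \<le> (\<Sum>i\<in>I. exp (- 2 * \<eta>\<^sup>2 * real N ^ 2))" by (intro sum_mono dev)
  also have "\<dots> = real N * 2 ^ N * exp (- 2 * \<eta>\<^sup>2 * real N ^ 2)"
    by (simp add: I_def card_cartesian_product card_Pow)
  also have "\<dots> < 1"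
  proof -
    have "real N \<le> 2 ^ N" using less_exp[of N] by (metis less_imp_le of_nat_le_iff of_nat_numeral of_nat_power)
    then have "real N * 2 ^ N \<le> 2 ^ N * 2 ^ N" by (intro mult_right_mono) auto
    also have "\<dots> = 4 ^ N" by (simp flip: power_mult_distrib)
    also have "\<dots> \<le> exp 2 ^ N"
    proof (rule power_mono)
      have "2 \<le> exp (1::real)" using exp_ge_add_one_self[of 1] by simp
      then have "2 * 2 \<le> exp (1::real) * exp 1" by (intro mult_mono) auto
      then show "4 \<le> exp (2::real)" by (simp flip: exp_add)
    qed simp
    also have "\<dots> = exp (2 * real N)" by (simp add: exp_of_nat_mult[symmetric] mult_ac)
    finally have "real N * 2 ^ N * exp (- 2 * \<eta>\<^sup>2 * real N ^ 2) \<le> exp (2 * real N) * exp (- 2 * \<eta>\<^sup>2 * real N ^ 2)"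
      by (intro mult_right_mono) auto
    also have "\<dots> = exp (2 * real N - 2 * \<eta>\<^sup>2 * real N ^ 2)" by (simp flip: exp_add)
    also have "\<dots> < 1"
    proof -
      have "1 < \<eta>\<^sup>2 * real N" using N \<eta> by (simp add: divide_less_eq mult_ac)
      then have "real N * 1 < real N * (\<eta>\<^sup>2 * real N)" using N0 by (intro mult_strict_left_mono) auto
      then show ?thesis by (simp add: power2_eq_square mult_ac)
    qed
    finally show ?thesis .
  qed
  finally have "measure_pmf.prob M (\<Union>i\<in>I. Bad i) < 1" .
  then have "\<not> set_pmf M \<subseteq> (\<Union>i\<in>I. Bad i)"
    by (metis measure_pmf.prob_eq_1 AE_measure_pmf_iff subsetD less_irrefl sets_measure_pmf UNIV_I)
  then obtain g where g: "g \<in> set_pmf M" "\<And>i. i \<in> I \<Longrightarrow> g \<notin> Bad i" by blast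
  have gC: "g t \<in> C" for t
    using set_Pi_pmf_subset'[OF finE, of dflt "\<lambda>_. P"] g(1) setP dflt
    unfolding M_def PiE_dflt_def by (cases "t \<in> E") auto
  show ?thesis
  proof (intro exI[of _ g] conjI allI impI gC)
    fix U assume U: "U \<subseteq> {..<N}"
    have finU: "finite U" using U by (rule finite_subset) simp
    define T where "T = {(u, v, w). u \<in> U \<and> v \<in> U \<and> w \<in> U \<and> u < v \<and> v < w}"
    have bij: "bij_betw (\<lambda>(u, v, w). {u, v, w}) T {t. t \<subseteq> U \<and> card t = 3}"
      unfolding T_def by (rule bij_betw_increasing_triples)
    have finT: "finite T" by (rule finite_subset[of _ "U \<times> U \<times> U"]) (use finU in \<open>auto simp: T_def\<close>)
    have TR: "T = (\<Union>r\<in>{..<N}. residue_triples N U r)"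
      using N0 by (auto simp: T_def residue_triples_def)
    have split: "(\<Sum>t\<in>T. h t) = (\<Sum>r<N. \<Sum>t\<in>residue_triples N U r. h t)" for h :: "nat \<times> nat \<times> nat \<Rightarrow> real"
      unfolding TR
    proof (rule sum.UNION_disjoint)
      show "\<forall>r\<in>{..<N}. finite (residue_triples N U r)" using card_residue_triples(1)[OF U] by blast
      show "\<forall>r\<in>{..<N}. \<forall>r'\<in>{..<N}. r \<noteq> r' \<longrightarrow> residue_triples N U r \<inter> residue_triples N U r' = {}"
        by (auto simp: residue_triples_def)
    qed simp
    have cardT: "real (card T) = real (card U choose 3)"
      using bij_betw_same_card[OF bij] n_subsets[OF finU, of 3] by simp
    have "{t. t \<subseteq> U \<and> card t = 3 \<and> forbidden_triple D g t} = {s \<in> (\<lambda>(u, v, w). {u, v, w}) ` T. forbidden_triple D g s}"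
      unfolding bij_betw_imp_surj_on[OF bij] by blast
    also have "\<dots> = (\<lambda>(u, v, w). {u, v, w}) ` {t\<in>T. forbidden_triple D g (case t of (u, v, w) \<Rightarrow> {u, v, w})}"
      by blast
    finally have "card {t. t \<subseteq> U \<and> card t = 3 \<and> forbidden_triple D g t} = card {t\<in>T. forbidden_triple D g (case t of (u, v, w) \<Rightarrow> {u, v, w})}"
      using bij_betw_imp_inj_on[OF bij] by (simp add: card_image inj_on_subset)
    then have "real (card {t. t \<subseteq> U \<and> card t = 3 \<and> forbidden_triple D g t}) = real (card {t\<in>T. forbidden_triple D g (case t of (u, v, w) \<Rightarrow> {u, v, w})})"
      by simp
    also have "\<dots> = (\<Sum>t\<in>T. of_bool (forbidden_triple D g (case t of (u, v, w) \<Rightarrow> {u, v, w})))"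
      using finT by (simp add: sum_of_bool_eq Int_def)
    also have "\<dots> = (\<Sum>(u, v, w)\<in>T. of_bool (D (g {u, v}) (g {u, w}) (g {v, w})))"
      by (intro sum.cong refl) (auto simp: T_def forbidden_triple_iff[OF D])
    also have "\<dots> = (\<Sum>r<N. \<Sum>(u, v, w)\<in>residue_triples N U r. of_bool (D (g {u, v}) (g {u, w}) (g {v, w})))"
      by (rule split)
    also have "\<dots> \<le> (\<Sum>r<N. real (card (residue_triples N U r)) * b + \<eta> * real N ^ 2)"
    proof (intro sum_mono)
      fix r assume "r \<in> {..<N}"
      then have "g \<notin> Bad (r, U)" using U by (intro g) (auto simp: I_def)
      then show "(\<Sum>(u, v, w)\<in>residue_triples N U r. of_bool (D (g {u, v}) (g {u, w}) (g {v, w}))) \<le> real (card (residue_triples N U r)) * b + \<eta> * real N ^ 2"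
        by (simp add: Bad_def)
    qed
    also have "\<dots> = b * (\<Sum>r<N. real (card (residue_triples N U r))) + \<eta> * real N ^ 3"
      by (simp add: sum.distrib sum_distrib_left power2_eq_square power3_eq_cube mult_ac)
    also have "(\<Sum>r<N. real (card (residue_triples N U r))) = real (card T)"
      using split[of "\<lambda>_. 1"] by simp
    finally show "real (card {t. t \<subseteq> U \<and> card t = 3 \<and> forbidden_triple D g t}) \<le> forbidden_mass C D p * real (card U choose 3) + \<eta> * real N ^ 3"
      by (simp add: cardT b_def)
  qed
qed

section \<open>Splitting colours\<close>

text \<open>Colours are lists: a copy of the colour \<open>a\<close> is \<open>l # a\<close>, so that \<open>tl\<close> recovers the original colour and
  palettes of all stages of the iteration share one type.\<close>

definition lift :: "nat set \<Rightarrow> nat list set \<Rightarrow> nat list set" where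
  "lift L A = (\<lambda>(l, a). l # a) ` (L \<times> A)"

lemma lift_simps [simp]: "l # a \<in> lift L A \<longleftrightarrow> l \<in> L \<and> a \<in> A" "[] \<notin> lift L A"
  by (auto simp: lift_def)

lemma liftE: assumes "u \<in> lift L A" obtains l a where "u = l # a" "l \<in> L" "a \<in> A"
  using assms by (auto simp: lift_def)

lemma finite_lift: "finite L \<Longrightarrow> finite A \<Longrightarrow> finite (lift L A)"
  by (simp add: lift_def)

lemma sum_lift: "sum h (lift L A) = (\<Sum>l\<in>L. \<Sum>a\<in>A. h (l # a))"
proof -
  have "inj_on (\<lambda>(l, a). l # a) (L \<times> A)" by (auto simp: inj_on_def)
  then show ?thesis by (simp add: lift_def sum.reindex sum.cartesian_product case_prod_unfold comp_def)
qed

definition marginal :: "nat \<Rightarrow> (nat list \<Rightarrow> real) \<Rightarrow> nat list \<Rightarrow> real" where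
  "marginal S p = (\<lambda>a. \<Sum>l<S. p (l # a))"

lemma sum_lift_tl: "(\<Sum>u\<in>lift {..<S} C. p u * h (tl u)) = (\<Sum>a\<in>C. marginal S p a * h a)"
  unfolding sum_lift marginal_def sum_distrib_right by (simp add: sum.swap[of _ C])

lemma sum_marginal: "sum (marginal S p) A = sum p (lift {..<S} A)"
  using sum_lift_tl[of p "\<lambda>_. 1" S A] by simp

lemma probability_on_marginal:
  assumes "probability_on (lift {..<S} C) p"
  shows "probability_on C (marginal S p)"
  unfolding probability_on_def
proof
  show "\<forall>a\<in>C. 0 \<le> marginal S p a"
    using assms by (auto simp: probability_on_def marginal_def intro!: sum_nonneg)
  show "sum (marginal S p) C = 1"
    using assms by (simp add: sum_marginal probability_on_def)
qed

definition same_part :: "nat list set \<Rightarrow> nat list set \<Rightarrow> nat list \<Rightarrow> nat list \<Rightarrow> nat list \<Rightarrow> bool" where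
  "same_part X Y u v w \<longleftrightarrow> tl u \<in> X \<and> tl v \<in> X \<and> hd u = hd v \<and> tl w \<in> Y"

text \<open>The three occurrences of \<open>same_part\<close> are the possible positions of the colour of \<open>Y\<close>, which keeps the
  relation symmetric.\<close>

definition split_relation ::
  "nat list set \<Rightarrow> nat list set \<Rightarrow> (nat list \<Rightarrow> nat list \<Rightarrow> nat list \<Rightarrow> bool) \<Rightarrow> nat list \<Rightarrow> nat list \<Rightarrow> nat list \<Rightarrow> bool" where
  "split_relation X Y D u v w \<longleftrightarrow>
     D (tl u) (tl v) (tl w) \<or> same_part X Y u v w \<or> same_part X Y u w v \<or> same_part X Y v w u"

lemma same_part_commute: "same_part X Y u v w = same_part X Y v u w"
  by (auto simp: same_part_def)

lemma symmetric_split_relation: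
  assumes "symmetric_relation D"
  shows "symmetric_relation (split_relation X Y D)"
  unfolding symmetric_relation_def
proof (intro allI conjI)
  fix u v w
  have "D (tl u) (tl v) (tl w) = D (tl v) (tl u) (tl w)" "D (tl u) (tl v) (tl w) = D (tl u) (tl w) (tl v)"
    using assms unfolding symmetric_relation_def by blast+
  moreover have "same_part X Y u v w = same_part X Y v u w" "same_part X Y v w u = same_part X Y w v u"
    by (rule same_part_commute)+
  ultimately show "split_relation X Y D u v w = split_relation X Y D v u w"
    "split_relation X Y D u v w = split_relation X Y D u w v"
    unfolding split_relation_def by blast+
qed

text \<open>If such triples become forbidden, they add their full weight to the forbidden mass.\<close>

definition fresh :: "('c \<Rightarrow> 'c \<Rightarrow> 'c \<Rightarrow> bool) \<Rightarrow> 'c set \<Rightarrow> 'c set \<Rightarrow> bool" where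
  "fresh D X Y \<longleftrightarrow> (\<forall>a\<in>X. \<forall>b\<in>X. \<forall>c\<in>Y. \<not> D a b c)"

text \<open>For disjoint \<open>X\<close> and \<open>Y\<close> the position of the colour of \<open>Y\<close> in a new forbidden triple is unique, which
  gives the factor three, and by freshness the new triples are not among the old ones.\<close>

lemma forbidden_mass_split:
  assumes D: "symmetric_relation D" and XY: "X \<subseteq> C" "Y \<subseteq> C" "X \<inter> Y = {}" and fresh: "fresh D X Y"
    and C: "finite C"
  shows "forbidden_mass (lift {..<S} C) (split_relation X Y D) p =
     forbidden_mass C D (marginal S p) + 3 * ((\<Sum>l<S. (\<Sum>a\<in>X. p (l # a))\<^sup>2) * sum (marginal S p) Y)"
proof -
  let ?L = "lift {..<S} C"
  define A where "A = (\<Sum>l<S. (\<Sum>a\<in>X. p (l # a))\<^sup>2)"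
  define B where "B = sum (marginal S p) Y"
  have symD: "D a b c = D b a c" "D a b c = D a c b" for a b c
    using D unfolding symmetric_relation_def by blast+
  have fr: "\<not> D a b c" if "a \<in> X" "b \<in> X" "c \<in> Y" for a b c using fresh that by (auto simp: fresh_def)
  have split: "of_bool (split_relation X Y D u v w) = of_bool (D (tl u) (tl v) (tl w)) + of_bool (same_part X Y u v w)
      + of_bool (same_part X Y u w v) + (of_bool (same_part X Y v w u) :: real)" for u v w
  proof -
    have "\<not> (same_part X Y u v w \<and> same_part X Y u w v)" "\<not> (same_part X Y u v w \<and> same_part X Y v w u)"
      "\<not> (same_part X Y u w v \<and> same_part X Y v w u)" using XY(3) by (auto simp: same_part_def)
    moreover have "\<not> (D (tl u) (tl v) (tl w) \<and> same_part X Y u v w)" using fr by (auto simp: same_part_def)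
    moreover have "\<not> (D (tl u) (tl v) (tl w) \<and> same_part X Y u w v)" using fr symD by (metis same_part_def)
    moreover have "\<not> (D (tl u) (tl v) (tl w) \<and> same_part X Y v w u)" using fr symD by (metis same_part_def)
    ultimately show ?thesis unfolding split_relation_def by auto
  qed
  have base: "(\<Sum>u\<in>?L. \<Sum>v\<in>?L. \<Sum>w\<in>?L. of_bool (D (tl u) (tl v) (tl w)) * (p u * p v * p w)) = forbidden_mass C D (marginal S p)"
  proof -
    have in1: "(\<Sum>w\<in>?L. p w * of_bool (D a b (tl w))) = (\<Sum>c\<in>C. marginal S p c * of_bool (D a b c))" for a b
      by (rule sum_lift_tl)
    have in2: "(\<Sum>v\<in>?L. p v * (\<Sum>c\<in>C. marginal S p c * of_bool (D a (tl v) c))) =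
        (\<Sum>b\<in>C. marginal S p b * (\<Sum>c\<in>C. marginal S p c * of_bool (D a b c)))" for a
      by (rule sum_lift_tl)
    have "(\<Sum>u\<in>?L. \<Sum>v\<in>?L. \<Sum>w\<in>?L. of_bool (D (tl u) (tl v) (tl w)) * (p u * p v * p w))
      = (\<Sum>u\<in>?L. p u * (\<Sum>v\<in>?L. p v * (\<Sum>w\<in>?L. p w * of_bool (D (tl u) (tl v) (tl w)))))"
      by (simp add: sum_distrib_left mult_ac)
    also have "\<dots> = (\<Sum>u\<in>?L. p u * (\<Sum>b\<in>C. marginal S p b * (\<Sum>c\<in>C. marginal S p c * of_bool (D (tl u) b c))))"
      by (simp only: in1 in2)
    also have "\<dots> = (\<Sum>a\<in>C. marginal S p a * (\<Sum>b\<in>C. marginal S p b * (\<Sum>c\<in>C. marginal S p c * of_bool (D a b c))))"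
      by (rule sum_lift_tl[where h = "\<lambda>a. \<Sum>b\<in>C. marginal S p b * (\<Sum>c\<in>C. marginal S p c * of_bool (D a b c))"])
    also have "\<dots> = forbidden_mass C D (marginal S p)"
      by (simp add: forbidden_mass_def sum_distrib_left mult_ac)
    finally show ?thesis .
  qed
  have pairX: "(\<Sum>u\<in>?L. \<Sum>v\<in>?L. of_bool (tl u \<in> X \<and> tl v \<in> X \<and> hd u = hd v) * (p u * p v)) = A"
  proof -
    have "(\<Sum>u\<in>?L. \<Sum>v\<in>?L. of_bool (tl u \<in> X \<and> tl v \<in> X \<and> hd u = hd v) * (p u * p v))
       = (\<Sum>l<S. \<Sum>a\<in>C. \<Sum>m<S. \<Sum>b\<in>C. of_bool (a \<in> X \<and> b \<in> X \<and> l = m) * (p (l # a) * p (m # b)))"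
      by (simp add: sum_lift)
    also have "\<dots> = (\<Sum>l<S. \<Sum>a\<in>C. \<Sum>m<S. if m = l then (\<Sum>b\<in>C. of_bool (a \<in> X) * (of_bool (b \<in> X) * (p (l # a) * p (l # b)))) else 0)"
      by (intro sum.cong refl) (auto simp: of_bool_conj intro!: sum.cong)
    also have "\<dots> = (\<Sum>l<S. \<Sum>a\<in>C. \<Sum>b\<in>C. of_bool (a \<in> X) * (of_bool (b \<in> X) * (p (l # a) * p (l # b))))"
      by (intro sum.cong refl) (simp add: sum.delta)
    also have "\<dots> = (\<Sum>l<S. (\<Sum>a\<in>C. of_bool (a \<in> X) * p (l # a)) * (\<Sum>b\<in>C. of_bool (b \<in> X) * p (l # b)))"
      by (simp add: sum_product mult_ac)
    also have "\<dots> = A"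
    proof -
      have "(\<Sum>a\<in>C. of_bool (a \<in> X) * p (l # a)) = (\<Sum>a\<in>X. p (l # a))" for l
        by (rule sum.mono_neutral_cong_right) (use C XY in auto)
      then show ?thesis by (simp add: A_def power2_eq_square)
    qed
    finally show ?thesis .
  qed
  have sumY: "(\<Sum>w\<in>?L. of_bool (tl w \<in> Y) * p w) = B"
  proof -
    have "(\<Sum>w\<in>?L. of_bool (tl w \<in> Y) * p w) = (\<Sum>a\<in>C. marginal S p a * of_bool (a \<in> Y))"
      using sum_lift_tl[of p "\<lambda>a. of_bool (a \<in> Y)" S C] by (simp add: mult.commute)
    also have "\<dots> = B" unfolding B_def
      by (rule sum.mono_neutral_cong_right) (use C XY in auto)
    finally show ?thesis .
  qed
  have s1: "(\<Sum>u\<in>?L. \<Sum>v\<in>?L. \<Sum>w\<in>?L. of_bool (same_part X Y u v w) * (p u * p v * p w)) = A * B"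
  proof -
    have "(\<Sum>u\<in>?L. \<Sum>v\<in>?L. \<Sum>w\<in>?L. of_bool (same_part X Y u v w) * (p u * p v * p w))
      = (\<Sum>u\<in>?L. \<Sum>v\<in>?L. (of_bool (tl u \<in> X \<and> tl v \<in> X \<and> hd u = hd v) * (p u * p v)) * (\<Sum>w\<in>?L. of_bool (tl w \<in> Y) * p w))"
      unfolding sum_distrib_left by (intro sum.cong refl) (simp add: same_part_def of_bool_conj)
    then show ?thesis by (simp only: sumY pairX sum_distrib_right[symmetric])
  qed
  have s2: "(\<Sum>u\<in>?L. \<Sum>v\<in>?L. \<Sum>w\<in>?L. of_bool (same_part X Y u w v) * (p u * p v * p w)) = A * B"
  proof -
    have "(\<Sum>u\<in>?L. \<Sum>v\<in>?L. \<Sum>w\<in>?L. of_bool (same_part X Y u w v) * (p u * p v * p w))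
      = (\<Sum>u\<in>?L. \<Sum>w\<in>?L. \<Sum>v\<in>?L. of_bool (same_part X Y u w v) * (p u * p v * p w))"
      by (intro sum.cong refl sum.swap)
    also have "\<dots> = (\<Sum>u\<in>?L. \<Sum>w\<in>?L. \<Sum>v\<in>?L. of_bool (same_part X Y u w v) * (p u * p w * p v))"
      by (simp add: mult_ac)
    finally show ?thesis using s1 by simp
  qed
  have s3: "(\<Sum>u\<in>?L. \<Sum>v\<in>?L. \<Sum>w\<in>?L. of_bool (same_part X Y v w u) * (p u * p v * p w)) = A * B"
  proof -
    have "(\<Sum>u\<in>?L. \<Sum>v\<in>?L. \<Sum>w\<in>?L. of_bool (same_part X Y v w u) * (p u * p v * p w))
      = (\<Sum>v\<in>?L. \<Sum>u\<in>?L. \<Sum>w\<in>?L. of_bool (same_part X Y v w u) * (p u * p v * p w))"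
      by (rule sum.swap)
    also have "\<dots> = (\<Sum>v\<in>?L. \<Sum>w\<in>?L. \<Sum>u\<in>?L. of_bool (same_part X Y v w u) * (p u * p v * p w))"
      by (intro sum.cong refl sum.swap)
    also have "\<dots> = (\<Sum>v\<in>?L. \<Sum>w\<in>?L. \<Sum>u\<in>?L. of_bool (same_part X Y v w u) * (p v * p w * p u))"
      by (simp add: mult_ac)
    finally show ?thesis using s1 by simp
  qed
  have "forbidden_mass ?L (split_relation X Y D) p = forbidden_mass C D (marginal S p) + A * B + A * B + A * B"
    unfolding forbidden_mass_def[of ?L] split distrib_right sum.distrib
    by (simp only: base s1 s2 s3)
  then show ?thesis by (simp add: A_def B_def)
qed

text \<open>The invariant of the iteration. The minimum of the forbidden mass lies in \<open>[\<beta> - \<Delta>, \<beta>)\<close>, and every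
  weight vector of forbidden mass at most \<open>\<beta>\<close> gives mass at least \<open>c\<close> to each of the groups \<open>X\<close>, \<open>Y\<close>, \<open>Z\<close>. The
  groups \<open>X\<close>, \<open>Y\<close> are used in the next step; \<open>Z\<close> is kept in reserve, because after the step \<open>X\<close> and \<open>Y\<close>
  are no longer fresh with respect to each other. The bound on \<open>\<Delta>\<close> in terms of \<open>c\<close> reproduces itself when
  \<open>c\<close> is replaced by \<open>c / 4\<close>.\<close>

definition refinable ::
  "real \<Rightarrow> nat list set \<Rightarrow> (nat list \<Rightarrow> nat list \<Rightarrow> nat list \<Rightarrow> bool) \<Rightarrow> nat list set \<Rightarrow> nat list set \<Rightarrow> nat list set \<Rightarrow> real \<Rightarrow> real \<Rightarrow> bool" where
  "refinable \<beta> C D X Y Z c \<Delta> \<longleftrightarrow>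
     finite C \<and> symmetric_relation D \<and> X \<subseteq> C \<and> Y \<subseteq> C \<and> Z \<subseteq> C \<and> X \<inter> Y = {} \<and> X \<inter> Z = {} \<and> Y \<inter> Z = {} \<and>
     fresh D X Y \<and> fresh D X Z \<and> fresh D Z X \<and>
     (\<exists>p. probability_on C p \<and> forbidden_mass C D p < \<beta>) \<and>
     (\<forall>p. probability_on C p \<longrightarrow> \<beta> - \<Delta> \<le> forbidden_mass C D p) \<and>
     (\<forall>p. probability_on C p \<longrightarrow> forbidden_mass C D p \<le> \<beta> \<longrightarrow> c \<le> sum p X \<and> c \<le> sum p Y \<and> c \<le> sum p Z) \<and>
     0 < c \<and> 0 < \<Delta> \<and> \<Delta> \<le> c ^ 6 / 4096"

text \<open>A small variance forces every index set of at least a third of the indices to carry almost a third of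
  the sum, by the Cauchy-Schwarz inequality.\<close>

lemma sum_of_part_lower_bound:
  fixes x :: "nat \<Rightarrow> real"
  assumes "H \<subseteq> {..<S}" "0 < S" "real S / 3 \<le> real (card H)" "0 < c" "c \<le> sum x {..<S}"
    "(\<Sum>l<S. (x l)\<^sup>2) - (sum x {..<S})\<^sup>2 / real S \<le> 2 / (c * (real S)\<^sup>2)" "288 / c ^ 3 \<le> real S"
  shows "c / 4 \<le> sum x H"
proof -
  define X where "X = sum x {..<S}"
  define V where "V = (\<Sum>l<S. (x l - X / real S)\<^sup>2)"
  define t where "t = X / real S"
  have "V = (\<Sum>l<S. (x l)\<^sup>2 - 2 * t * x l + t\<^sup>2)"
    unfolding V_def t_def[symmetric] by (intro sum.cong refl) (simp add: power2_diff mult_ac)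
  also have "\<dots> = (\<Sum>l<S. (x l)\<^sup>2) - 2 * t * X + real S * t\<^sup>2"
    unfolding sum.distrib sum_subtractf sum_distrib_left[symmetric] X_def by simp
  also have "\<dots> = (\<Sum>l<S. (x l)\<^sup>2) - X\<^sup>2 / real S"
    using assms(2) by (simp add: t_def power2_eq_square)
  finally have V: "V \<le> 2 / (c * (real S)\<^sup>2)" using assms(6) by (simp add: X_def)
  have finH: "finite H" using assms(1) by (rule finite_subset) simp
  have h: "real (card H) \<le> real S" using card_mono[OF _ assms(1)] by simp
  have "(\<Sum>l\<in>H. x l - X / real S)\<^sup>2 \<le> (\<Sum>l\<in>H. 1\<^sup>2) * (\<Sum>l\<in>H. (x l - X / real S)\<^sup>2)"
    using Cauchy_Schwarz_ineq_sum[of "\<lambda>_. 1" "\<lambda>l. x l - X / real S" H] by simp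
  also have "\<dots> \<le> real S * V"
  proof (rule mult_mono)
    show "(\<Sum>l\<in>H. (x l - X / real S)\<^sup>2) \<le> V" unfolding V_def by (rule sum_mono2) (use assms(1) in auto)
  qed (use h in \<open>auto intro!: sum_nonneg\<close>)
  also have "\<dots> \<le> real S * (2 / (c * (real S)\<^sup>2))" using V by (intro mult_left_mono) auto
  also have "\<dots> = 2 / (c * real S)" using assms(2) by (simp add: power2_eq_square)
  also have "\<dots> \<le> (c / 12)\<^sup>2"
    using assms(2,4,7) by (simp add: field_simps power2_eq_square power3_eq_cube)
  finally have "\<bar>\<Sum>l\<in>H. x l - X / real S\<bar> \<le> \<bar>c / 12\<bar>" by (simp only: abs_le_square_iff)
  moreover have "(\<Sum>l\<in>H. x l - X / real S) = sum x H - real (card H) * (X / real S)" by (simp add: sum_subtractf)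
  moreover have "c / 3 \<le> real (card H) * (X / real S)"
  proof -
    have "c / 3 = (real S / 3) * (c / real S)" using assms(2) by simp
    also have "\<dots> \<le> real (card H) * (X / real S)"
      using assms by (intro mult_mono divide_right_mono) (auto simp: X_def)
    finally show ?thesis .
  qed
  ultimately show ?thesis using assms(4) by linarith
qed

text \<open>For a given marginal \<open>q\<close> the mass of the split palette is smallest when the mass of \<open>X\<close> is spread evenly
  over the \<open>S\<close> copies, and then equals \<open>K S q\<close> below. Choosing the least \<open>S\<close> for which \<open>K S\<close> takes values below
  \<open>\<beta>\<close> makes the new gap \<open>\<Delta>'\<close> at most \<open>3 / (S * (S - 1))\<close>, and \<open>S\<close> has order at least \<open>c^3 / \<Delta>\<close> because
  otherwise the added term alone would exceed the old gap. Any weight vector of mass at most \<open>\<beta>\<close> is within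
  \<open>\<Delta>'\<close> of the even distribution, so both halves of the copies of \<open>X\<close> carry mass. The next step splits
  the copies of \<open>Z\<close> against the first half; the second half is the new reserve.\<close>

lemma refinement_step:
  assumes R: "refinable \<beta> C D X Y Z c \<Delta>"
  shows "\<exists>S X' Y' Z' c' \<Delta>'. refinable \<beta> (lift {..<S} C) (split_relation X Y D) X' Y' Z' c' \<Delta>' \<and> \<Delta>' \<le> \<Delta> / 2"
proof -
  have C: "finite C" and D: "symmetric_relation D" and sub: "X \<subseteq> C" "Y \<subseteq> C" "Z \<subseteq> C"
    and disj: "X \<inter> Y = {}" "X \<inter> Z = {}" "Y \<inter> Z = {}" and fr: "fresh D X Y" "fresh D X Z" "fresh D Z X"
    and ex: "\<exists>p. probability_on C p \<and> forbidden_mass C D p < \<beta>"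
    and low: "\<And>p. probability_on C p \<Longrightarrow> \<beta> - \<Delta> \<le> forbidden_mass C D p"
    and big: "\<And>p. probability_on C p \<Longrightarrow> forbidden_mass C D p \<le> \<beta> \<Longrightarrow> c \<le> sum p X \<and> c \<le> sum p Y \<and> c \<le> sum p Z"
    and c: "0 < c" and \<Delta>: "0 < \<Delta>" "\<Delta> \<le> c ^ 6 / 4096"
    using R unfolding refinable_def by blast+
  have fin: "finite X" "finite Y" "finite Z" using sub C by (auto intro: finite_subset)
  define K where "K = (\<lambda>S q. forbidden_mass C D q + 3 * ((sum q X)\<^sup>2 * sum q Y) / real S)"
  have mass01: "0 \<le> sum q A \<and> sum q A \<le> 1" if "probability_on C q" "A \<subseteq> C" for q A
  proof -
    have "sum q A \<le> sum q C" using that C by (intro sum_mono2) (auto simp: probability_on_def)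
    moreover have "0 \<le> sum q A" using that by (intro sum_nonneg) (auto simp: probability_on_def)
    ultimately show ?thesis using that by (simp add: probability_on_def)
  qed
  have XXY: "0 \<le> (sum q X)\<^sup>2 * sum q Y \<and> (sum q X)\<^sup>2 * sum q Y \<le> 1" if "probability_on C q" for q
    using mass01[OF that sub(1)] mass01[OF that sub(2)] by (simp add: power_le_one mult_le_one)
  have c1: "c \<le> 1"
    using ex big mass01[OF _ sub(1)] by (meson less_imp_le order_trans)
  have mass_split: "forbidden_mass (lift {..<S} C) (split_relation X Y D) p =
     forbidden_mass C D (marginal S p) + 3 * ((\<Sum>l<S. (\<Sum>a\<in>X. p (l # a))\<^sup>2) * sum (marginal S p) Y)" for S p
    by (rule forbidden_mass_split) (use D sub disj fr C in auto)
  have margX: "sum (marginal S p) X = (\<Sum>l<S. \<Sum>a\<in>X. p (l # a))" for S p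
    by (simp add: sum_marginal sum_lift)
  have lowK: "K S (marginal S p) \<le> forbidden_mass (lift {..<S} C) (split_relation X Y D) p"
    if "0 < S" "probability_on (lift {..<S} C) p" for S p
  proof -
    have "(\<Sum>l<S. 1 * (\<Sum>a\<in>X. p (l # a)))\<^sup>2 \<le> (\<Sum>l<S. 1\<^sup>2) * (\<Sum>l<S. (\<Sum>a\<in>X. p (l # a))\<^sup>2)"
      by (rule Cauchy_Schwarz_ineq_sum)
    then have "(sum (marginal S p) X)\<^sup>2 / real S \<le> (\<Sum>l<S. (\<Sum>a\<in>X. p (l # a))\<^sup>2)"
      using that(1) by (simp add: margX divide_le_eq mult.commute)
    then have "(sum (marginal S p) X)\<^sup>2 / real S * sum (marginal S p) Y \<le> (\<Sum>l<S. (\<Sum>a\<in>X. p (l # a))\<^sup>2) * sum (marginal S p) Y"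
      using mass01[OF probability_on_marginal[OF that(2)] sub(2)] by (intro mult_right_mono) auto
    then show ?thesis unfolding mass_split K_def by simp
  qed
  have unif: "\<exists>p. probability_on (lift {..<S} C) p \<and> forbidden_mass (lift {..<S} C) (split_relation X Y D) p = K S q"
    if "0 < S" "probability_on C q" for S q
  proof (intro exI[of _ "\<lambda>u. q (tl u) / real S"] conjI)
    have marg: "marginal S (\<lambda>u. q (tl u) / real S) = q" using that(1) by (simp add: marginal_def fun_eq_iff)
    show "probability_on (lift {..<S} C) (\<lambda>u. q (tl u) / real S)"
      using that by (auto simp: probability_on_def elim!: liftE) (simp add: sum_lift flip: sum_divide_distrib)
    have "(\<Sum>l<S. (\<Sum>a\<in>X. q (tl (l # a)) / real S)\<^sup>2) = (sum q X)\<^sup>2 / real S"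
      using that(1) by (simp add: power2_eq_square flip: sum_divide_distrib)
    then show "forbidden_mass (lift {..<S} C) (split_relation X Y D) (\<lambda>u. q (tl u) / real S) = K S q"
      unfolding mass_split marg K_def by simp
  qed
  \<comment> \<open>\<open>Good S\<close> says that the minimum for \<open>S\<close> copies is still below \<open>\<beta>\<close>, by \<open>lowK\<close> and \<open>unif\<close>.\<close>
  define Good where "Good = (\<lambda>S. 0 < S \<and> (\<exists>q. probability_on C q \<and> K S q < \<beta>))"
  have exGood: "\<exists>S. Good S"
  proof -
    obtain q where q: "probability_on C q" "forbidden_mass C D q < \<beta>" using ex by blast
    define S where "S = nat \<lceil>3 / (\<beta> - forbidden_mass C D q)\<rceil> + 1"
    have Spos: "0 < S" by (simp add: S_def)
    have S: "3 / (\<beta> - forbidden_mass C D q) < real S"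
      using real_nat_ceiling_ge[of "3 / (\<beta> - forbidden_mass C D q)"] unfolding S_def by linarith
    have "3 * ((sum q X)\<^sup>2 * sum q Y) / real S \<le> 3 / real S" using XXY[OF q(1)] by (intro divide_right_mono) auto
    also have "\<dots> < \<beta> - forbidden_mass C D q"
    proof -
      have gen: "3 / s < g" if "3 / g < s" "0 < g" "0 < s" for s g :: real using that by (simp add: field_simps)
      show ?thesis by (rule gen[OF S]) (use q(2) Spos in simp_all)
    qed
    finally have "K S q < \<beta>" by (simp add: K_def)
    then show ?thesis using q by (intro exI[of _ S]) (auto simp: Good_def S_def)
  qed
  define S where "S = (LEAST S. Good S)"
  have "Good S" unfolding S_def using exGood by (rule LeastI_ex)
  then obtain q0 where S0: "0 < S" and q0: "probability_on C q0" "K S q0 < \<beta>" by (auto simp: Good_def)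
  have Slow: "3 * c ^ 3 / \<Delta> < real S"
  proof -
    have "0 \<le> 3 * ((sum q0 X)\<^sup>2 * sum q0 Y) / real S" using XXY[OF q0(1)] by simp
    then have "forbidden_mass C D q0 \<le> \<beta>" using q0(2) by (simp add: K_def)
    then have m: "c \<le> sum q0 X" "c \<le> sum q0 Y" using big[OF q0(1)] by auto
    have "c\<^sup>2 * c \<le> (sum q0 X)\<^sup>2 * sum q0 Y" using m c by (intro mult_mono power_mono) auto
    then have "3 * c ^ 3 / real S \<le> 3 * ((sum q0 X)\<^sup>2 * sum q0 Y) / real S"
      by (intro divide_right_mono) (auto simp: power2_eq_square power3_eq_cube)
    also have "\<dots> < \<Delta>" using q0(2) low[OF q0(1)] by (simp add: K_def)
    finally show ?thesis using S0 \<Delta> by (simp add: field_simps)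
  qed
  \<comment> \<open>By the invariant \<open>\<Delta> \<le> c ^ 6 / 4096\<close>; the constant is \<open>3 * 4096\<close>.\<close>
  have S1: "12288 / c ^ 3 < real S"
  proof -
    have "12288 / c ^ 3 = 3 * c ^ 3 / (c ^ 6 / 4096)" using c by (simp add: field_simps power_add[symmetric])
    also have "\<dots> \<le> 3 * c ^ 3 / \<Delta>" using \<Delta> c by (intro divide_left_mono) auto
    finally show ?thesis using Slow by linarith
  qed
  have S2: "2 \<le> S"
  proof -
    have "c ^ 3 \<le> 1" using c c1 by (simp add: power_le_one)
    then have "12288 / 1 \<le> 12288 / c ^ 3" using c by (intro divide_left_mono) auto
    then have "12288 < real S" using S1 by linarith
    then show ?thesis by linarith
  qed
  define \<Delta>' where "\<Delta>' = 3 / (real S * (real S - 1))"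
  have \<Delta>'pos: "0 < \<Delta>'" using S2 by (simp add: \<Delta>'_def)
  have \<Delta>'S: "\<Delta>' \<le> 6 / (real S)\<^sup>2"
    using S2 by (simp add: \<Delta>'_def field_simps power2_eq_square)
  have \<Delta>'\<Delta>: "\<Delta>' \<le> 2 / 3 * \<Delta>\<^sup>2 / c ^ 6"
  proof -
    have "(3 * c ^ 3 / \<Delta>)\<^sup>2 \<le> (real S)\<^sup>2" using Slow c \<Delta> by (intro power_mono) auto
    then have "6 / (real S)\<^sup>2 \<le> 6 / (3 * c ^ 3 / \<Delta>)\<^sup>2" using c \<Delta> S0 by (intro divide_left_mono) auto
    also have "\<dots> = 2 / 3 * \<Delta>\<^sup>2 / c ^ 6" using c \<Delta> by (simp add: power_divide power_mult_distrib flip: power_mult)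
    finally show ?thesis using \<Delta>'S by linarith
  qed
  have ratio: "\<Delta> / c ^ 6 \<le> 1 / 4096" using \<Delta> c by (simp add: field_simps)
  have half: "\<Delta>' \<le> \<Delta> / 6144"
  proof -
    have "2 / 3 * \<Delta>\<^sup>2 / c ^ 6 = 2 / 3 * \<Delta> * (\<Delta> / c ^ 6)" by (simp add: power2_eq_square)
    also have "\<dots> \<le> 2 / 3 * \<Delta> * (1 / 4096)" using ratio \<Delta> by (intro mult_left_mono) auto
    finally show ?thesis using \<Delta>'\<Delta> by linarith
  qed
  \<comment> \<open>As \<open>S - 1\<close> copies push every vector to \<open>\<beta>\<close> or more, \<open>S\<close> copies fall short by at most the difference
    of the two added terms.\<close>
  have lowK': "\<beta> - \<Delta>' \<le> K S q" if q: "probability_on C q" for q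
  proof -
    have "\<not> Good (S - 1)" unfolding S_def by (rule not_less_Least) (use S0 S_def in simp)
    then have "\<beta> \<le> K (S - 1) q" using q S2 by (auto simp: Good_def not_less)
    then have "\<beta> - K S q \<le> 3 * ((sum q X)\<^sup>2 * sum q Y) * (1 / (real S - 1) - 1 / real S)"
      using S2 by (simp add: K_def of_nat_diff algebra_simps)
    also have "\<dots> \<le> 3 * 1 * (1 / (real S - 1) - 1 / real S)"
      using XXY[OF q] S2 by (intro mult_right_mono mult_left_mono) (auto simp: field_simps)
    also have "\<dots> = \<Delta>'" using S2 by (simp add: \<Delta>'_def field_simps)
    finally show ?thesis by linarith
  qed
  define H1 where "H1 = {..<S div 2}"
  define H2 where "H2 = {S div 2..<S}"
  have H: "H1 \<subseteq> {..<S}" "H2 \<subseteq> {..<S}" "H1 \<inter> H2 = {}" "real S / 3 \<le> real (card H1)" "real S / 3 \<le> real (card H2)"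
  proof -
    have "S \<le> 3 * (S div 2)" "S \<le> 3 * (S - S div 2)" using S2 by linarith+
    then have "real S \<le> real (3 * (S div 2))" "real S \<le> real (3 * (S - S div 2))" by (simp_all only: of_nat_le_iff)
    then show "real S / 3 \<le> real (card H1)" "real S / 3 \<le> real (card H2)" by (simp_all add: H1_def H2_def)
  qed (auto simp: H1_def H2_def)
  have key: "c / 4 \<le> sum p (lift {..<S} Z) \<and> c / 4 \<le> sum p (lift H1 X) \<and> c / 4 \<le> sum p (lift H2 X)"
    if p: "probability_on (lift {..<S} C) p" "forbidden_mass (lift {..<S} C) (split_relation X Y D) p \<le> \<beta>" for p
  proof -
    define q where "q = marginal S p"
    define x where "x = (\<lambda>l. \<Sum>a\<in>X. p (l # a))"
    have q: "probability_on C q" unfolding q_def by (rule probability_on_marginal[OF p(1)])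
    have fq: "forbidden_mass C D q + 3 * ((\<Sum>l<S. (x l)\<^sup>2) * sum q Y) \<le> \<beta>"
      using p(2) unfolding mass_split q_def x_def .
    have "0 \<le> (\<Sum>l<S. (x l)\<^sup>2) * sum q Y" 
      using mass01[OF q sub(2)] by (intro mult_nonneg_nonneg[OF sum_nonneg]) auto
    then have "forbidden_mass C D q \<le> \<beta>" using fq by linarith
    then have m: "c \<le> sum q X" "c \<le> sum q Y" "c \<le> sum q Z" using big[OF q] by auto
    have qX: "sum q X = sum x {..<S}" by (simp add: q_def x_def margX)
    have "3 * ((\<Sum>l<S. (x l)\<^sup>2) * sum q Y) - 3 * ((sum q X)\<^sup>2 * sum q Y) / real S \<le> \<Delta>'"
      using fq lowK'[OF q] unfolding K_def by linarith
    then have le: "3 * sum q Y * ((\<Sum>l<S. (x l)\<^sup>2) - (sum x {..<S})\<^sup>2 / real S) \<le> \<Delta>'"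
      unfolding qX by (simp add: algebra_simps)
    have nn: "0 \<le> (\<Sum>l<S. (x l)\<^sup>2) - (sum x {..<S})\<^sup>2 / real S"
    proof -
      have "(\<Sum>l<S. 1 * x l)\<^sup>2 \<le> (\<Sum>l<S. 1\<^sup>2) * (\<Sum>l<S. (x l)\<^sup>2)" by (rule Cauchy_Schwarz_ineq_sum)
      then show ?thesis using S0 by (simp add: divide_le_eq mult.commute)
    qed
    have "3 * c * ((\<Sum>l<S. (x l)\<^sup>2) - (sum x {..<S})\<^sup>2 / real S) \<le> 3 * sum q Y * ((\<Sum>l<S. (x l)\<^sup>2) - (sum x {..<S})\<^sup>2 / real S)"
      using m nn by (intro mult_right_mono) auto
    also have "\<dots> \<le> 6 / (real S)\<^sup>2" using le \<Delta>'S by linarith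
    finally have V: "(\<Sum>l<S. (x l)\<^sup>2) - (sum x {..<S})\<^sup>2 / real S \<le> 2 / (c * (real S)\<^sup>2)"
      using c S0 by (simp add: field_simps)
    have "288 / c ^ 3 \<le> 12288 / c ^ 3" using c by (intro divide_right_mono) auto
    then have S3: "288 / c ^ 3 \<le> real S" using S1 by linarith
    have half: "c / 4 \<le> sum x J" if "J \<subseteq> {..<S}" "real S / 3 \<le> real (card J)" for J
      by (rule sum_of_part_lower_bound[OF that(1) S0 that(2) c _ V S3]) (use m qX in simp)
    have "sum p (lift J X) = sum x J" for J by (simp add: sum_lift x_def)
    moreover have "sum p (lift {..<S} Z) = sum q Z" by (simp add: q_def sum_marginal)
    ultimately show ?thesis using half[OF H(1,4)] half[OF H(2,5)] m c by auto
  qed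
  have "refinable \<beta> (lift {..<S} C) (split_relation X Y D) (lift {..<S} Z) (lift H1 X) (lift H2 X) (c / 4) \<Delta>'"
    unfolding refinable_def
  proof (intro conjI allI impI)
    show "finite (lift {..<S} C)" using C by (simp add: finite_lift)
    show "symmetric_relation (split_relation X Y D)" using D by (rule symmetric_split_relation)
    show "lift {..<S} Z \<subseteq> lift {..<S} C" "lift H1 X \<subseteq> lift {..<S} C" "lift H2 X \<subseteq> lift {..<S} C"
      using sub H by (auto simp: lift_def)
    show "lift {..<S} Z \<inter> lift H1 X = {}" "lift {..<S} Z \<inter> lift H2 X = {}" "lift H1 X \<inter> lift H2 X = {}"
      using disj H by (auto simp: lift_def)
    \<comment> \<open>All newly forbidden triples contain a colour of \<open>Y\<close>, so the freshness between \<open>X\<close> and \<open>Z\<close> persists in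
      both directions.\<close>
    have frA: "fresh (split_relation X Y D) (lift {..<S} Z) (lift J X)" for J
      using fr(3) disj unfolding fresh_def by (auto elim!: liftE simp: split_relation_def same_part_def)
    show "fresh (split_relation X Y D) (lift {..<S} Z) (lift H1 X)" "fresh (split_relation X Y D) (lift {..<S} Z) (lift H2 X)"
      by (rule frA)+
    show "fresh (split_relation X Y D) (lift H2 X) (lift {..<S} Z)"
      using fr(2) disj unfolding fresh_def by (auto elim!: liftE simp: split_relation_def same_part_def)
    show "\<exists>p. probability_on (lift {..<S} C) p \<and> forbidden_mass (lift {..<S} C) (split_relation X Y D) p < \<beta>"
      using unif[OF S0 q0(1)] q0(2) by auto
    show "\<beta> - \<Delta>' \<le> forbidden_mass (lift {..<S} C) (split_relation X Y D) p" if "probability_on (lift {..<S} C) p" for p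
      using lowK[OF S0 that] lowK'[OF probability_on_marginal[OF that]] by linarith
    show "c / 4 \<le> sum p (lift {..<S} Z)" "c / 4 \<le> sum p (lift H1 X)" "c / 4 \<le> sum p (lift H2 X)"
      if "probability_on (lift {..<S} C) p" "forbidden_mass (lift {..<S} C) (split_relation X Y D) p \<le> \<beta>" for p
      using key[OF that] by auto
    show "0 < c / 4" "0 < \<Delta>'" using c \<Delta>'pos by auto
    have "\<Delta>' \<le> (c ^ 6 / 4096) / 6144" using half \<Delta>(2) by linarith
    also have "\<dots> \<le> (c ^ 6 / 4096) / 4096" using c by (intro divide_left_mono) auto
    also have "\<dots> = (c / 4) ^ 6 / 4096" by (simp add: power_divide)
    finally show "\<Delta>' \<le> (c / 4) ^ 6 / 4096" .
  qed
  moreover have "\<Delta>' \<le> \<Delta> / 2" using half \<Delta> by linarith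
  ultimately show ?thesis by blast
qed

section \<open>Densities of palette sequences\<close>

lemma forbidden_mass_monochromatic:
  assumes "finite C"
  shows "forbidden_mass C (\<lambda>a b c. a = b \<and> b = c) p = (\<Sum>a\<in>C. p a ^ 3)"
  unfolding forbidden_mass_def
proof (intro sum.cong refl)
  fix a assume a: "a \<in> C"
  have "(\<Sum>c\<in>C. of_bool (a = b \<and> b = c) * (p a * p b * p c)) = (if b = a then p a ^ 3 else 0)" for b
  proof (cases "b = a")
    case True
    have "(\<Sum>c\<in>C. of_bool (a = b \<and> b = c) * (p a * p b * p c)) = (\<Sum>c\<in>C. if c = a then p a ^ 3 else 0)"
      by (intro sum.cong refl) (auto simp: True power3_eq_cube)
    then show ?thesis using a assms True by simp
  qed simp
  then show "(\<Sum>b\<in>C. \<Sum>c\<in>C. of_bool (a = b \<and> b = c) * (p a * p b * p c)) = p a ^ 3"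
    using a assms by simp
qed

text \<open>Expansion at the minimum \<open>(1/3, 1/3, 1/3)\<close>. The linear terms cancel on the simplex, and the remainder is
  nonnegative and controls the distance of each coordinate from \<open>1/3\<close>.\<close>

lemma sum_three_cubes:
  fixes x y z :: real
  assumes "x + y + z = 1"
  shows "x ^ 3 + y ^ 3 + z ^ 3 = 1 / 9 + (x - 1 / 3)\<^sup>2 * (2 / 3 + x) + (y - 1 / 3)\<^sup>2 * (2 / 3 + y) + (z - 1 / 3)\<^sup>2 * (2 / 3 + z)"
proof -
  define q where "q = (\<lambda>y :: real. (y - 1 / 3)\<^sup>2 * (2 / 3 + y))"
  have e: "y ^ 3 = 1 / 27 + (y - 1 / 3) / 3 + q y" for y
    by (simp add: q_def power2_eq_square power3_eq_cube field_simps)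
  have "x ^ 3 + y ^ 3 + z ^ 3 = 1 / 9 + q x + q y + q z + (x + y + z - 1) / 3"
    unfolding e by (simp add: field_simps)
  then have "x ^ 3 + y ^ 3 + z ^ 3 = 1 / 9 + q x + q y + q z" unfolding assms by simp
  then show ?thesis by (simp only: q_def)
qed

text \<open>The three groups are the single colours. The interval for \<open>\<beta>\<close> is as long as the bound on \<open>\<Delta>\<close> in the
  definition of \<open>refinable\<close> permits with \<open>c = 1/4\<close>.\<close>

lemma refinable_base:
  assumes \<beta>: "1 / 9 < \<beta>" "\<beta> \<le> 1 / 9 + (1 / 4) ^ 6 / 4096" and uvw: "u \<noteq> v" "u \<noteq> w" "v \<noteq> w"
  shows "refinable \<beta> {u, v, w} (\<lambda>a b c. a = b \<and> b = c) {u} {v} {w} (1 / 4) ((1 / 4) ^ 6 / 4096)"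
proof -
  let ?C = "{u, v, w}"
  let ?D = "\<lambda>a b c :: nat list. a = b \<and> b = c"
  define q where "q = (\<lambda>y :: real. (y - 1 / 3)\<^sup>2 * (2 / 3 + y))"
  have fm0: "forbidden_mass ?C ?D p = p u ^ 3 + p v ^ 3 + p w ^ 3" for p
    using uvw by (simp add: forbidden_mass_monochromatic)
  have nn: "0 \<le> p u" "0 \<le> p v" "0 \<le> p w" and s1: "p u + p v + p w = 1" if "probability_on ?C p" for p
    using that uvw by (simp_all add: probability_on_def)
  have fm: "forbidden_mass ?C ?D p = 1 / 9 + q (p u) + q (p v) + q (p w)" if "probability_on ?C p" for p
    unfolding fm0 q_def by (rule sum_three_cubes[OF s1[OF that]])
  have qnn: "0 \<le> q y" if "0 \<le> y" for y using that by (simp add: q_def)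
  have qlarge: "1 / 4 \<le> y" if "0 \<le> y" "q y \<le> (1 / 4) ^ 6 / 4096" for y
  proof -
    have "(y - 1 / 3)\<^sup>2 * (2 / 3) \<le> q y" unfolding q_def using that by (intro mult_left_mono) auto
    moreover have "(1 / 4) ^ 6 / 4096 \<le> (1 / 12)\<^sup>2 * (2 / 3 :: real)" by (simp add: power_one_over)
    ultimately have "(y - 1 / 3)\<^sup>2 \<le> (1 / 12)\<^sup>2" using that(2) by linarith
    then have "\<bar>y - 1 / 3\<bar> \<le> \<bar>1 / 12\<bar>" by (simp only: abs_le_square_iff)
    then show ?thesis by linarith
  qed
  show ?thesis
    unfolding refinable_def
  proof (intro conjI allI impI)
    show "symmetric_relation ?D" by (auto simp: symmetric_relation_def)
    have "probability_on ?C (\<lambda>_. 1 / 3)" using uvw by (simp add: probability_on_def)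
    moreover have "forbidden_mass ?C ?D (\<lambda>_. 1 / 3) < \<beta>" unfolding fm0 using \<beta> by (simp add: power3_eq_cube)
    ultimately show "\<exists>p. probability_on ?C p \<and> forbidden_mass ?C ?D p < \<beta>" by blast
    show "\<beta> - (1 / 4) ^ 6 / 4096 \<le> forbidden_mass ?C ?D p" if p: "probability_on ?C p" for p
      unfolding fm[OF p] using qnn[OF nn(1)[OF p]] qnn[OF nn(2)[OF p]] qnn[OF nn(3)[OF p]] \<beta> by linarith
    fix p assume p: "probability_on ?C p" and le: "forbidden_mass ?C ?D p \<le> \<beta>"
    have "q (p u) + q (p v) + q (p w) \<le> (1 / 4) ^ 6 / 4096" using le \<beta> unfolding fm[OF p] by linarith
    then have "q (p u) \<le> (1 / 4) ^ 6 / 4096" "q (p v) \<le> (1 / 4) ^ 6 / 4096" "q (p w) \<le> (1 / 4) ^ 6 / 4096"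
      using qnn[OF nn(1)[OF p]] qnn[OF nn(2)[OF p]] qnn[OF nn(3)[OF p]] by linarith+
    then show "1 / 4 \<le> sum p {u}" "1 / 4 \<le> sum p {v}" "1 / 4 \<le> sum p {w}"
      using qlarge nn[OF p] by simp_all
  qed (use uvw in \<open>auto simp: fresh_def\<close>)
qed

text \<open>Iteration of \<open>refinement_step\<close>. The gaps at least halve in each step, and dropping the copy number is a
  homomorphism to the previous palette.\<close>

lemma palette_sequence:
  assumes \<beta>: "1 / 9 < \<beta>" "\<beta> \<le> 1 / 9 + (1 / 4) ^ 6 / 4096"
  obtains C :: "nat \<Rightarrow> nat list set" and D and \<Delta> :: "nat \<Rightarrow> real" where
    "\<And>n. finite (C n)" "\<And>n. symmetric_relation (D n)"
    "\<And>n. \<exists>p. probability_on (C n) p \<and> forbidden_mass (C n) (D n) p \<le> \<beta>"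
    "\<And>n p. probability_on (C n) p \<Longrightarrow> \<beta> - \<Delta> n \<le> forbidden_mass (C n) (D n) p"
    "\<And>n. palette_hom tl (C (Suc n)) (D (Suc n)) (C n) (D n)"
    "\<Delta> \<longlonglongrightarrow> 0"
proof -
  define R where "R = (\<lambda>(C, D, \<Delta>). 0 < \<Delta> \<and> (\<exists>X Y Z c. refinable \<beta> C D X Y Z c \<Delta>))"
  define step where "step = (\<lambda>(C :: nat list set, D, \<Delta> :: real) (C', D', \<Delta>'). palette_hom tl C' D' C D \<and> \<Delta>' \<le> \<Delta> / 2)"
  have "\<exists>f. \<forall>n. R (f n) \<and> step (f n) (f (Suc n))"
  proof (rule dependent_nat_choice[where P = "\<lambda>_. R" and Q = "\<lambda>_. step"])
    show "\<exists>x. R x"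
      using refinable_base[OF \<beta>, of "[0]" "[1]" "[2]"] unfolding R_def
      by (intro exI[of _ "({[0], [1], [2]}, (\<lambda>a b c. a = b \<and> b = c), (1 / 4) ^ 6 / 4096)"]) auto
    fix s and n :: nat assume "R s"
    then obtain C D \<Delta> X Y Z c where s: "s = (C, D, \<Delta>)" and r: "refinable \<beta> C D X Y Z c \<Delta>"
      unfolding R_def by (cases s) auto
    obtain S X' Y' Z' c' \<Delta>' where r': "refinable \<beta> (lift {..<S} C) (split_relation X Y D) X' Y' Z' c' \<Delta>'" "\<Delta>' \<le> \<Delta> / 2"
      using refinement_step[OF r] by blast
    have "palette_hom tl (lift {..<S} C) (split_relation X Y D) C D"
      by (auto simp: palette_hom_def split_relation_def elim!: liftE)
    moreover have "0 < \<Delta>'" using r'(1) unfolding refinable_def by blast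
    ultimately show "\<exists>y. R y \<and> step s y"
      using r' unfolding s R_def step_def
      by (intro exI[of _ "(lift {..<S} C, split_relation X Y D, \<Delta>')"]) auto
  qed
  then obtain f where f: "\<And>n. R (f n)" "\<And>n. step (f n) (f (Suc n))" by blast
  define C where "C = (\<lambda>n. fst (f n))"
  define D where "D = (\<lambda>n. fst (snd (f n)))"
  define \<Delta> where "\<Delta> = (\<lambda>n. snd (snd (f n)))"
  have fn: "f n = (C n, D n, \<Delta> n)" for n by (simp add: C_def D_def \<Delta>_def)
  have ref: "\<exists>X Y Z c. refinable \<beta> (C n) (D n) X Y Z c (\<Delta> n)" and pos: "0 < \<Delta> n" for n
    using f(1)[of n] by (auto simp: R_def fn)
  have hom: "palette_hom tl (C (Suc n)) (D (Suc n)) (C n) (D n)" and half: "\<Delta> (Suc n) \<le> \<Delta> n / 2" for n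
    using f(2)[of n] by (auto simp: step_def fn)
  have geo: "\<Delta> n \<le> \<Delta> 0 * (1 / 2) ^ n" for n
  proof (induction n)
    case (Suc n)
    then show ?case using half[of n] by simp
  qed simp
  have "(\<lambda>n. \<Delta> 0 * (1 / 2) ^ n) \<longlonglongrightarrow> \<Delta> 0 * 0"
    by (intro tendsto_mult_left LIMSEQ_power_zero) simp
  then have lim: "\<Delta> \<longlonglongrightarrow> 0"
    using tendsto_sandwich[of "\<lambda>_. 0" \<Delta> sequentially "\<lambda>n. \<Delta> 0 * (1 / 2) ^ n" 0] pos geo
    by (simp add: eventually_sequentiallyI less_imp_le)
  show ?thesis
  proof (rule that[of C D \<Delta>])
    show "finite (C n)" "symmetric_relation (D n)" for n
      using ref[of n] unfolding refinable_def by blast+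
    show "\<exists>p. probability_on (C n) p \<and> forbidden_mass (C n) (D n) p \<le> \<beta>" for n
    proof -
      obtain p where "probability_on (C n) p \<and> forbidden_mass (C n) (D n) p < \<beta>"
        using ref[of n] unfolding refinable_def by blast
      then show ?thesis by (intro exI[of _ p]) simp
    qed
    show "\<beta> - \<Delta> n \<le> forbidden_mass (C n) (D n) p" if "probability_on (C n) p" for n p
      using ref[of n] that unfolding refinable_def by blast
  qed (use hom lim in auto)
qed

text \<open>Disjoint copies of a palette, without constraints between different copies.\<close>

definition block_relation :: "(nat list \<Rightarrow> nat list \<Rightarrow> nat list \<Rightarrow> bool) \<Rightarrow> nat list \<Rightarrow> nat list \<Rightarrow> nat list \<Rightarrow> bool" where
  "block_relation D u v w \<longleftrightarrow> hd u = hd v \<and> hd v = hd w \<and> D (tl u) (tl v) (tl w)"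

lemma symmetric_block_relation: "symmetric_relation D \<Longrightarrow> symmetric_relation (block_relation D)"
  unfolding symmetric_relation_def block_relation_def by metis

lemma forbidden_mass_block:
  "forbidden_mass (lift {..<m} C) (block_relation D) p = (\<Sum>i<m. forbidden_mass C D (\<lambda>a. p (i # a)))"
proof -
  have "forbidden_mass (lift {..<m} C) (block_relation D) p =
    (\<Sum>i<m. \<Sum>a\<in>C. \<Sum>j<m. \<Sum>b\<in>C. \<Sum>k<m. \<Sum>c\<in>C. of_bool (i = j \<and> j = k \<and> D a b c) * (p (i # a) * p (j # b) * p (k # c)))"
    by (simp add: forbidden_mass_def sum_lift block_relation_def)
  also have "\<dots> = (\<Sum>i<m. \<Sum>a\<in>C. \<Sum>b\<in>C. \<Sum>c\<in>C. of_bool (D a b c) * (p (i # a) * p (i # b) * p (i # c)))"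
  proof (intro sum.cong refl)
    fix i a assume i: "i \<in> {..<m}"
    have single: "(\<Sum>k<m. g k) = g i" if "\<And>k. k \<noteq> i \<Longrightarrow> g k = 0" for g :: "nat \<Rightarrow> real"
      using i that by (subst sum.remove[of _ i]) (auto intro!: sum.neutral)
    have "(\<Sum>j<m. \<Sum>b\<in>C. \<Sum>k<m. \<Sum>c\<in>C. of_bool (i = j \<and> j = k \<and> D a b c) * (p (i # a) * p (j # b) * p (k # c)))
       = (\<Sum>b\<in>C. \<Sum>k<m. \<Sum>c\<in>C. of_bool (i = i \<and> i = k \<and> D a b c) * (p (i # a) * p (i # b) * p (k # c)))"
      by (rule single) simp
    also have "\<dots> = (\<Sum>b\<in>C. \<Sum>c\<in>C. of_bool (i = i \<and> i = i \<and> D a b c) * (p (i # a) * p (i # b) * p (i # c)))"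
      by (intro sum.cong refl single) simp
    finally show "(\<Sum>j<m. \<Sum>b\<in>C. \<Sum>k<m. \<Sum>c\<in>C. of_bool (i = j \<and> j = k \<and> D a b c) * (p (i # a) * p (j # b) * p (k # c)))
       = (\<Sum>b\<in>C. \<Sum>c\<in>C. of_bool (D a b c) * (p (i # a) * p (i # b) * p (i # c)))" by simp
  qed
  also have "\<dots> = (\<Sum>i<m. forbidden_mass C D (\<lambda>a. p (i # a)))"
    unfolding forbidden_mass_def ..
  finally show ?thesis .
qed

text \<open>The cubes lie above their tangent at \<open>1 / m\<close>; the tangents sum to the left-hand side.\<close>

lemma sum_cubes_lower_bound:
  fixes x :: "nat \<Rightarrow> real"
  assumes "0 < m" "\<And>i. i < m \<Longrightarrow> 0 \<le> x i" "sum x {..<m} = 1"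
  shows "1 / (real m)\<^sup>2 \<le> (\<Sum>i<m. x i ^ 3)"
proof -
  define t where "t = 1 / real m"
  have tangent: "3 * t\<^sup>2 * y - 2 * t ^ 3 \<le> y ^ 3" if "0 \<le> y" for y
  proof -
    have "0 \<le> (y - t)\<^sup>2 * (y + 2 * t)" using that by (simp add: t_def)
    also have "\<dots> = y ^ 3 - (3 * t\<^sup>2 * y - 2 * t ^ 3)"
      by (simp add: power2_eq_square power3_eq_cube algebra_simps)
    finally show ?thesis by simp
  qed
  have "1 / (real m)\<^sup>2 = 3 * t\<^sup>2 * 1 - real m * (2 * t ^ 3)"
    using assms(1) by (simp add: t_def power2_eq_square power3_eq_cube field_simps)
  also have "\<dots> = (\<Sum>i<m. 3 * t\<^sup>2 * x i - 2 * t ^ 3)"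
    unfolding sum_subtractf sum_distrib_left[symmetric] assms(3) by simp
  also have "\<dots> \<le> (\<Sum>i<m. x i ^ 3)" using assms(2) by (intro sum_mono tangent) auto
  finally show ?thesis .
qed

text \<open>If the blocks have masses \<open>x\<^sub>i\<close>, then by homogeneity the forbidden mass is at least \<open>b\<close> times the sum of the
  \<open>x\<^sub>i ^ 3\<close>, which is smallest for equal masses.\<close>

lemma forbidden_mass_block_lower_bound:
  assumes "0 < m" "0 \<le> b" "\<And>p. probability_on C p \<Longrightarrow> b \<le> forbidden_mass C D p"
    and p: "probability_on (lift {..<m} C) p"
  shows "b / (real m)\<^sup>2 \<le> forbidden_mass (lift {..<m} C) (block_relation D) p"
proof -
  have nn: "0 \<le> p (i # a)" if "i < m" "a \<in> C" for i a using p that by (auto simp: probability_on_def)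
  have "b * (1 / (real m)\<^sup>2) \<le> b * (\<Sum>i<m. (\<Sum>a\<in>C. p (i # a)) ^ 3)"
  proof (rule mult_left_mono[OF sum_cubes_lower_bound])
    show "(\<Sum>i<m. \<Sum>a\<in>C. p (i # a)) = 1" using p by (simp add: probability_on_def sum_lift)
  qed (use assms nn in \<open>auto intro!: sum_nonneg\<close>)
  also have "\<dots> = (\<Sum>i<m. b * (\<Sum>a\<in>C. p (i # a)) ^ 3)" by (rule sum_distrib_left)
  also have "\<dots> \<le> (\<Sum>i<m. forbidden_mass C D (\<lambda>a. p (i # a)))"
    by (intro sum_mono forbidden_mass_homogeneous_bound assms(3)) (use nn in auto)
  finally show ?thesis by (simp add: forbidden_mass_block)
qed

text \<open>Equal weights on the blocks show that the lower bound is sharp.\<close>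

lemma forbidden_mass_block_attained:
  assumes "0 < m" "probability_on C q"
  shows "\<exists>p. probability_on (lift {..<m} C) p \<and> forbidden_mass (lift {..<m} C) (block_relation D) p = forbidden_mass C D q / (real m)\<^sup>2"
proof (intro exI[of _ "\<lambda>u. (1 / real m) * q (tl u)"] conjI)
  show "probability_on (lift {..<m} C) (\<lambda>u. (1 / real m) * q (tl u))"
    using assms by (auto simp: probability_on_def elim!: liftE) (simp add: sum_lift flip: sum_divide_distrib)
  have "forbidden_mass (lift {..<m} C) (block_relation D) (\<lambda>u. (1 / real m) * q (tl u))
      = (\<Sum>i<m. forbidden_mass C D (\<lambda>a. (1 / real m) * q a))" by (simp only: forbidden_mass_block list.sel)
  also have "\<dots> = real m * ((1 / real m) ^ 3 * forbidden_mass C D q)" by (simp only: forbidden_mass_scale) simp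
  also have "\<dots> = forbidden_mass C D q / (real m)\<^sup>2" using assms(1) by (simp add: power2_eq_square power3_eq_cube)
  finally show "forbidden_mass (lift {..<m} C) (block_relation D) (\<lambda>u. (1 / real m) * q (tl u)) = forbidden_mass C D q / (real m)\<^sup>2" .
qed

lemma palette_hom_block:
  assumes "palette_hom tl C D C' D'"
  shows "palette_hom (\<lambda>u. hd u # tl (tl u)) (lift {..<m} C) (block_relation D) (lift {..<m} C') (block_relation D')"
  using assms by (auto simp: palette_hom_def block_relation_def elim!: liftE)

text \<open>The edges are all triples that the random colouring does not forbid. The vertex set is the
  fixed set \<open>{..<N}\<close>, on which there are only finitely many 3-graphs.\<close>

lemma paintable_dense_exists:
  fixes C :: "'c::countable set"
  assumes "finite C" "symmetric_relation D" "probability_on C p" "0 < \<eta>" "1 / \<eta>\<^sup>2 < real N" "forbidden_mass C D p \<le> b"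
  shows "\<exists>E \<subseteq> Pow {..<N}. three_graph \<lparr>verts = {..<N}, edges = E\<rparr> \<and> paintable C D \<lparr>verts = {..<N}, edges = E\<rparr>
     \<and> uniformly_dense (1 - b) \<eta> \<lparr>verts = {..<N :: nat}, edges = E\<rparr>"
proof -
  obtain f :: "nat set \<Rightarrow> 'c" where f: "\<forall>t. f t \<in> C" "\<And>U. U \<subseteq> {..<N} \<Longrightarrow>
      real (card {t. t \<subseteq> U \<and> card t = 3 \<and> forbidden_triple D f t}) \<le> forbidden_mass C D p * real (card U choose 3) + \<eta> * real N ^ 3"
    using uniform_random_colouring[OF assms(1-5)] by blast
  define E where "E = {t. t \<subseteq> {..<N} \<and> card t = 3 \<and> \<not> forbidden_triple D f t}"
  let ?H = "\<lparr>verts = {..<N}, edges = E\<rparr>"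
  have "uniformly_dense (1 - b) \<eta> ?H"
    unfolding uniformly_dense_def
  proof (intro allI impI)
    fix U assume "U \<subseteq> verts ?H"
    then have U: "U \<subseteq> {..<N}" by simp
    then have finU: "finite U" by (rule finite_subset) simp
    have "card {t. t \<subseteq> U \<and> card t = 3} = card ({t \<in> E. t \<subseteq> U} \<union> {t. t \<subseteq> U \<and> card t = 3 \<and> forbidden_triple D f t})"
      by (rule arg_cong[where f = card]) (use U in \<open>auto simp: E_def\<close>)
    also have "\<dots> = card {t \<in> E. t \<subseteq> U} + card {t. t \<subseteq> U \<and> card t = 3 \<and> forbidden_triple D f t}"
      by (rule card_Un_disjoint) (use finU in \<open>auto simp: E_def intro!: finite_subset[of _ "Pow U"]\<close>)
    finally have "card U choose 3 = edges_in ?H U + card {t. t \<subseteq> U \<and> card t = 3 \<and> forbidden_triple D f t}"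
      using n_subsets[OF finU, of 3] by (simp add: edges_in_def)
    then have "real (card U choose 3) = real (edges_in ?H U) + real (card {t. t \<subseteq> U \<and> card t = 3 \<and> forbidden_triple D f t})"
      by simp
    moreover have "forbidden_mass C D p * real (card U choose 3) \<le> b * real (card U choose 3)"
      using assms(6) by (intro mult_right_mono) auto
    ultimately show "(1 - b) * real (card U choose 3) - \<eta> * real (card (verts ?H)) ^ 3 \<le> real (edges_in ?H U)"
      using f(2)[OF U] by (simp add: algebra_simps)
  qed
  moreover have "three_graph ?H" "paintable C D ?H" "E \<subseteq> Pow {..<N}"
    using f(1) by (auto simp: three_graph_def paintable_def E_def)
  ultimately show ?thesis by blast
qed

text \<open>The forbidden family consists of all 3-graphs that some palette of the sequence cannot paint. For the
  lower bound, each palette has a dense paintable 3-graph on \<open>{..<N}\<close> with the same \<open>N\<close>; by the pigeonhole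
  principle one 3-graph serves for infinitely many palettes, hence for all, as paintability is inherited
  by earlier palettes. For the upper bound, a single palette with small gap suffices.\<close>

lemma density_of_palette_sequence:
  fixes C :: "nat \<Rightarrow> 'c::countable set"
  assumes C: "\<And>n. finite (C n)" and D: "\<And>n. symmetric_relation (D n)"
    and hom: "\<And>n. \<exists>h. palette_hom h (C (Suc n)) (D (Suc n)) (C n) (D n)"
    and att: "\<And>n. \<exists>p. probability_on (C n) p \<and> forbidden_mass (C n) (D n) p \<le> \<beta>"
    and low: "\<And>n p. probability_on (C n) p \<Longrightarrow> \<beta> - \<Delta> n \<le> forbidden_mass (C n) (D n) p"
    and \<Delta>: "\<Delta> \<longlonglongrightarrow> 0" and \<beta>: "0 \<le> \<beta>" "\<beta> \<le> 1"
  shows "1 - \<beta> \<in> uniform_turan_densities"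
proof -
  define P where "P = {H :: nat hgraph. \<forall>n. paintable (C n) (D n) H}"
  define F where "F = {G. three_graph G \<and> G \<notin> P}"
  have anti: "paintable (C n) (D n) H" if "paintable (C m) (D m) H" "n \<le> m" for n m and H :: "nat hgraph"
    using that(2,1)
  proof (induction m rule: dec_induct)
    case (step m)
    then show ?case using hom[of m] paintable_hom by blast
  qed
  have free: "free_of F H" if "H \<in> P" for H
    unfolding free_of_def
  proof (intro ballI notI)
    fix G assume "G \<in> F" "contains_copy H G"
    then show False using that paintable_copy[of H G] by (auto simp: F_def P_def)
  qed
  have free': "H \<in> P" if "free_of F H" "three_graph H" for H
  proof (rule ccontr)
    assume "H \<notin> P"
    then have "H \<in> F" using that by (simp add: F_def)
    then show False using that contains_copy_refl unfolding free_of_def by blast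
  qed
  have ach: "1 - \<beta> \<in> achievable_densities F"
    unfolding achievable_densities_def
  proof (intro CollectI conjI allI impI)
    show "1 - \<beta> \<in> {0..1}" using \<beta> by simp
    fix \<eta> :: real and n0 :: nat assume \<eta>: "0 < \<eta>"
    define N where "N = max n0 (nat \<lceil>1 / \<eta>\<^sup>2\<rceil> + 1)"
    have N: "n0 \<le> N" "1 / \<eta>\<^sup>2 < real N"
    proof -
      have "1 / \<eta>\<^sup>2 < real (nat \<lceil>1 / \<eta>\<^sup>2\<rceil> + 1)" using real_nat_ceiling_ge[of "1 / \<eta>\<^sup>2"] by linarith
      also have "\<dots> \<le> real N" by (simp add: N_def)
      finally show "1 / \<eta>\<^sup>2 < real N" .
    qed (simp add: N_def)
    define Q where "Q = (\<lambda>n E. E \<subseteq> Pow {..<N} \<and> three_graph \<lparr>verts = {..<N}, edges = E\<rparr> \<and> paintable (C n) (D n) \<lparr>verts = {..<N}, edges = E\<rparr>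
       \<and> uniformly_dense (1 - \<beta>) \<eta> \<lparr>verts = {..<N :: nat}, edges = E\<rparr>)"
    have "\<exists>E. Q n E" for n
    proof -
      obtain p where p: "probability_on (C n) p" "forbidden_mass (C n) (D n) p \<le> \<beta>" using att by blast
      show ?thesis using paintable_dense_exists[OF C D p(1) \<eta> N(2) p(2)] unfolding Q_def by blast
    qed
    then obtain E where E: "\<And>n. Q n (E n)" by metis
    have "finite (range E)"
      by (rule finite_subset[of _ "Pow (Pow {..<N})"]) (use E in \<open>auto simp: Q_def\<close>)
    then obtain n1 where inf: "infinite {n. E n = E n1}"
      using pigeonhole_infinite[of "UNIV :: nat set" E] by auto
    define H where "H = \<lparr>verts = {..<N}, edges = E n1\<rparr>"
    have "paintable (C n) (D n) H" for n
    proof -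
      obtain m where "n \<le> m" "E m = E n1" using inf by (metis (mono_tags, lifting) infinite_nat_iff_unbounded_le mem_Collect_eq)
      then have "paintable (C m) (D m) H" using E[of m] by (simp add: Q_def H_def)
      then show ?thesis using \<open>n \<le> m\<close> by (rule anti)
    qed
    then have "free_of F H" by (intro free) (simp add: P_def)
    moreover have "three_graph H" "uniformly_dense (1 - \<beta>) \<eta> H" using E[of n1] by (simp_all add: Q_def H_def)
    ultimately show "\<exists>H :: nat hgraph. three_graph H \<and> n0 \<le> card (verts H) \<and> free_of F H \<and> uniformly_dense (1 - \<beta>) \<eta> H"
      using N by (intro exI[of _ H]) (simp add: H_def)
  qed
  have upper: "d \<le> 1 - \<beta>" if d: "d \<in> achievable_densities F" for d
  proof (rule ccontr)
    assume "\<not> d \<le> 1 - \<beta>"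
    then have e: "0 < (d - (1 - \<beta>)) / 2" (is "0 < ?e") by simp
    obtain n where n: "\<Delta> n < ?e"
      using order_tendstoD(2)[OF \<Delta> e] by (auto simp: eventually_sequentially)
    define b where "b = max 0 (\<beta> - \<Delta> n)"
    obtain p where p: "probability_on (C n) p" "forbidden_mass (C n) (D n) p \<le> \<beta>" using att by blast
    have bn: "b \<le> forbidden_mass (C n) (D n) q" if "probability_on (C n) q" for q
      using low[OF that] forbidden_mass_nonneg[of "C n" q "D n"] that by (simp add: b_def probability_on_def)
    have b01: "0 \<le> b" "b \<le> 1" using bn[OF p(1)] p(2) \<beta> by (auto simp: b_def)
    have ne: "C n \<noteq> {}" using p(1) by (auto simp: probability_on_def)
    obtain \<eta> n0 where \<eta>: "0 < \<eta>" and up: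
      "\<forall>H :: nat hgraph. three_graph H \<longrightarrow> paintable (C n) (D n) H \<longrightarrow> n0 \<le> card (verts H) \<longrightarrow> \<not> uniformly_dense (1 - b + ?e) \<eta> H"
      by (rule paintable_not_dense[OF C ne forbidden_mass_homogeneous_bound[OF bn] b01 e])
    obtain H :: "nat hgraph" where H: "three_graph H" "n0 \<le> card (verts H)" "free_of F H" "uniformly_dense d \<eta> H"
      using d \<eta> unfolding achievable_densities_def by blast
    have "H \<in> P" using free' H by blast
    then have "paintable (C n) (D n) H" by (simp add: P_def)
    moreover have "uniformly_dense (1 - b + ?e) \<eta> H"
    proof (rule uniformly_dense_mono[OF H(4)])
      have "\<beta> - \<Delta> n \<le> b" by (simp add: b_def)
      then show "1 - b + ?e \<le> d" using n by (simp add: field_simps)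
    qed simp
    ultimately show False using up H by blast
  qed
  have "Sup (achievable_densities F) = 1 - \<beta>" using ach upper by (intro cSup_eq_maximum)
  then have "uniform_turan_density F = 1 - \<beta>" using ach by (auto simp: uniform_turan_density_def)
  moreover have "\<forall>G\<in>F. three_graph G" by (simp add: F_def)
  ultimately show ?thesis unfolding uniform_turan_densities_def
    by (intro CollectI exI[of _ F]) simp
qed

text \<open>One colour and nothing forbidden.\<close>

lemma one_in_uniform_turan_densities: "1 \<in> uniform_turan_densities"
proof -
  have "1 - 0 \<in> uniform_turan_densities"
    by (rule density_of_palette_sequence[where C = "\<lambda>_. {[] :: nat list}" and D = "\<lambda>_ _ _ _. False" and \<Delta> = "\<lambda>_. 0"])
       (auto simp: symmetric_relation_def palette_hom_def forbidden_mass_def probability_on_def intro: exI[of _ "\<lambda>_. 1"] exI[of _ "\<lambda>x. x"])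
  then show ?thesis by simp
qed

lemma scaled_interval_in_uniform_turan_densities:
  assumes \<beta>: "1 / 9 < \<beta>" "\<beta> \<le> 1 / 9 + (1 / 4) ^ 6 / 4096" and m: "0 < m"
  shows "1 - \<beta> / (real m)\<^sup>2 \<in> uniform_turan_densities"
proof -
  obtain C :: "nat \<Rightarrow> nat list set" and D and \<Delta> :: "nat \<Rightarrow> real" where
    C: "\<And>n. finite (C n)" and D: "\<And>n. symmetric_relation (D n)"
    and att: "\<And>n. \<exists>p. probability_on (C n) p \<and> forbidden_mass (C n) (D n) p \<le> \<beta>"
    and low: "\<And>n p. probability_on (C n) p \<Longrightarrow> \<beta> - \<Delta> n \<le> forbidden_mass (C n) (D n) p"
    and hom: "\<And>n. palette_hom tl (C (Suc n)) (D (Suc n)) (C n) (D n)"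
    and \<Delta>: "\<Delta> \<longlonglongrightarrow> 0"
    using palette_sequence[OF \<beta>] by blast
  have m1: "1 \<le> (real m)\<^sup>2" using m by (simp add: one_le_power)
  show ?thesis
  proof (rule density_of_palette_sequence[where C = "\<lambda>n. lift {..<m} (C n)" and D = "\<lambda>n. block_relation (D n)" and \<Delta> = "\<lambda>n. \<bar>\<Delta> n\<bar>"])
    show "finite (lift {..<m} (C n))" "symmetric_relation (block_relation (D n))" for n
      using C D by (simp_all add: finite_lift symmetric_block_relation)
    show "\<exists>h. palette_hom h (lift {..<m} (C (Suc n))) (block_relation (D (Suc n))) (lift {..<m} (C n)) (block_relation (D n))" for n
      using palette_hom_block[OF hom] by blast
    show "\<exists>p. probability_on (lift {..<m} (C n)) p \<and> forbidden_mass (lift {..<m} (C n)) (block_relation (D n)) p \<le> \<beta> / (real m)\<^sup>2" for n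
    proof -
      obtain q where "probability_on (C n) q" "forbidden_mass (C n) (D n) q \<le> \<beta>" using att by blast
      then show ?thesis using forbidden_mass_block_attained[OF m, of "C n" q "D n"] by (metis divide_right_mono zero_le_power2)
    qed
    fix n p assume p: "probability_on (lift {..<m} (C n)) p"
    have "max 0 (\<beta> - \<Delta> n) \<le> forbidden_mass (C n) (D n) q" if "probability_on (C n) q" for q
      using low[OF that] forbidden_mass_nonneg[of "C n" q "D n"] that by (simp add: probability_on_def)
    then have "max 0 (\<beta> - \<Delta> n) / (real m)\<^sup>2 \<le> forbidden_mass (lift {..<m} (C n)) (block_relation (D n)) p"
      using m p by (intro forbidden_mass_block_lower_bound) auto
    moreover have "(\<beta> - \<Delta> n) / (real m)\<^sup>2 \<le> max 0 (\<beta> - \<Delta> n) / (real m)\<^sup>2" by (intro divide_right_mono) auto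
    moreover have "\<bar>\<Delta> n\<bar> / (real m)\<^sup>2 \<le> \<bar>\<Delta> n\<bar> / 1" using m1 m by (intro divide_left_mono) auto
    moreover have "\<Delta> n / (real m)\<^sup>2 \<le> \<bar>\<Delta> n\<bar> / (real m)\<^sup>2" by (intro divide_right_mono) auto
    ultimately show "\<beta> / (real m)\<^sup>2 - \<bar>\<Delta> n\<bar> \<le> forbidden_mass (lift {..<m} (C n)) (block_relation (D n)) p"
      by (simp add: diff_divide_distrib)
  next
    show "(\<lambda>n. \<bar>\<Delta> n\<bar>) \<longlonglongrightarrow> 0" using \<Delta> by (simp add: tendsto_rabs_zero)
    show "0 \<le> \<beta> / (real m)\<^sup>2" using \<beta> by simp
    have "\<beta> / (real m)\<^sup>2 \<le> \<beta> / 1" using m1 m \<beta> by (intro divide_left_mono) auto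
    moreover have "(1 / 4) ^ 6 / 4096 \<le> (1 :: real) / 2" by (simp add: power_one_over)
    ultimately show "\<beta> / (real m)\<^sup>2 \<le> 1" using \<beta> by linarith
  qed
qed

text \<open>Given \<open>b = 1 - a\<close>, take the least \<open>m\<close> with \<open>b * m\<^sup>2 > 1/9\<close>. For small \<open>b\<close> this \<open>m\<close> is large, and consecutive
  values \<open>b * (m - 1)\<^sup>2\<close> and \<open>b * m\<^sup>2\<close> are so close that the latter lies in the interval reached by the
  palette sequences.\<close>

lemma interval_in_uniform_turan_densities:
  "\<exists>\<delta>::real. 0 < \<delta> \<and> {1 - \<delta>..1} \<subseteq> uniform_turan_densities"
proof -
  \<comment> \<open>The interval above \<open>1/9\<close> has length \<open>(1 / 4) ^ 6 / 4096 = 2 ^ (- 24)\<close>, and one step in \<open>m\<close> changes \<open>b * m\<^sup>2\<close>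
    by at most \<open>3 / (9 * L)\<close>.\<close>
  define L :: real where "L = 2 ^ 23"
  define \<delta> where "\<delta> = 1 / (9 * (L + 2)\<^sup>2)"
  have \<delta>: "0 < \<delta>" by (simp add: \<delta>_def L_def)
  have "a \<in> uniform_turan_densities" if a: "a \<in> {1 - \<delta>..1}" for a
  proof (cases "a = 1")
    case True
    then show ?thesis using one_in_uniform_turan_densities by simp
  next
    case False
    define b where "b = 1 - a"
    have b: "0 < b" "b \<le> \<delta>" using a False by (auto simp: b_def)
    define m where "m = (LEAST m :: nat. 1 / 9 < b * (real m)\<^sup>2)"
    have ex: "\<exists>m :: nat. 1 / 9 < b * (real m)\<^sup>2"
    proof -
      obtain k :: nat where k: "1 / (9 * b) + 1 < real k" using reals_Archimedean2 by blast
      then have k1: "1 \<le> real k" using b by (smt (verit) divide_nonneg_pos)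
      have "1 / 9 < b * real k" using k b by (simp add: field_simps)
      also have "\<dots> \<le> b * (real k)\<^sup>2" using k1 b by (intro mult_left_mono) (auto simp: power2_eq_square)
      finally show ?thesis by blast
    qed
    have m: "1 / 9 < b * (real m)\<^sup>2" unfolding m_def using ex by (rule LeastI_ex)
    have m0: "0 < m" using m by (cases m) auto
    have "b * (real m)\<^sup>2 \<le> \<delta> * (real m)\<^sup>2" using b by (intro mult_right_mono) auto
    then have "1 / 9 < (real m)\<^sup>2 / (9 * (L + 2)\<^sup>2)" using m by (simp add: \<delta>_def)
    then have "(L + 2)\<^sup>2 < (real m)\<^sup>2" by (simp add: L_def)
    then have mL: "L + 2 < real m" by (rule power2_less_imp_less) simp
    have "\<not> 1 / 9 < b * (real (m - 1))\<^sup>2" unfolding m_def by (rule not_less_Least) (use m0 m_def in simp)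
    then have m': "b * (real m - 1)\<^sup>2 \<le> 1 / 9" using m0 by (simp add: of_nat_diff)
    define x where "x = real m - 1"
    have x: "L + 1 < x" "real m = x + 1" using mL by (simp_all add: x_def)
    have "b * (real m)\<^sup>2 \<le> 1 / 9 + (1 / 4) ^ 6 / 4096"
    proof -
      have xpos: "0 < x" using x by (simp add: L_def)
      have bx: "b * x\<^sup>2 \<le> 1 / 9" using m' by (simp add: x_def)
      have "b * x * L \<le> b * x * x" using x b xpos by (intro mult_left_mono) auto
      then have bxL: "b * x * L \<le> 1 / 9" using bx by (simp add: power2_eq_square mult.assoc)
      have "b * 1 \<le> b * x" using x b by (intro mult_left_mono) (auto simp: L_def)
      then have "b * (real m)\<^sup>2 \<le> b * x\<^sup>2 + 3 * (b * x)" unfolding x(2) by (simp add: power2_eq_square algebra_simps)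
      moreover have "3 * (b * x) \<le> (1 / 4) ^ 6 / 4096" using bxL by (simp add: L_def power_one_over)
      ultimately show ?thesis using bx by linarith
    qed
    from scaled_interval_in_uniform_turan_densities[OF m this m0]
    show ?thesis using m0 by (simp add: b_def)
  qed
  then show ?thesis using \<delta> by blast
qed

section \<open>The Souslin operation and measurability of the set of densities\<close>

text \<open>A measurable superset of least measure; intersecting it with another measurable superset cannot make
  the measure smaller.\<close>

lemma measurable_hull_exists:
  fixes M :: "'a measure"
  assumes M: "K \<in> sets M" "emeasure M K < \<infinity>" and S: "S \<subseteq> K"
  shows "\<exists>B\<in>sets M. S \<subseteq> B \<and> B \<subseteq> K \<and> (\<forall>E\<in>sets M. S \<subseteq> E \<longrightarrow> B - E \<in> null_sets M)"
proof -
  define \<E> where "\<E> = {E \<in> sets M. S \<subseteq> E \<and> E \<subseteq> K}"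
  have fin: "emeasure M E = ennreal (measure M E)" if "E \<in> \<E>" for E
  proof -
    have "emeasure M E \<le> emeasure M K" using that M by (intro emeasure_mono) (auto simp: \<E>_def)
    then have "emeasure M E < \<infinity>" using M(2) by (rule le_less_trans)
    then show ?thesis by (simp add: emeasure_eq_ennreal_measure)
  qed
  define m where "m = Inf (measure M ` \<E>)"
  have KE: "K \<in> \<E>" using M S by (simp add: \<E>_def)
  have bdd: "bdd_below (measure M ` \<E>)" by (rule bdd_belowI[of _ 0]) auto
  have m_le: "m \<le> measure M E" if "E \<in> \<E>" for E
    unfolding m_def using that bdd by (intro cInf_lower) auto
  have "\<exists>E\<in>\<E>. measure M E < m + 1 / real (Suc n)" for n
  proof -
    have "Inf (measure M ` \<E>) < m + 1 / real (Suc n)" by (simp add: m_def)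
    then show ?thesis using KE bdd by (subst (asm) cInf_less_iff) auto
  qed
  then obtain E where E: "\<And>n. E n \<in> \<E>" "\<And>n. measure M (E n) < m + 1 / real (Suc n)" by metis
  define B where "B = (\<Inter>n. E n)"
  have "B \<subseteq> E 0" by (auto simp: B_def)
  moreover have "B \<in> sets M" "S \<subseteq> B" using E(1) by (auto simp: \<E>_def B_def)
  ultimately have BE: "B \<in> \<E>" using E(1)[of 0] by (auto simp: \<E>_def)
  have "measure M B \<le> m + 1 / real (Suc n)" for n
  proof -
    have "emeasure M B \<le> emeasure M (E n)" using E(1)[of n] by (intro emeasure_mono) (auto simp: B_def \<E>_def)
    then have "measure M B \<le> measure M (E n)" using fin[OF BE] fin[OF E(1)[of n]] by simp
    then show ?thesis using E(2)[of n] by linarith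
  qed
  moreover have "(\<lambda>n. m + 1 / real (Suc n)) \<longlonglongrightarrow> m + 0"
    by (intro tendsto_add tendsto_const lim_1_over_n[THEN LIMSEQ_Suc, simplified] LIMSEQ_Suc[OF lim_1_over_n])
  ultimately have Bm: "measure M B \<le> m"
    by (intro LIMSEQ_le_const[of "\<lambda>n. m + 1 / real (Suc n)"]) auto
  have "B - F \<in> null_sets M" if F: "F \<in> sets M" "S \<subseteq> F" for F
  proof -
    have BF: "B \<inter> F \<in> \<E>" using BE F by (auto simp: \<E>_def)
    have BsM: "B \<in> sets M" using BE by (simp add: \<E>_def)
    have "emeasure M (B - B \<inter> F) = emeasure M B - emeasure M (B \<inter> F)"
      using BF BsM fin[OF BF] by (intro emeasure_Diff) (auto simp: \<E>_def)
    also have "\<dots> = 0"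
      using m_le[OF BF] Bm unfolding fin[OF BF] fin[OF BE] by (simp add: ennreal_minus diff_le_0_iff_le ennreal_eq_0_iff)
    finally have "emeasure M (B - F) = 0" by (simp add: Diff_Int)
    then show ?thesis using BsM F by (auto intro!: null_setsI)
  qed
  then show ?thesis using BE by (auto simp: \<E>_def)
qed

text \<open>Let \<open>S l\<close> be the part of the result that comes from branches through \<open>l\<close>, and \<open>B l\<close> a measurable hull of
  it inside \<open>A l\<close>. As \<open>S l\<close> is the union of the \<open>S (l @ [n])\<close>, the set \<open>B l\<close> exceeds the union of the \<open>B (l @ [n])\<close>
  by a null set only. A point of \<open>B []\<close> outside these countably many null sets can be followed along a
  branch and lies in \<open>S []\<close>, so \<open>S []\<close> differs from \<open>B []\<close> by a null set.\<close>

theorem souslin_operation_lebesgue: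
  fixes A :: "nat list \<Rightarrow> 'a::euclidean_space set"
  assumes A: "\<And>l. A l \<in> sets lebesgue" and K: "K \<in> sets lebesgue" "emeasure lebesgue K < \<infinity>" "\<And>l. A l \<subseteq> K"
  shows "(\<Union>t :: nat \<Rightarrow> nat. \<Inter>k. A (map t [0..<k])) \<in> sets lebesgue"
proof -
  define S where "S = (\<lambda>l. \<Union>t\<in>{t :: nat \<Rightarrow> nat. map t [0..<length l] = l}. \<Inter>k. A (map t [0..<k]))"
  have SA: "S l \<subseteq> A l" for l
  proof
    fix x assume "x \<in> S l"
    then obtain t :: "nat \<Rightarrow> nat" where t: "map t [0..<length l] = l" "\<And>k. x \<in> A (map t [0..<k])"
      unfolding S_def by auto
    then show "x \<in> A l" using t(2)[of "length l"] by simp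
  qed
  have Ssplit: "S l \<subseteq> (\<Union>n. S (l @ [n]))" for l
  proof
    fix x assume "x \<in> S l"
    then obtain t :: "nat \<Rightarrow> nat" where t: "map t [0..<length l] = l" "x \<in> (\<Inter>k. A (map t [0..<k]))"
      unfolding S_def by auto
    have "map t [0..<length (l @ [t (length l)])] = l @ [t (length l)]" using t(1) by simp
    then have "x \<in> S (l @ [t (length l)])" unfolding S_def using t(2) by blast
    then show "x \<in> (\<Union>n. S (l @ [n]))" by blast
  qed
  have "\<exists>B. B \<in> sets lebesgue \<and> S l \<subseteq> B \<and> B \<subseteq> A l \<and> (\<forall>E\<in>sets lebesgue. S l \<subseteq> E \<longrightarrow> B - E \<in> null_sets lebesgue)" for l
  proof -
    have "emeasure lebesgue (A l) \<le> emeasure lebesgue K" using A K by (intro emeasure_mono)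
    then have "emeasure lebesgue (A l) < \<infinity>" using K(2) by (rule le_less_trans)
    from measurable_hull_exists[OF A this SA] show ?thesis by blast
  qed
  then obtain B where B: "\<And>l. B l \<in> sets lebesgue" "\<And>l. S l \<subseteq> B l" "\<And>l. B l \<subseteq> A l"
    "\<And>l E. E \<in> sets lebesgue \<Longrightarrow> S l \<subseteq> E \<Longrightarrow> B l - E \<in> null_sets lebesgue"
    by metis
  define N where "N = (\<lambda>l. B l - (\<Union>n. B (l @ [n])))"
  have N: "N l \<in> null_sets lebesgue" for l
    unfolding N_def
  proof (rule B(4))
    show "(\<Union>n. B (l @ [n])) \<in> sets lebesgue" using B(1) by blast
    show "S l \<subseteq> (\<Union>n. B (l @ [n]))" using Ssplit[of l] B(2) by blast
  qed
  have sub: "B [] - S [] \<subseteq> (\<Union>l. N l)"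
  proof (rule subsetI, rule ccontr)
    fix x assume x: "x \<in> B [] - S []" and "x \<notin> (\<Union>l. N l)"
    then have step: "\<exists>n. x \<in> B (l @ [n])" if "x \<in> B l" for l using that by (auto simp: N_def)
    define L where "L = rec_nat [] (\<lambda>_ l. l @ [SOME n. x \<in> B (l @ [n])])"
    have L: "L 0 = []" "L (Suc k) = L k @ [SOME n. x \<in> B (L k @ [n])]" for k by (simp_all add: L_def)
    have xB: "x \<in> B (L k)" for k
    proof (induction k)
      case (Suc k)
      then show ?case unfolding L by (rule someI_ex[OF step])
    qed (use x L in simp)
    define t where "t = (\<lambda>k. SOME n. x \<in> B (L k @ [n]))"
    have tL: "map t [0..<k] = L k" for k
      by (induction k) (simp_all add: L t_def)
    have "x \<in> A (map t [0..<k])" for k using xB[of k] B(3) tL by auto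
    then have "x \<in> S []" unfolding S_def by auto
    then show False using x by simp
  qed
  have "(\<Union>l. N l) \<in> null_sets lebesgue" using N by (intro null_sets_UN') auto
  then have null: "B [] - S [] \<in> null_sets lebesgue" using sub by (rule null_sets_completion_subset[rotated])
  have "S [] = B [] - (B [] - S [])" using B(2)[of "[]"] by blast
  then have "S [] \<in> sets lebesgue" using B(1)[of "[]"] null by (metis null_setsD2 sets.Diff)
  moreover have "S [] = (\<Union>t :: nat \<Rightarrow> nat. \<Inter>k. A (map t [0..<k]))" by (simp add: S_def)
  ultimately show ?thesis by simp
qed

text \<open>Some number above \<open>x\<close> is a uniform density of \<open>G\<close> in a quantitative sense controlled by \<open>s\<close>. The value \<open>s j\<close>
  serves both as a bound on the size and as the reciprocal of the error. Requiring \<open>j \<le> card (verts G)\<close> makes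
  the condition depend on finitely many values of \<open>s\<close> only.\<close>

definition overdense :: "(nat \<Rightarrow> nat) \<Rightarrow> real \<Rightarrow> nat hgraph \<Rightarrow> bool" where
  "overdense s x G \<longleftrightarrow> (\<exists>j. x + 1 / real (Suc j) \<le> 1 \<and> s j \<le> card (verts G) \<and> j \<le> card (verts G) \<and>
      uniformly_dense (x + 1 / real (Suc j)) (1 / real (Suc (s j))) G)"

text \<open>A 3-graph that shows, up to \<open>1 / (m + 1)\<close>, that \<open>x\<close> is a lower bound for the density of the family of
  \<open>s\<close>-overdense 3-graphs, while not containing any of them.\<close>

definition density_witness :: "nat \<Rightarrow> (nat \<Rightarrow> nat) \<Rightarrow> nat hgraph \<Rightarrow> real \<Rightarrow> bool" where
  "density_witness m s H x \<longleftrightarrow> m \<le> card (verts H) \<and> uniformly_dense (x - 1 / real (Suc m)) (1 / real (Suc m)) H \<and>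
     (\<forall>G. three_graph G \<longrightarrow> contains_copy H G \<longrightarrow> \<not> overdense s x G)"

text \<open>This replaces the quantifier over families by one over number sequences. From a family with density \<open>x\<close>,
  the sequence \<open>s\<close> records for which size and error the density \<open>x + 1 / (j + 1)\<close> fails; its dense free 3-graphs
  are witnesses. Conversely, the 3-graphs that are overdense with respect to \<open>s\<close> form a family of density
  \<open>x\<close>: the witnesses bound its density from below, and a free 3-graph of larger density would be
  overdense and so contain a member, itself.\<close>

lemma density_iff_witnesses:
  assumes x: "0 < x" "x < 1"
  shows "x \<in> uniform_turan_densities \<longleftrightarrow> (\<exists>s. \<forall>m. \<exists>H. three_graph H \<and> density_witness m s H x)"
proof
  assume "x \<in> uniform_turan_densities"
  then obtain F where F: "x = uniform_turan_density F" unfolding uniform_turan_densities_def by blast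
  define A where "A = achievable_densities F"
  have ne: "A \<noteq> {}" and supA: "Sup A = x" using F x by (auto simp: uniform_turan_density_def A_def split: if_splits)
  have A01: "A \<subseteq> {0..1}" by (auto simp: A_def achievable_densities_def)
  have bdd: "bdd_above A" using A01 by (rule bdd_above_mono[OF bdd_above_Icc])
  have ex: "\<exists>n \<ge> j. x + 1 / real (Suc j) \<le> 1 \<longrightarrow> (\<forall>H :: nat hgraph. three_graph H \<longrightarrow> n \<le> card (verts H) \<longrightarrow> free_of F H \<longrightarrow>
      \<not> uniformly_dense (x + 1 / real (Suc j)) (1 / real (Suc n)) H)" for j
  proof (cases "x + 1 / real (Suc j) \<le> 1")
    case True
    have notA: "x + 1 / real (Suc j) \<notin> A"
      using cSup_upper[OF _ bdd, of "x + 1 / real (Suc j)"] supA by (auto simp: not_le)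
    have "\<exists>\<eta>>0. \<exists>n0. \<forall>H :: nat hgraph. \<not> (three_graph H \<and> n0 \<le> card (verts H) \<and> free_of F H \<and> uniformly_dense (x + 1 / real (Suc j)) \<eta> H)"
    proof (rule ccontr)
      assume neg: "\<not> ?thesis"
      have "x + 1 / real (Suc j) \<in> A"
        unfolding A_def achievable_densities_def
      proof (intro CollectI conjI allI impI)
        show "x + 1 / real (Suc j) \<in> {0..1}" using True x by simp
        fix \<eta> :: real and n0 :: nat assume "0 < \<eta>"
        then show "\<exists>H :: nat hgraph. three_graph H \<and> n0 \<le> card (verts H) \<and> free_of F H \<and> uniformly_dense (x + 1 / real (Suc j)) \<eta> H"
          using neg by blast
      qed
      with notA show False by contradiction
    qed
    then obtain \<eta> n0 where \<eta>: "0 < \<eta>" and no: "\<And>H :: nat hgraph. three_graph H \<Longrightarrow> n0 \<le> card (verts H) \<Longrightarrow> free_of F H \<Longrightarrow>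
      \<not> uniformly_dense (x + 1 / real (Suc j)) \<eta> H"
      by blast
    define n where "n = max j (max n0 (nat \<lceil>1 / \<eta>\<rceil>))"
    have "1 / \<eta> \<le> real (Suc n)" using real_nat_ceiling_ge[of "1 / \<eta>"] by (simp add: n_def)
    then have "1 / real (Suc n) \<le> \<eta>" using \<eta> by (simp add: field_simps)
    then have "\<not> uniformly_dense (x + 1 / real (Suc j)) (1 / real (Suc n)) H"
      if "three_graph H" "n \<le> card (verts H)" "free_of F H" for H :: "nat hgraph"
      using no[OF that(1) _ that(3)] that(2) uniformly_dense_mono[of "x + 1 / real (Suc j)" "1 / real (Suc n)" H "x + 1 / real (Suc j)" \<eta>]
      by (auto simp: n_def)
    then show ?thesis by (intro exI[of _ n]) (auto simp: n_def)
  qed auto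
  have "\<exists>s. \<forall>j. x + 1 / real (Suc j) \<le> 1 \<longrightarrow> (\<forall>H :: nat hgraph. three_graph H \<longrightarrow> s j \<le> card (verts H) \<longrightarrow> free_of F H \<longrightarrow>
      \<not> uniformly_dense (x + 1 / real (Suc j)) (1 / real (Suc (s j))) H)"
    using ex by metis
  then obtain s where s: "\<And>j (H :: nat hgraph). x + 1 / real (Suc j) \<le> 1 \<Longrightarrow> three_graph H \<Longrightarrow> s j \<le> card (verts H) \<Longrightarrow> free_of F H \<Longrightarrow>
      \<not> uniformly_dense (x + 1 / real (Suc j)) (1 / real (Suc (s j))) H"
    by blast
  have "\<exists>H. three_graph H \<and> density_witness m s H x" for m
  proof -
    have "x - 1 / real (Suc m) < Sup A" using supA by simp
    then obtain a where a: "a \<in> A" "x - 1 / real (Suc m) < a" using less_cSup_iff[OF ne bdd] by blast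
    have "0 < 1 / real (Suc m)" by simp
    then obtain H :: "nat hgraph" where H: "three_graph H" "m \<le> card (verts H)" "free_of F H" "uniformly_dense a (1 / real (Suc m)) H"
      using a(1) unfolding A_def achievable_densities_def by blast
    have "\<not> overdense s x G" if "three_graph G" "contains_copy H G" for G
    proof
      assume "overdense s x G"
      moreover have "free_of F G" using H(3) that(2) contains_copy_trans unfolding free_of_def by blast
      ultimately show False using s[OF _ that(1)] unfolding overdense_def by blast
    qed
    moreover have "uniformly_dense (x - 1 / real (Suc m)) (1 / real (Suc m)) H"
      using H(4) by (rule uniformly_dense_mono) (use a in auto)
    ultimately show ?thesis using H unfolding density_witness_def by blast
  qed
  then show "\<exists>s. \<forall>m. \<exists>H. three_graph H \<and> density_witness m s H x" by blast
next
  assume "\<exists>s. \<forall>m. \<exists>H. three_graph H \<and> density_witness m s H x"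
  then obtain s where s: "\<And>m. \<exists>H. three_graph H \<and> density_witness m s H x" by blast
  define F where "F = {G. three_graph G \<and> overdense s x G}"
  define A where "A = achievable_densities F"
  have low: "d \<in> A" if d: "0 \<le> d" "d < x" for d
    unfolding A_def achievable_densities_def
  proof (intro CollectI conjI allI impI)
    show "d \<in> {0..1}" using d x by simp
    fix \<eta> :: real and n0 :: nat assume \<eta>: "0 < \<eta>"
    define m where "m = max n0 (nat \<lceil>max (1 / \<eta>) (1 / (x - d))\<rceil>)"
    have "max (1 / \<eta>) (1 / (x - d)) \<le> real (nat \<lceil>max (1 / \<eta>) (1 / (x - d))\<rceil>)" by (rule real_nat_ceiling_ge)
    also have "\<dots> \<le> real (Suc m)" by (simp add: m_def)
    finally have "1 / \<eta> \<le> real (Suc m)" "1 / (x - d) \<le> real (Suc m)" by auto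
    then have m: "1 / real (Suc m) \<le> \<eta>" "1 / real (Suc m) \<le> x - d" using \<eta> d by (simp_all add: field_simps)
    obtain H :: "nat hgraph" where H: "three_graph H" "density_witness m s H x" using s by blast
    have "free_of F H" using H(2) unfolding free_of_def F_def density_witness_def by blast
    moreover have "uniformly_dense d \<eta> H"
      by (rule uniformly_dense_mono[of "x - 1 / real (Suc m)" "1 / real (Suc m)"]) (use H(2) m in \<open>auto simp: density_witness_def\<close>)
    ultimately show "\<exists>H :: nat hgraph. three_graph H \<and> n0 \<le> card (verts H) \<and> free_of F H \<and> uniformly_dense d \<eta> H"
      using H by (intro exI[of _ H]) (auto simp: density_witness_def m_def)
  qed
  have high: "d \<le> x" if d: "d \<in> A" for d
  proof (rule ccontr)
    assume "\<not> d \<le> x"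
    then have dx: "0 < d - x" by simp
    obtain j where j: "1 / real (Suc j) < d - x" using nat_approx_posE[OF dx] by blast
    have d1: "d \<le> 1" using d by (auto simp: A_def achievable_densities_def)
    have "0 < 1 / real (Suc (s j))" by simp
    then obtain H :: "nat hgraph" where H: "three_graph H" "max (s j) j \<le> card (verts H)" "free_of F H" "uniformly_dense d (1 / real (Suc (s j))) H"
      using d unfolding A_def achievable_densities_def by blast
    have "uniformly_dense (x + 1 / real (Suc j)) (1 / real (Suc (s j))) H"
      using H(4) by (rule uniformly_dense_mono) (use j in auto)
    then have "overdense s x H" unfolding overdense_def using H(2) j d1 by (intro exI[of _ j]) auto
    then have "H \<in> F" using H(1) by (simp add: F_def)
    then show False using H(3) contains_copy_refl unfolding free_of_def by blast
  qed
  have ne: "A \<noteq> {}" using low[of 0] x by auto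
  have bdd: "bdd_above A" using high by (rule bdd_aboveI)
  have "Sup A \<le> x" using ne high by (rule cSup_least)
  moreover have "x \<le> Sup A"
  proof (rule dense_le_bounded[OF x(1)])
    fix w assume "0 < w" "w < x"
    then show "w \<le> Sup A" using low[of w] bdd by (intro cSup_upper) auto
  qed
  ultimately have "uniform_turan_density F = x" using ne by (simp add: uniform_turan_density_def A_def)
  moreover have "\<forall>G\<in>F. three_graph G" by (simp add: F_def)
  ultimately show "x \<in> uniform_turan_densities" unfolding uniform_turan_densities_def
    by (intro CollectI exI[of _ F]) simp
qed

lemma countable_three_graphs: "countable {H :: nat hgraph. three_graph H}"
proof -
  define \<V> where "\<V> = {V :: nat set. finite V}"
  define \<W> where "\<W> = {E. finite E \<and> E \<subseteq> \<V>}"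
  have cV: "countable \<V>" unfolding \<V>_def by (rule countable_Collect_finite)
  then have "countable \<W>" unfolding \<W>_def by (rule countable_Collect_finite_subset)
  with cV have c: "countable (\<V> \<times> \<W>)" by (rule countable_SIGMA)
  have "{H :: nat hgraph. three_graph H} \<subseteq> (\<lambda>(V, E). \<lparr>verts = V, edges = E\<rparr>) ` (\<V> \<times> \<W>)"
  proof
    fix H :: "nat hgraph" assume "H \<in> {H. three_graph H}"
    then have H: "finite (verts H)" "edges H \<subseteq> Pow (verts H)" by (auto simp: three_graph_def)
    then have "finite (edges H)" by (meson finite_Pow_iff finite_subset)
    moreover have "edges H \<subseteq> \<V>" using H by (auto simp: \<V>_def intro: finite_subset)
    ultimately have "(verts H, edges H) \<in> \<V> \<times> \<W>" using H by (simp add: \<V>_def \<W>_def)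
    then show "H \<in> (\<lambda>(V, E). \<lparr>verts = V, edges = E\<rparr>) ` (\<V> \<times> \<W>)"
      by (intro image_eqI[of _ _ "(verts H, edges H)"]) simp_all
  qed
  then show ?thesis using c by (meson countable_image countable_subset)
qed

lemma uniformly_dense_borel:
  assumes "three_graph H"
  shows "{x :: real. uniformly_dense (x + c) \<eta> H} \<in> sets borel"
proof -
  have "{x. uniformly_dense (x + c) \<eta> H} = (\<Inter>U\<in>Pow (verts H). {x. (x + c) * real (card U choose 3) - \<eta> * real (card (verts H)) ^ 3 \<le> real (edges_in H U)})"
    by (auto simp: uniformly_dense_def)
  moreover have "closed \<dots>"
    by (intro closed_INT ballI closed_Collect_le continuous_intros)
  ultimately show ?thesis by simp
qed

lemma density_witness_borel:
  assumes "three_graph H"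
  shows "{x. density_witness m s H x} \<in> sets borel"
proof -
  define \<G> where "\<G> = {G :: nat hgraph. three_graph G \<and> contains_copy H G}"
  have cG: "countable \<G>" by (rule countable_subset[OF _ countable_three_graphs]) (auto simp: \<G>_def)
  have over: "{x. overdense s x G} \<in> sets borel" if "G \<in> \<G>" for G
  proof -
    have "{x. overdense s x G} = (\<Union>j\<in>{j. s j \<le> card (verts G) \<and> j \<le> card (verts G)}. {..1 - 1 / real (Suc j)} \<inter> {x. uniformly_dense (x + 1 / real (Suc j)) (1 / real (Suc (s j))) G})"
      unfolding overdense_def by (auto simp: algebra_simps)
    also have "\<dots> \<in> sets borel"
    proof (rule sets.countable_UN'')
      fix j
      have "{x. uniformly_dense (x + 1 / real (Suc j)) (1 / real (Suc (s j))) G} \<in> sets borel"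
        by (rule uniformly_dense_borel) (use that in \<open>simp add: \<G>_def\<close>)
      then show "{..1 - 1 / real (Suc j)} \<inter> {x. uniformly_dense (x + 1 / real (Suc j)) (1 / real (Suc (s j))) G} \<in> sets borel"
        by (intro sets.Int) auto
    qed auto
    finally show ?thesis .
  qed
  have "{x. density_witness m s H x} = (if m \<le> card (verts H) then
      {x. uniformly_dense (x + (- 1 / real (Suc m))) (1 / real (Suc m)) H} - (\<Union>G\<in>\<G>. {x. overdense s x G}) else {})"
    unfolding density_witness_def \<G>_def by auto
  also have "\<dots> \<in> sets borel"
  proof -
    have "(\<Union>G\<in>\<G>. {x. overdense s x G}) \<in> sets borel" by (rule sets.countable_UN''[OF cG over])
    then show ?thesis using uniformly_dense_borel[OF assms] by (simp only: sets.Diff sets.empty_sets split: if_splits) simp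
  qed
  finally show ?thesis .
qed

text \<open>Subgraphs of \<open>H\<close> have at most as many vertices as \<open>H\<close>. A finite initial segment of \<open>s\<close> therefore decides
  the condition, as a Souslin scheme requires.\<close>

lemma density_witness_cong:
  assumes "three_graph H" "\<And>j. j \<le> card (verts H) \<Longrightarrow> s j = s' j"
  shows "density_witness m s H x \<longleftrightarrow> density_witness m s' H x"
proof -
  have "overdense s x G \<longleftrightarrow> overdense s' x G" if "contains_copy H G" for G
  proof -
    have eq: "s j = s' j" if "j \<le> card (verts G)" for j
      using assms(2) card_verts_copy_le[OF \<open>contains_copy H G\<close> assms(1)] that by simp
    show ?thesis unfolding overdense_def by (intro ex_cong1 iffI; elim conjE; simp add: eq)
  qed
  then show ?thesis unfolding density_witness_def by blast
qed

text \<open>A branch \<open>t\<close> of the scheme encodes the sequence \<open>s\<close> together with the index of a witness for each \<open>m\<close>. The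
  set attached to a finite sequence imposes the conditions for those witnesses that are decided by it,
  namely those with fewer vertices than the sequence has entries.\<close>

lemma uniform_turan_densities_measurable: "uniform_turan_densities \<in> sets lebesgue"
proof -
  define \<H> where "\<H> = {H :: nat hgraph. three_graph H}"
  have ne: "\<H> \<noteq> {}"
  proof -
    have "\<lparr>verts = {}, edges = {}\<rparr> \<in> \<H>" by (simp add: \<H>_def three_graph_def)
    then show ?thesis by blast
  qed
  have cH: "countable \<H>" unfolding \<H>_def by (rule countable_three_graphs)
  define G where "G = from_nat_into \<H>"
  have G: "three_graph (G i)" for i using from_nat_into[OF ne, of i] by (simp add: G_def \<H>_def)
  have Gsurj: "\<exists>i. H = G i" if "three_graph H" for H
    using from_nat_into_surj[OF cH, of H] that by (auto simp: G_def \<H>_def)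
  \<comment> \<open>The part of \<open>s\<close> known from a finite sequence; the conditions in \<open>A\<close> below read only entries inside
    the sequence, so the default \<open>0\<close> is harmless.\<close>
  define sq where "sq = (\<lambda>l j. if j < length l then fst (prod_decode (l ! j)) else 0)"
  define A where "A = (\<lambda>l. {0<..<1} \<inter> (\<Inter>i\<in>{i. i < length l \<and> card (verts (G (snd (prod_decode (l ! i))))) < length l}.
      {x. density_witness i (sq l) (G (snd (prod_decode (l ! i)))) x}))"
  have Aborel: "A l \<in> sets borel" for l
  proof (cases "{i. i < length l \<and> card (verts (G (snd (prod_decode (l ! i))))) < length l} = {}")
    case True
    then show ?thesis unfolding A_def True by simp
  next
    case False
    then show ?thesis unfolding A_def
      by (intro sets.Int sets.countable_INT'' sets.finite_INT density_witness_borel G) auto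
  qed
  have eq: "uniform_turan_densities \<inter> {0<..<1} = (\<Union>t :: nat \<Rightarrow> nat. \<Inter>k. A (map t [0..<k]))"
  proof (intro equalityI subsetI)
    fix x assume x: "x \<in> uniform_turan_densities \<inter> {0<..<1}"
    then obtain s where s: "\<And>m. \<exists>H. three_graph H \<and> density_witness m s H x"
      using density_iff_witnesses[of x] by auto
    have "\<exists>i. density_witness m s (G i) x" for m using s[of m] Gsurj by metis
    then obtain h where h: "\<And>m. density_witness m s (G (h m)) x" by metis
    define t where "t = (\<lambda>k. prod_encode (s k, h k))"
    have "x \<in> A (map t [0..<k])" for k
    proof -
      have "density_witness i (sq (map t [0..<k])) (G (h i)) x" if "i < k" "card (verts (G (h i))) < k" for i
      proof -
        have "sq (map t [0..<k]) j = s j" if "j \<le> card (verts (G (h i)))" for j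
          using that \<open>card (verts (G (h i))) < k\<close> by (simp add: sq_def t_def)
        then show ?thesis using h[of i] density_witness_cong[OF G, of "h i" "sq (map t [0..<k])" s i x] by simp
      qed
      then show ?thesis using x by (auto simp: A_def t_def)
    qed
    then show "x \<in> (\<Union>t :: nat \<Rightarrow> nat. \<Inter>k. A (map t [0..<k]))" by blast
  next
    fix x assume "x \<in> (\<Union>t :: nat \<Rightarrow> nat. \<Inter>k. A (map t [0..<k]))"
    then obtain t :: "nat \<Rightarrow> nat" where t: "\<And>k. x \<in> A (map t [0..<k])" by blast
    have x01: "0 < x" "x < 1" using t[of 0] by (auto simp: A_def)
    define s where "s = (\<lambda>j. fst (prod_decode (t j)))"
    define h where "h = (\<lambda>i. snd (prod_decode (t i)))"
    have "density_witness m s (G (h m)) x" for m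
    proof -
      \<comment> \<open>The condition on the witness for \<open>m\<close> first appears at this level.\<close>
      define k where "k = Suc (max m (card (verts (G (h m)))))"
      have mk: "m < k" "card (verts (G (h m))) < k" by (simp_all add: k_def)
      have "x \<in> (\<Inter>i\<in>{i. i < length (map t [0..<k]) \<and> card (verts (G (snd (prod_decode (map t [0..<k] ! i))))) < length (map t [0..<k])}.
          {x. density_witness i (sq (map t [0..<k])) (G (snd (prod_decode (map t [0..<k] ! i)))) x})"
        using t[of k] unfolding A_def by (rule IntD2)
      then have "x \<in> {x. density_witness m (sq (map t [0..<k])) (G (snd (prod_decode (map t [0..<k] ! m)))) x}"
        by (rule INT_D) (use mk in \<open>simp add: h_def\<close>)
      then have "density_witness m (sq (map t [0..<k])) (G (h m)) x" using mk by (simp add: h_def)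
      moreover have "sq (map t [0..<k]) j = s j" if "j \<le> card (verts (G (h m)))" for j
      proof -
        have "j < k" using that by (simp add: k_def)
        then show ?thesis by (simp add: sq_def s_def)
      qed
      ultimately show ?thesis using density_witness_cong[OF G, of "h m" "sq (map t [0..<k])" s m x] by simp
    qed
    then have "x \<in> uniform_turan_densities" using density_iff_witnesses[OF x01] G by blast
    then show "x \<in> uniform_turan_densities \<inter> {0<..<1}" using x01 by simp
  qed
  have "(\<Union>t :: nat \<Rightarrow> nat. \<Inter>k. A (map t [0..<k])) \<in> sets lebesgue"
  proof (rule souslin_operation_lebesgue)
    show "A l \<in> sets lebesgue" for l using Aborel[of l] by (simp add: sets_completionI_sets)
    show "{0<..<1::real} \<in> sets lebesgue" by simp
    show "emeasure lebesgue {0<..<1::real} < \<infinity>" by simp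
    show "A l \<subseteq> {0<..<1}" for l by (auto simp: A_def)
  qed
  then have 1: "uniform_turan_densities \<inter> {0<..<1} \<in> sets lebesgue" by (simp only: eq)
  have "finite (uniform_turan_densities \<inter> {0, 1})" by simp
  then have 2: "uniform_turan_densities \<inter> {0, 1} \<in> sets lebesgue"
    by (intro sets_completionI_sets) (auto intro: finite_imp_closed borel_closed)
  have "uniform_turan_densities = (uniform_turan_densities \<inter> {0<..<1}) \<union> (uniform_turan_densities \<inter> {0, 1})"
    using uniform_turan_densities_subset by force
  then show ?thesis using sets.Un[OF 1 2] by simp
qed

section \<open>Hausdorff dimension\<close>

text \<open>Cover \<open>[0, 1]\<close> by \<open>N\<close> intervals of length \<open>1 / N\<close>; then \<open>N * (1 / N) powr s\<close> tends to zero.\<close>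

lemma hausdorff_measure_zero_above_one:
  fixes A :: "real set"
  assumes A: "A \<subseteq> {0..1}" and s: "1 < s"
  shows "hausdorff_measure s A = 0"
proof -
  have "hausdorff_premeasure s \<epsilon> A \<le> 0" if \<epsilon>: "0 < \<epsilon>" for \<epsilon>
  proof (rule tendsto_lowerbound)
    show "((\<lambda>n. ennreal (real (Suc n) powr (1 - s))) \<longlongrightarrow> 0) sequentially"
    proof -
      have "((\<lambda>n. real n powr (1 - s)) \<longlongrightarrow> 0) sequentially"
        using s by (intro tendsto_neg_powr filterlim_real_sequentially) auto
      then have "((\<lambda>n. real (Suc n) powr (1 - s)) \<longlongrightarrow> 0) sequentially" by (rule LIMSEQ_Suc)
      then show ?thesis using tendsto_ennrealI by fastforce
    qed
    obtain k where k: "1 / real (Suc k) < \<epsilon>" using nat_approx_posE[OF \<epsilon>] by blast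
    show "\<forall>\<^sub>F n in sequentially. hausdorff_premeasure s \<epsilon> A \<le> ennreal (real (Suc n) powr (1 - s))"
      using eventually_ge_at_top[of k]
    proof eventually_elim
      case (elim n)
      define N where "N = Suc n"
      have N: "0 < N" "1 / real N \<le> \<epsilon>"
      proof -
        have "1 / real N \<le> 1 / real (Suc k)" using elim by (simp add: N_def frac_le)
        then show "1 / real N \<le> \<epsilon>" using k by linarith
      qed (simp add: N_def)
      define U where "U = (\<lambda>i. if i < N then {real i / real N..real (Suc i) / real N} else {})"
      have diam: "diameter (U i) = (if i < N then 1 / real N else 0)" for i
        using N by (simp add: U_def field_simps divide_strict_right_mono)
      have cover: "A \<subseteq> (\<Union>i. U i)"
      proof
        fix x assume "x \<in> A"
        then have x: "0 \<le> x" "x \<le> 1" using A by auto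
        define i where "i = (if x = 1 then N - 1 else nat \<lfloor>x * real N\<rfloor>)"
        have "i < N \<and> real i \<le> x * real N \<and> x * real N \<le> real (Suc i)"
        proof (cases "x = 1")
          case True
          then show ?thesis using N by (simp add: i_def of_nat_diff)
        next
          case False
          then have "x * real N < 1 * real N" using x N by (intro mult_strict_right_mono) auto
          moreover have "0 \<le> x * real N" using x by simp
          ultimately show ?thesis using False unfolding i_def by (simp add: floor_less_iff) linarith
        qed
        then have "x \<in> U i" using N by (simp add: U_def field_simps)
        then show "x \<in> (\<Union>i. U i)" by blast
      qed
      have "(\<Sum>i. diam_power s (U i)) = (\<Sum>i<N. diam_power s (U i))"
        by (rule suminf_finite) (auto simp: U_def diam_power_def)
      also have "\<dots> = (\<Sum>i<N. ennreal ((1 / real N) powr s))"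
      proof (intro sum.cong refl)
        fix i assume i: "i \<in> {..<N}"
        have "U i \<noteq> {}" using i N by (simp add: U_def divide_right_mono)
        then show "diam_power s (U i) = ennreal ((1 / real N) powr s)" using i s by (simp add: diam_power_def diam)
      qed
      also have "\<dots> = ennreal (real N * (1 / real N) powr s)" by (simp add: ennreal_mult ennreal_of_nat_eq_real_of_nat)
      also have "real N * (1 / real N) powr s = real N powr (1 - s)"
        using N by (simp add: powr_divide powr_diff)
      finally have sum: "(\<Sum>i. diam_power s (U i)) = ennreal (real N powr (1 - s))" .
      have "bounded (U i) \<and> diameter (U i) \<le> \<epsilon>" for i
        using N \<epsilon> unfolding diam by (auto simp: U_def)
      then have "hausdorff_premeasure s \<epsilon> A \<le> (\<Sum>i. diam_power s (U i))"
        unfolding hausdorff_premeasure_def using cover by (intro Inf_lower) blast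
      then show ?case by (simp only: sum N_def)
    qed
  qed simp
  then have "hausdorff_measure s A \<le> 0" unfolding hausdorff_measure_def by (intro SUP_least) auto
  then show ?thesis by simp
qed

lemma diameter_le_diam_power:
  fixes U :: "real set"
  assumes "bounded U" "diameter U \<le> 1" "0 \<le> s" "s \<le> 1"
  shows "ennreal (diameter U) \<le> diam_power s U"
proof -
  have d0: "0 \<le> diameter U" using assms(1) by (rule diameter_ge_0)
  show ?thesis
  proof (cases "U = {} \<or> s = 0 \<or> diameter U = 0")
    case True
    then show ?thesis using assms(2) by (auto simp: diam_power_def)
  next
    case False
    then have "diameter U powr 1 \<le> diameter U powr s" using assms d0 by (intro powr_mono') auto
    then show ?thesis using False d0 by (simp add: diam_power_def ennreal_leI)
  qed
qed

lemma bounded_subset_interval_diameter: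
  fixes U :: "real set"
  assumes "bounded U"
  shows "\<exists>a b. U \<subseteq> {a..b} \<and> emeasure lborel {a..b} \<le> ennreal (diameter U)"
proof (cases "U = {}")
  case True
  then show ?thesis by (intro exI[of _ 1] exI[of _ 0]) simp
next
  case False
  have bd: "bdd_above U" "bdd_below U" using assms by (auto intro: bounded_imp_bdd_above bounded_imp_bdd_below)
  have le: "x - y \<le> diameter U" if "x \<in> U" "y \<in> U" for x y
    using diameter_bounded_bound[OF assms that] by (simp add: dist_real_def)
  have "Sup U \<le> diameter U + Inf U"
  proof (rule cSup_least[OF False])
    fix x assume x: "x \<in> U"
    have "x - diameter U \<le> Inf U" by (rule cInf_greatest[OF False]) (use le x in force)
    then show "x \<le> diameter U + Inf U" by simp
  qed
  moreover have "Inf U \<le> Sup U" using False bd by (rule cInf_le_cSup)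
  ultimately have "emeasure lborel {Inf U..Sup U} \<le> ennreal (diameter U)" by (simp add: ennreal_leI)
  moreover have "U \<subseteq> {Inf U..Sup U}" using bd by (auto intro: cInf_lower cSup_upper)
  ultimately show ?thesis by blast
qed

text \<open>For diameters at most one and \<open>s \<le> 1\<close>, the \<open>s\<close>-th power of the diameter is at least the diameter, and
  diameters of a cover sum to at least the Lebesgue measure of the interval.\<close>

lemma hausdorff_measure_pos_below_one:
  fixes A :: "real set"
  assumes A: "{a..b} \<subseteq> A" "a < b" and s: "0 \<le> s" "s \<le> 1"
  shows "hausdorff_measure s A \<noteq> 0"
proof -
  have "ennreal (b - a) \<le> hausdorff_premeasure s 1 A"
    unfolding hausdorff_premeasure_def
  proof (rule Inf_greatest)
    fix z assume "z \<in> {\<Sum>i. diam_power s (U i) | U :: nat \<Rightarrow> real set. A \<subseteq> (\<Union>i. U i) \<and> (\<forall>i. bounded (U i) \<and> diameter (U i) \<le> 1)}"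
    then obtain U :: "nat \<Rightarrow> real set" where U: "z = (\<Sum>i. diam_power s (U i))" "A \<subseteq> (\<Union>i. U i)"
      "\<And>i. bounded (U i)" "\<And>i. diameter (U i) \<le> 1"
      by blast
    have "\<exists>V. U i \<subseteq> V \<and> V \<in> sets lborel \<and> emeasure lborel V \<le> ennreal (diameter (U i))" for i
      using bounded_subset_interval_diameter[OF U(3)[of i]] by (metis atLeastAtMost_borel sets_lborel)
    then obtain V where V: "\<And>i. U i \<subseteq> V i" "\<And>i. V i \<in> sets lborel" "\<And>i. emeasure lborel (V i) \<le> ennreal (diameter (U i))"
      by metis
    have "ennreal (b - a) = emeasure lborel {a..b}" using A by simp
    also have "\<dots> \<le> emeasure lborel (\<Union>i. V i)"
    proof (rule emeasure_mono)
      show "{a..b} \<subseteq> (\<Union>i. V i)" using A(1) U(2) V(1) by blast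
      show "(\<Union>i. V i) \<in> sets lborel" using V(2) by blast
    qed
    also have "\<dots> \<le> (\<Sum>i. emeasure lborel (V i))" using V(2) by (intro emeasure_subadditive_countably) auto
    also have "\<dots> \<le> (\<Sum>i. diam_power s (U i))"
      by (intro suminf_le summableI order_trans[OF V(3)] diameter_le_diam_power U s)
    finally show "ennreal (b - a) \<le> z" using U(1) by simp
  qed
  also have "\<dots> \<le> hausdorff_measure s A" unfolding hausdorff_measure_def by (rule SUP_upper) simp
  finally show ?thesis using A(2) by (auto simp: ennreal_eq_0_iff)
qed

lemma hausdorff_dim_eq_one:
  fixes A :: "real set"
  assumes "{a..b} \<subseteq> A" "a < b" "A \<subseteq> {0..1}"
  shows "hausdorff_dim A = 1"
  unfolding hausdorff_dim_def
proof (rule antisym)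
  show "Inf {ennreal s | s. 0 \<le> s \<and> hausdorff_measure s A = 0} \<le> 1"
  proof (rule tendsto_lowerbound)
    have "((\<lambda>n. ennreal (1 + 1 / real (Suc n))) \<longlongrightarrow> ennreal (1 + 0)) sequentially"
      by (intro tendsto_ennrealI tendsto_add tendsto_const LIMSEQ_Suc[OF lim_1_over_n])
    then show "((\<lambda>n. ennreal (1 + 1 / real (Suc n))) \<longlongrightarrow> 1) sequentially" by simp
    show "\<forall>\<^sub>F n in sequentially. Inf {ennreal s | s. 0 \<le> s \<and> hausdorff_measure s A = 0} \<le> ennreal (1 + 1 / real (Suc n))"
    proof (intro always_eventually allI Inf_lower CollectI exI conjI)
      fix n :: nat
      show "hausdorff_measure (1 + 1 / real (Suc n)) A = 0"
        by (rule hausdorff_measure_zero_above_one[OF assms(3)]) simp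
    qed auto
  qed simp
  show "1 \<le> Inf {ennreal s | s. 0 \<le> s \<and> hausdorff_measure s A = 0}"
  proof (rule Inf_greatest, clarify)
    fix s :: real assume "0 \<le> s" "hausdorff_measure s A = 0"
    then have "1 \<le> s" using hausdorff_measure_pos_below_one[OF assms(1,2), of s] by fastforce
    then show "1 \<le> ennreal s" by simp
  qed
qed

theorem theorem1p1:
  "(\<exists>\<delta>::real. \<delta> > 0 \<and> {1 - \<delta>..1} \<subseteq> uniform_turan_densities) \<and>
   emeasure lebesgue uniform_turan_densities > 0 \<and>
   hausdorff_dim uniform_turan_densities = 1"
proof -
  obtain \<delta> :: real where \<delta>: "0 < \<delta>" "{1 - \<delta>..1} \<subseteq> uniform_turan_densities"
    using interval_in_uniform_turan_densities by blast
  have "0 < emeasure lebesgue {1 - \<delta>..1}" using \<delta>(1) by simp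
  also have "\<dots> \<le> emeasure lebesgue uniform_turan_densities"
    by (rule emeasure_mono[OF \<delta>(2) uniform_turan_densities_measurable])
  finally have "0 < emeasure lebesgue uniform_turan_densities" .
  moreover have "hausdorff_dim uniform_turan_densities = 1"
    by (rule hausdorff_dim_eq_one[OF \<delta>(2) _ uniform_turan_densities_subset]) (use \<delta>(1) in simp)
  ultimately show ?thesis using \<delta> by blast
qed

end
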